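(* Let $X=\{X_t\}_{t\ge 0}$ be a càdlàg Feller process with state-space $\mathbb{R}^n$, semigroup $(P_t)_{t\ge0}$ and infinitesimal generator $\mathcal{L}$ with dense domain $\mathcal{D}(\mathcal{L})\subset C_0(\mathbb{R}^n)$. Let $Z=\{Z_t\}_{t\ge0}$ be an additive subordinator, independent of $X$, with Laplace exponent $\log \mathbf{E}[e^{-uZ_t}]=\int_0^t\psi_s(u)\,ds$ for $u\in\mathbb{C}$ with $\Re(u)\ge 0$, where $$\psi_s(u)=-u\beta(s)+\int_{(0,\infty)}(e^{-ur}-1)\,g(s,r)\,dr ,$$ $\beta:\mathbb{R}_+\to\mathbb{R}_+$ and $g:\mathbb{R}_+\times\mathbb{R}_+\to\mathbb{R}_+$ are continuous, and $\int_{(0,\infty)}(1\wedge r)\,g(s,r)\,dr<\infty$ for all $s\in\mathbb{R}_+$. Define $(D,Y)=\{(D_t,Y_t)\}_{t\ge0}$ by $D_t:=D_0+t$ and $Y_t:=X_{Z_{D_t}}$, where $D_0\in\mathbb{R}_+$. Then the process $(D,Y)$ is Feller with state-space $\mathbb{R}_+\times\mathbb{R}^n$ and infinitesimal generator $\mathcal{L}'$, defined on a dense subspace of the Banach space $C_0(\mathbb{R}_+\times\mathbb{R}^n)$, given by $$\mathcal{L}'f(s,x)=\frac{\partial f}{\partial s}(s,x)+\beta(s)\,\mathcal{L}f_s(x)+\int_{(0,\infty)}\big[P_rf_s(x)-f(s,x)\big]\,g(s,r)\,dr$$ for every $f\in C_0(\mathbb{R}_+\times\mathbb{R}^n)$ such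 that $f_s(\cdot):=f(s,\cdot)\in\mathcal{D}(\mathcal{L})$ for all $s\in\mathbb{R}_+$ and such that the functions $(s,x)\mapsto\mathcal{L}f_s(x)$ and $(s,x)\mapsto\frac{\partial f}{\partial s}(s,x)$ are continuous and vanish at infinity.
   Context: $\mathbb{R}_+=[0,\infty)$ and $n\in\mathbb{N}$. $C_0(E)$, for $E=\mathbb{R}^n$ or $E=\mathbb{R}_+\times\mathbb{R}^n$, is the Banach space of real continuous functions on $E$ vanishing at infinity with the supremum norm. The semigroup of $X$ is $P_tf(x)=\mathbf{E}^x[f(X_t)]$ for $f\in C_0(\mathbb{R}^n)$, where $\mathbf{E}^x$ is the expectation with respect to the law of $X$ started at $X_0=x$. A Markov process with state-space $E$ is Feller if its transition semigroup is a strongly continuous contraction semigroup of positive operators on $C_0(E)$; its infinitesimal generator is the generator of this semigroup. The semigroup of $(D,Y)$ is $Q_tf(s,x)=\mathbf{E}[f(D_t,Y_t)\mid D_0=s,\,Y_0=x]$. An additive subordinator is a càdlàg process with nondecreasing paths in $\mathbb{R}_+$ and independent (possibly nonstationary) increments: $Z_t-Z_s$ is independent of $Z_u$ for all $0\le u\le s<t$. The value $Z_0=0$ a.s. is implied by the formula for the Laplace exponent.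
   Formalization: The generator formula is asserted only for those listed f whose right-hand side lies in C_0(R_+ x R^n), as it can fail otherwise (e.g. unbounded beta); independent increments means Z_t - Z_s is independent of the whole past (Z_u), u<=s. *)

theory Defs
  imports "HOL-Probability.Probability"
begin

section \<open>Semigroups on \<open>C\<^sub>0(E)\<close>\<close>

text \<open>
  A state space is a subset \<open>E\<close> of a type. An element of \<open>C\<^sub>0(E)\<close> is represented by its
  extension by zero to the whole type, so that equality of functions is equality in \<open>C\<^sub>0(E)\<close>.
\<close>

definition zero_ext :: "'b set \<Rightarrow> ('b \<Rightarrow> real) \<Rightarrow> 'b \<Rightarrow> real" where
  "zero_ext E h = (\<lambda>z. if z \<in> E then h z else 0)"

definition C0 :: "'b::topological_space set \<Rightarrow> ('b \<Rightarrow> real) set" where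
  "C0 E = {f. continuous_on E f \<and>
              (\<forall>\<epsilon>>0. \<exists>K. compact K \<and> K \<subseteq> E \<and> (\<forall>z\<in>E - K. \<bar>f z\<bar> < \<epsilon>)) \<and>
              (\<forall>z. z \<notin> E \<longrightarrow> f z = 0)}"

definition supnorm :: "'b set \<Rightarrow> ('b \<Rightarrow> real) \<Rightarrow> real" where
  "supnorm E f = (SUP z\<in>E. \<bar>f z\<bar>)"

definition feller_semigroup ::
  "'b::topological_space set \<Rightarrow> (real \<Rightarrow> ('b \<Rightarrow> real) \<Rightarrow> 'b \<Rightarrow> real) \<Rightarrow> bool" where
  "feller_semigroup E T \<longleftrightarrow>
     (\<forall>t\<ge>0. \<forall>f\<in>C0 E. T t f \<in> C0 E) \<and>
     (\<forall>t\<ge>0. \<forall>f\<in>C0 E. \<forall>h\<in>C0 E. \<forall>a b.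
        T t (\<lambda>z. a * f z + b * h z) = (\<lambda>z. a * T t f z + b * T t h z)) \<and>
     (\<forall>t\<ge>0. \<forall>f\<in>C0 E. supnorm E (T t f) \<le> supnorm E f) \<and>
     (\<forall>t\<ge>0. \<forall>f\<in>C0 E. (\<forall>z\<in>E. 0 \<le> f z) \<longrightarrow> (\<forall>z\<in>E. 0 \<le> T t f z)) \<and>
     (\<forall>f\<in>C0 E. T 0 f = f) \<and>
     (\<forall>s\<ge>0. \<forall>t\<ge>0. \<forall>f\<in>C0 E. T (s + t) f = T s (T t f)) \<and>
     (\<forall>f\<in>C0 E. ((\<lambda>t. supnorm E (\<lambda>z. T t f z - f z)) \<longlongrightarrow> 0) (at_right 0))"

definition generator_graph ::
  "'b::topological_space set \<Rightarrow> (real \<Rightarrow> ('b \<Rightarrow> real) \<Rightarrow> 'b \<Rightarrow> real) \<Rightarrow>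
   ('b \<Rightarrow> real) \<Rightarrow> ('b \<Rightarrow> real) \<Rightarrow> bool" where
  "generator_graph E T f h \<longleftrightarrow> f \<in> C0 E \<and> h \<in> C0 E \<and>
     ((\<lambda>t. supnorm E (\<lambda>z. (T t f z - f z) / t - h z)) \<longlongrightarrow> 0) (at_right 0)"

definition generator_dom ::
  "'b::topological_space set \<Rightarrow> (real \<Rightarrow> ('b \<Rightarrow> real) \<Rightarrow> 'b \<Rightarrow> real) \<Rightarrow> ('b \<Rightarrow> real) set" where
  "generator_dom E T = {f. \<exists>h. generator_graph E T f h}"

definition generator ::
  "'b::topological_space set \<Rightarrow> (real \<Rightarrow> ('b \<Rightarrow> real) \<Rightarrow> 'b \<Rightarrow> real) \<Rightarrow>
   ('b \<Rightarrow> real) \<Rightarrow> 'b \<Rightarrow> real" where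
  "generator E T f = (THE h. generator_graph E T f h)"

definition dense_in_C0 :: "'b::topological_space set \<Rightarrow> ('b \<Rightarrow> real) set \<Rightarrow> bool" where
  "dense_in_C0 E S \<longleftrightarrow> S \<subseteq> C0 E \<and>
     (\<forall>f\<in>C0 E. \<forall>\<epsilon>>0. \<exists>h\<in>S. supnorm E (\<lambda>z. f z - h z) < \<epsilon>)"


section \<open>Processes\<close>

definition generated_by ::
  "'w measure \<Rightarrow> real set \<Rightarrow> (real \<Rightarrow> 'w \<Rightarrow> 'b::topological_space) \<Rightarrow> 'w measure" where
  "generated_by M I U =
     sigma (space M) (\<Union>u\<in>I. {U u -` A \<inter> space M | A. A \<in> sets borel})"

abbreviation natural_filtration ::
  "'w measure \<Rightarrow> (real \<Rightarrow> 'w \<Rightarrow> 'b::topological_space) \<Rightarrow> real \<Rightarrow> 'w measure" where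
  "natural_filtration M U t \<equiv> generated_by M {0..t} U"

text \<open>
  \<open>U\<close> is, under \<open>M\<close> and with whatever initial law it has there, a time-homogeneous Markov
  process in \<open>E\<close> with transition semigroup \<open>T\<close>. For \<open>t = 0\<close> the last clause says that
  \<open>T h f\<close> is a version of the conditional expectation of \<open>f(U\<^sub>h)\<close> given \<open>U\<^sub>0\<close>.
\<close>

definition markov_process ::
  "'w measure \<Rightarrow> 'b::topological_space set \<Rightarrow> (real \<Rightarrow> 'w \<Rightarrow> 'b) \<Rightarrow>
   (real \<Rightarrow> ('b \<Rightarrow> real) \<Rightarrow> 'b \<Rightarrow> real) \<Rightarrow> bool" where
  "markov_process M E U T \<longleftrightarrow> prob_space M \<and>
     (\<forall>t\<ge>0. U t \<in> borel_measurable M) \<and>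
     (\<forall>t\<ge>0. \<forall>\<omega>\<in>space M. U t \<omega> \<in> E) \<and>
     (\<forall>t\<ge>0. \<forall>h\<ge>0. \<forall>f\<in>C0 E. AE \<omega> in M.
        real_cond_exp M (natural_filtration M U t) (\<lambda>\<omega>. f (U (t + h) \<omega>)) \<omega> = T h f (U t \<omega>))"

definition feller_process ::
  "'w measure \<Rightarrow> 'b::topological_space set \<Rightarrow> (real \<Rightarrow> 'w \<Rightarrow> 'b) \<Rightarrow>
   (real \<Rightarrow> ('b \<Rightarrow> real) \<Rightarrow> 'b \<Rightarrow> real) \<Rightarrow> bool" where
  "feller_process M E U T \<longleftrightarrow> markov_process M E U T \<and> feller_semigroup E T"

definition cadlag :: "(real \<Rightarrow> 'b::topological_space) \<Rightarrow> bool" where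
  "cadlag p \<longleftrightarrow> (\<forall>t\<ge>0. continuous (at_right t) p) \<and> (\<forall>t>0. \<exists>l. (p \<longlongrightarrow> l) (at_left t))"

definition additive_subordinator :: "'w measure \<Rightarrow> (real \<Rightarrow> 'w \<Rightarrow> real) \<Rightarrow> bool" where
  "additive_subordinator M Z \<longleftrightarrow>
     (\<forall>t\<ge>0. Z t \<in> borel_measurable M) \<and>
     (\<forall>\<omega>\<in>space M. cadlag (\<lambda>t. Z t \<omega>) \<and> mono_on {0..} (\<lambda>t. Z t \<omega>) \<and> (\<forall>t\<ge>0. 0 \<le> Z t \<omega>)) \<and>
     (\<forall>s\<ge>0. \<forall>t>s. prob_space.indep_set M
        (sets (vimage_algebra (space M) (\<lambda>\<omega>. Z t \<omega> - Z s \<omega>) borel))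
        (sets (natural_filtration M Z s)))"

definition indep_processes ::
  "'w measure \<Rightarrow> (real \<Rightarrow> 'w \<Rightarrow> 'b::topological_space) \<Rightarrow>
   (real \<Rightarrow> 'w \<Rightarrow> 'c::topological_space) \<Rightarrow> bool" where
  "indep_processes M U V \<longleftrightarrow> prob_space.indep_set M
     (sets (generated_by M {0..} U)) (sets (generated_by M {0..} V))"

definition psi :: "(real \<Rightarrow> real) \<Rightarrow> (real \<Rightarrow> real \<Rightarrow> real) \<Rightarrow> real \<Rightarrow> complex \<Rightarrow> complex" where
  "psi \<beta> g s u = - u * complex_of_real (\<beta> s) +
     (LINT r:{0<..}|lborel. (exp (- u * complex_of_real r) - 1) * complex_of_real (g s r))"

text \<open>
  Integrability of \<open>s \<mapsto> \<psi>\<^sub>s(u)\<close> has to be stated: the integral of a non-integrable function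
  is \<open>0\<close> by convention. The complex logarithm of the Laplace transform is taken to be the given
  integral, i.e. the branch is fixed by exponentiating.
\<close>

definition has_laplace_exponent ::
  "'w measure \<Rightarrow> (real \<Rightarrow> 'w \<Rightarrow> real) \<Rightarrow> (real \<Rightarrow> complex \<Rightarrow> complex) \<Rightarrow> bool" where
  "has_laplace_exponent M Z \<psi> \<longleftrightarrow> (\<forall>t\<ge>0. \<forall>u. 0 \<le> Re u \<longrightarrow>
     set_integrable lborel {0..t} (\<lambda>s. \<psi> s u) \<and>
     (LINT \<omega>|M. exp (- u * complex_of_real (Z t \<omega>))) = exp (LINT s:{0..t}|lborel. \<psi> s u))"


section \<open>The time-changed process\<close>

definition semigroup_of ::
  "('b \<Rightarrow> 'w measure) \<Rightarrow> (real \<Rightarrow> 'w \<Rightarrow> 'b) \<Rightarrow> real \<Rightarrow> ('b \<Rightarrow> real) \<Rightarrow> 'b \<Rightarrow> real" where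
  "semigroup_of M X t f x = (LINT \<omega>|M x. f (X t \<omega>))"

abbreviation time_space :: "(real \<times> 'b) set" where
  "time_space \<equiv> {0..} \<times> UNIV"

text \<open>The process \<open>(D, Y)\<close> with \<open>D\<^sub>0 = s\<close>.\<close>

definition DY ::
  "(real \<Rightarrow> 'w \<Rightarrow> 'b) \<Rightarrow> (real \<Rightarrow> 'w \<Rightarrow> real) \<Rightarrow> real \<Rightarrow> real \<Rightarrow> 'w \<Rightarrow> real \<times> 'b" where
  "DY X Z s t \<omega> = (s + t, X (Z (s + t) \<omega>) \<omega>)"

text \<open>
  \<open>Q\<^sub>t f(s,x) = E[f(D\<^sub>t, Y\<^sub>t) | D\<^sub>0 = s, Y\<^sub>0 = x]\<close>: given \<open>X\<close> is at \<open>x\<close> at time \<open>Z\<^sub>s\<close>, it is restarted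
  at \<open>x\<close> and then observed after the further time \<open>Z\<^sub>s\<^sub>+\<^sub>t - Z\<^sub>s\<close>. This fixes a version for every
  \<open>(s,x)\<close>, also where the law of \<open>X\<close> at time \<open>Z\<^sub>s\<close> does not charge a neighbourhood of \<open>x\<close>. That it
  really is a version of the conditional expectation of \<open>(D, Y)\<close>, under every starting law, is part
  of \<open>feller_process\<close> for \<open>DY\<close> with this semigroup.
\<close>

definition DY_semigroup ::
  "('b \<Rightarrow> 'w measure) \<Rightarrow> (real \<Rightarrow> 'w \<Rightarrow> 'b) \<Rightarrow> (real \<Rightarrow> 'w \<Rightarrow> real) \<Rightarrow>
   real \<Rightarrow> (real \<times> 'b \<Rightarrow> real) \<Rightarrow> real \<times> 'b \<Rightarrow> real" where
  "DY_semigroup M X Z t f = zero_ext time_space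
     (\<lambda>(s, x). LINT \<omega>|M x. f (s + t, X (Z (s + t) \<omega> - Z s \<omega>) \<omega>))"

text \<open>
  The right-hand side of the generator formula, with \<open>f'\<close> standing for the time derivative of \<open>f\<close>.
  A generator takes values in \<open>C\<^sub>0\<close>, and for this expression membership in \<open>C\<^sub>0\<close> is a genuine
  condition on \<open>f\<close>: it can fail when \<open>\<beta>\<close> is unbounded, or when \<open>s \<mapsto> \<integral>(1 \<and> r) g(s,r) dr\<close> is
  unbounded or discontinuous, even if \<open>L f\<^sub>s(x)\<close> and \<open>f'\<close> are in \<open>C\<^sub>0\<close>.
\<close>

definition DY_generator_formula ::
  "('b::topological_space \<Rightarrow> 'w measure) \<Rightarrow> (real \<Rightarrow> 'w \<Rightarrow> 'b) \<Rightarrow> (real \<Rightarrow> real) \<Rightarrow>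
   (real \<Rightarrow> real \<Rightarrow> real) \<Rightarrow> (real \<times> 'b \<Rightarrow> real) \<Rightarrow> (real \<times> 'b \<Rightarrow> real) \<Rightarrow> real \<times> 'b \<Rightarrow> real" where
  "DY_generator_formula M X \<beta> g f f' = zero_ext time_space (\<lambda>(s, x).
     f' (s, x) + \<beta> s * generator UNIV (semigroup_of M X) (\<lambda>y. f (s, y)) x +
     (LINT r:{0<..}|lborel. (semigroup_of M X r (\<lambda>y. f (s, y)) x - f (s, x)) * g s r))"

end

theory Submission
  imports Defs
begin

text \<open>
  Rounding random times to a grid shows that \<open>X\<close>, being independent of \<open>Z\<close>, is Markov at the random
  times \<open>Z\<^sub>t\<close>. Hence \<open>Q\<^sub>t f(s,x) = (U\<^sub>s\<^sub>,\<^sub>s\<^sub>+\<^sub>t f\<^sub>s\<^sub>+\<^sub>t)(x)\<close> with \<open>U\<^sub>s\<^sub>,\<^sub>t v = \<^bold>E[P\<^sub>R v]\<close> and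
  \<open>R = Z\<^sub>t - Z\<^sub>s\<close>. The Feller properties follow from continuity in probability of \<open>Z\<close>, and the domain
  is dense because it contains the time averages of \<open>Q\<^sub>u f\<close>.

  For the generator, the Laplace exponent gives the forward equation
  \<open>d/du \<^bold>E p(R\<^sub>u) = \<^bold>E [\<beta>(u) p'(R\<^sub>u) + \<integral> (p(R\<^sub>u + r) - p(R\<^sub>u)) g(u,r) dr]\<close>, in integrated form, for
  exponentials \<open>p\<close>; by Weierstrass approximation in \<open>e\<^sup>-\<^sup>\<eta>\<^sup>r\<close> it holds for all bounded \<open>C\<^sup>1\<close> functions,
  in particular for \<open>p(r) = P\<^sub>r v(x)\<close> with \<open>v\<close> in the domain of \<open>L\<close>. The time dependence of \<open>f\<close> is added
  by comparing increments over short intervals, which yields Dynkin's formula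
  \<open>Q\<^sub>t f - f = \<integral>\<^sub>0\<^sup>t Q\<^sub>u L'f du\<close> for all times. Only the integrated forward equation is available,
  because \<open>\<integral> (1 \<and> r) g(s,r) dr\<close> need not be continuous in \<open>s\<close>.
\<close>

text \<open>Two facts rest on the single function \<open>psir 1\<close>. Its indefinite integral
  controls how small the increments of Z are, and since min(1,r) is at most 2 (1 - exp(-r)), twice
  its absolute value dominates \<open>K s\<close>, the integral of min(1,r) g(s,r). The resulting
  local integrability of \<open>K\<close> takes the place of continuity in the dominated convergence
  arguments. As the integrands in time may be discontinuous, equations cannot be checked by
  differentiating at every point; \<open>eq_if_increments_small\<close> compares increments with
  those of an indefinite integral instead.

  The approximation is applied to the derivative of exp(-2 eta r) p(r), since p need not have a
  limit at infinity: one factor exp(-eta r) gives continuity at the end point of the compactified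
  half-line, the other makes the error integrable, so that p is approximated together with its
  derivative.

  Dynkin's formula yields the generator because L'f lies in \<open>C0\<close>: by strong continuity
  of Q the averages of Q_u L'f over [0,t] converge uniformly.\<close>

section \<open>Functions vanishing at infinity\<close>

text \<open>Dominated convergence speaks about sequences, so membership in \<open>C0\<close> is
  reduced to them. Closedness of \<open>E\<close> makes each \<open>cball 0 n \<inter> E\<close>
  compact; if no compact set worked for some e, points with value at least e could be chosen outside
  every such ball, and they would escape to infinity.\<close>

lemma C0_seqI:
  fixes E :: "'b::euclidean_space set"
  assumes E: "closed E"
    and zero: "\<And>z. z \<notin> E \<Longrightarrow> f z = 0"
    and cont: "\<And>z l. (\<And>n. z n \<in> E) \<Longrightarrow> l \<in> E \<Longrightarrow> z \<longlonglongrightarrow> l \<Longrightarrow> (\<lambda>n. f (z n)) \<longlonglongrightarrow> f l"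
    and inf: "\<And>z. (\<And>n. z n \<in> E) \<Longrightarrow> filterlim (\<lambda>n. norm (z n)) at_top sequentially \<Longrightarrow> (\<lambda>n. f (z n)) \<longlonglongrightarrow> 0"
  shows "f \<in> C0 E"
proof -
  have "continuous_on E f"
    unfolding continuous_on_sequentially using cont by (auto simp: o_def)
  moreover have "\<exists>K. compact K \<and> K \<subseteq> E \<and> (\<forall>z\<in>E - K. \<bar>f z\<bar> < e)" if "e > 0" for e :: real
  proof (rule ccontr)
    assume no: "\<not> ?thesis"
    have "\<exists>z\<in>E. norm z > real n \<and> \<bar>f z\<bar> \<ge> e" for n
    proof -
      have "compact (cball 0 (real n) \<inter> E)" "cball 0 (real n) \<inter> E \<subseteq> E"
        using E by (auto intro: compact_Int_closed)
      then obtain z where "z \<in> E - (cball 0 (real n) \<inter> E)" "\<not> \<bar>f z\<bar> < e"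
        using no by blast
      then show ?thesis by (intro bexI[of _ z]) auto
    qed
    then obtain z where z: "\<And>n. z n \<in> E" "\<And>n. norm (z n) > real n" "\<And>n. \<bar>f (z n)\<bar> \<ge> e"
      by metis
    have "filterlim (\<lambda>n. norm (z n)) at_top sequentially"
      by (rule filterlim_at_top_mono[OF filterlim_real_sequentially])
         (auto intro!: always_eventually less_imp_le z(2))
    from inf[OF z(1) this] have "(\<lambda>n. f (z n)) \<longlonglongrightarrow> 0" .
    then obtain n where "\<bar>f (z n)\<bar> < e"
      using \<open>e > 0\<close> by (auto simp: lim_sequentially dist_real_def)
    with z(3)[of n] show False by simp
  qed
  ultimately show ?thesis using zero unfolding C0_def by blast
qed

lemma C0_zero: "f \<in> C0 E \<Longrightarrow> z \<notin> E \<Longrightarrow> f z = 0"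
  by (auto simp: C0_def)

lemma C0_continuous_on: "f \<in> C0 E \<Longrightarrow> continuous_on E f"
  by (auto simp: C0_def)

lemma C0_compactE:
  assumes "f \<in> C0 E" "e > 0"
  obtains K where "compact K" "K \<subseteq> E" "\<And>z. z \<notin> K \<Longrightarrow> \<bar>f z\<bar> < e"
proof -
  obtain K where K: "compact K" "K \<subseteq> E" "\<forall>z\<in>E - K. \<bar>f z\<bar> < e"
    using assms unfolding C0_def by blast
  have "\<bar>f z\<bar> < e" if "z \<notin> K" for z
    using K C0_zero[OF assms(1), of z] that assms(2) by (cases "z \<in> E") auto
  with K show ?thesis by (intro that[of K]) auto
qed

lemma C0_boundE:
  fixes E :: "'b::topological_space set"
  assumes "f \<in> C0 E"
  obtains B where "B \<ge> 0" "\<And>z. \<bar>f z\<bar> \<le> B"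
proof -
  obtain K where K: "compact K" "K \<subseteq> E" "\<And>z. z \<notin> K \<Longrightarrow> \<bar>f z\<bar> < 1"
    by (rule C0_compactE[OF assms zero_less_one]) blast
  have "compact (f ` K)"
    by (rule compact_continuous_image)
      (use K C0_continuous_on[OF assms] in \<open>auto intro: continuous_on_subset\<close>)
  then have "bounded (f ` K)" by (rule compact_imp_bounded)
  then obtain b where b: "\<And>z. z \<in> K \<Longrightarrow> \<bar>f z\<bar> \<le> b"
    unfolding bounded_iff by auto
  have "\<bar>f z\<bar> \<le> max 1 b" for z
    using K(3)[of z] b[of z] by (cases "z \<in> K") auto
  then show ?thesis by (intro that[of "max 1 b"]) auto
qed

lemma C0_seq_tendsto:
  fixes E :: "'b::metric_space set"
  assumes "f \<in> C0 E" "\<And>n. z n \<in> E" "l \<in> E" "z \<longlonglongrightarrow> l"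
  shows "(\<lambda>n. f (z n)) \<longlonglongrightarrow> f l"
  using C0_continuous_on[OF assms(1)] assms(2-)
  unfolding continuous_on_sequentially by (auto simp: o_def)

lemma C0_seq_infinity:
  fixes E :: "'b::euclidean_space set"
  assumes "f \<in> C0 E" "filterlim (\<lambda>n. norm (z n)) at_top sequentially"
  shows "(\<lambda>n. f (z n)) \<longlonglongrightarrow> 0"
proof (rule LIMSEQ_I)
  fix r :: real assume "r > 0"
  then obtain K where K: "compact K" "K \<subseteq> E" "\<And>z. z \<notin> K \<Longrightarrow> \<bar>f z\<bar> < r"
    using C0_compactE[OF assms(1), of r] by auto
  from compact_imp_bounded[OF K(1)] obtain b where b: "\<And>z. z \<in> K \<Longrightarrow> norm z \<le> b"
    unfolding bounded_iff by auto
  have "eventually (\<lambda>n. norm (z n) > b) sequentially"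
    using assms(2) unfolding filterlim_at_top_dense by auto
  then obtain N where "\<And>n. n \<ge> N \<Longrightarrow> norm (z n) > b"
    unfolding eventually_sequentially by auto
  then have "\<forall>n\<ge>N. norm (f (z n) - 0) < r"
    using b K(3) by (metis diff_zero linorder_not_le real_norm_def)
  then show "\<exists>no. \<forall>n\<ge>no. norm (f (z n) - 0) < r" by blast
qed

lemma C0_lincomb:
  fixes E :: "'b::euclidean_space set"
  assumes E: "closed E" and "f \<in> C0 E" "h \<in> C0 E"
  shows "(\<lambda>z. a * f z + b * h z) \<in> C0 E"
proof (rule C0_seqI[OF E])
  show "a * f z + b * h z = 0" if "z \<notin> E" for z
    using that assms by (simp add: C0_zero)
  show "(\<lambda>n. a * f (z n) + b * h (z n)) \<longlonglongrightarrow> a * f l + b * h l"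
    if "\<And>n. z n \<in> E" "l \<in> E" "z \<longlonglongrightarrow> l" for z l
    using C0_seq_tendsto[OF assms(2) that] C0_seq_tendsto[OF assms(3) that]
    by (intro tendsto_intros)
  show "(\<lambda>n. a * f (z n) + b * h (z n)) \<longlonglongrightarrow> 0"
    if "\<And>n. z n \<in> E" "filterlim (\<lambda>n. norm (z n)) at_top sequentially" for z
    using tendsto_add[OF tendsto_mult_left[OF C0_seq_infinity[OF assms(2) that(2)], of a]
        tendsto_mult_left[OF C0_seq_infinity[OF assms(3) that(2)], of b]] by simp
qed

lemma C0_diff:
  fixes E :: "'b::euclidean_space set"
  assumes "closed E" and "f \<in> C0 E" "h \<in> C0 E"
  shows "(\<lambda>z. f z - h z) \<in> C0 E"
  using C0_lincomb[OF assms, of 1 "-1"] by simp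

text \<open>Both limits of \<open>C0_seqI\<close> pass under the integral by dominated convergence;
  the constant \<open>B\<close> is an integrable majorant because the measure is finite.\<close>

lemma C0_integral:
  fixes E :: "'b::euclidean_space set"
  assumes E: "closed E" and "finite_measure N"
    and F: "\<And>\<omega>. \<omega> \<in> space N \<Longrightarrow> F \<omega> \<in> C0 E"
    and B: "\<And>\<omega> z. \<omega> \<in> space N \<Longrightarrow> \<bar>F \<omega> z\<bar> \<le> B"
    and m[measurable]: "\<And>z. z \<in> E \<Longrightarrow> (\<lambda>\<omega>. F \<omega> z) \<in> borel_measurable N"
  shows "(\<lambda>z. LINT \<omega>|N. F \<omega> z) \<in> C0 E"
proof -
  interpret finite_measure N by fact
  show ?thesis
  proof (rule C0_seqI[OF E])
    show "(LINT \<omega>|N. F \<omega> z) = 0" if "z \<notin> E" for z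
      using C0_zero[OF F that] by (subst Bochner_Integration.integral_cong[OF refl, of _ _ "\<lambda>_. 0"]) auto
    show "(\<lambda>n. LINT \<omega>|N. F \<omega> (z n)) \<longlonglongrightarrow> (LINT \<omega>|N. F \<omega> l)"
      if "\<And>n. z n \<in> E" "l \<in> E" "z \<longlonglongrightarrow> l" for z l
      by (rule integral_dominated_convergence[where w="\<lambda>_. B"])
        (use that B in \<open>auto intro!: AE_I2 C0_seq_tendsto[OF F]\<close>)
    show "(\<lambda>n. LINT \<omega>|N. F \<omega> (z n)) \<longlonglongrightarrow> 0"
      if "\<And>n. z n \<in> E" "filterlim (\<lambda>n. norm (z n)) at_top sequentially" for z
    proof -
      have "(\<lambda>n. LINT \<omega>|N. F \<omega> (z n)) \<longlonglongrightarrow> (LINT \<omega>|N. 0)"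
        by (rule integral_dominated_convergence[where w="\<lambda>_. B"])
          (use that B in \<open>auto intro!: AE_I2 C0_seq_infinity[OF F]\<close>)
      then show ?thesis by simp
    qed
  qed
qed

text \<open>Two points at distance below 1 either both lie outside \<open>K\<close>, where the
  values are below e/2, or both lie in the ball of radius b + 1, where Heine-Cantor applies.\<close>

lemma C0_uniformly_continuous:
  fixes E :: "'b::euclidean_space set"
  assumes E: "closed E" and f: "f \<in> C0 E" and e: "e > 0"
  obtains d where "d > 0" "\<And>z z'. z \<in> E \<Longrightarrow> z' \<in> E \<Longrightarrow> dist z z' < d \<Longrightarrow> \<bar>f z - f z'\<bar> \<le> e"
proof -
  obtain K where K: "compact K" "K \<subseteq> E" "\<And>z. z \<notin> K \<Longrightarrow> \<bar>f z\<bar> < e / 2"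
    using C0_compactE[OF f, of "e/2"] e by auto
  from compact_imp_bounded[OF K(1)] obtain b where b: "\<And>z. z \<in> K \<Longrightarrow> norm z \<le> b"
    unfolding bounded_iff by auto
  let ?K = "cball 0 (b + 1) \<inter> E"
  have "compact ?K" using E by (auto intro: compact_Int_closed)
  then have "uniformly_continuous_on ?K f"
    using C0_continuous_on[OF f] by (intro compact_uniformly_continuous) (auto intro: continuous_on_subset)
  then obtain d where d: "d > 0" "\<And>z z'. z \<in> ?K \<Longrightarrow> z' \<in> ?K \<Longrightarrow> dist z' z < d \<Longrightarrow> dist (f z') (f z) < e"
    unfolding uniformly_continuous_on_def using e by metis
  have "\<bar>f z - f z'\<bar> \<le> e" if zz: "z \<in> E" "z' \<in> E" "dist z z' < min d 1" for z z'
  proof (cases "z \<in> K \<or> z' \<in> K")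
    case True
    have "norm z \<le> norm z' + dist z z'" "norm z' \<le> norm z + dist z z'"
      by (auto simp: dist_norm norm_triangle_sub norm_triangle_sub[of z' z, unfolded norm_minus_commute[of z' z]])
    with True b[of z] b[of z'] zz have "z \<in> ?K" "z' \<in> ?K" by auto
    from d(2)[OF this] zz show ?thesis by (simp add: dist_commute dist_real_def abs_minus_commute)
  next
    case False
    then show ?thesis using K(3)[of z] K(3)[of z'] by linarith
  qed
  then show ?thesis using d(1) by (intro that[of "min d 1"]) auto
qed

lemma C0_borel_measurable:
  fixes E :: "'b::euclidean_space set"
  assumes E: "closed E" and f: "f \<in> C0 E"
  shows "f \<in> borel_measurable borel"
proof -
  have "(\<lambda>z. indicator E z *\<^sub>R f z) \<in> borel_measurable borel"
    by (rule borel_measurable_continuous_on_indicator)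
      (use E C0_continuous_on[OF f] in auto)
  also have "(\<lambda>z. indicator E z *\<^sub>R f z) = f"
    using C0_zero[OF f] by (auto simp: indicator_def fun_eq_iff)
  finally show ?thesis .
qed

lemma C0_abs_le_supnorm:
  assumes "f \<in> C0 E" "z \<in> E"
  shows "\<bar>f z\<bar> \<le> supnorm E f"
proof -
  obtain B where "\<And>z. \<bar>f z\<bar> \<le> B" using C0_boundE[OF assms(1)] by blast
  then show ?thesis unfolding supnorm_def
    by (intro cSUP_upper[OF assms(2)] bdd_aboveI2[of _ _ B]) auto
qed

lemma supnorm_le:
  assumes "E \<noteq> {}" "\<And>z. z \<in> E \<Longrightarrow> \<bar>f z\<bar> \<le> c"
  shows "supnorm E f \<le> c"
  unfolding supnorm_def using assms by (intro cSUP_least) auto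

lemma C0_supnorm_nonneg:
  assumes "f \<in> C0 E" "E \<noteq> {}"
  shows "0 \<le> supnorm E f"
proof -
  obtain z where "z \<in> E" using assms by auto
  from C0_abs_le_supnorm[OF assms(1) this] show ?thesis by linarith
qed

text \<open>Turns limits in norm into pointwise estimates. Membership in \<open>C0\<close> keeps the
  values bounded; the real supremum of an unbounded set is unspecified.\<close>

lemma supnorm_tendsto_0_iff:
  fixes F :: "real \<Rightarrow> 'b::topological_space \<Rightarrow> real"
  assumes E: "E \<noteq> {}" and F: "\<And>t. t > 0 \<Longrightarrow> F t \<in> C0 E"
  shows "((\<lambda>t. supnorm E (F t)) \<longlongrightarrow> 0) (at_right 0) \<longleftrightarrow>
    (\<forall>e>0. \<exists>d>0. \<forall>t. 0 < t \<longrightarrow> t < d \<longrightarrow> (\<forall>z\<in>E. \<bar>F t z\<bar> \<le> e))" (is "?L \<longleftrightarrow> ?R")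
proof
  assume ?L
  show ?R
  proof (intro allI impI)
    fix e :: real assume "e > 0"
    with \<open>?L\<close> have "eventually (\<lambda>t. dist (supnorm E (F t)) 0 < e) (at_right 0)"
      unfolding tendsto_iff by auto
    then obtain d where "d > 0" "\<And>t. 0 < t \<Longrightarrow> t < d \<Longrightarrow> dist (supnorm E (F t)) 0 < e"
      using eventually_at_right_field[of "\<lambda>t. dist (supnorm E (F t)) 0 < e" 0] by blast
    moreover have "\<bar>F t z\<bar> \<le> e" if "0 < t" "t < d" "z \<in> E" for t z
      using calculation(2)[OF that(1,2)] C0_abs_le_supnorm[OF F[OF that(1)] that(3)]
      by (simp add: dist_real_def)
    ultimately show "\<exists>d>0. \<forall>t. 0 < t \<longrightarrow> t < d \<longrightarrow> (\<forall>z\<in>E. \<bar>F t z\<bar> \<le> e)" by blast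
  qed
next
  assume R: ?R
  show ?L unfolding tendsto_iff
  proof (intro allI impI)
    fix e :: real assume "e > 0"
    \<comment> \<open>Half of e, because a supremum preserves only weak inequalities and the limit
      asks for a strict one.\<close>
    then obtain d where d: "d > 0" "\<And>t z. 0 < t \<Longrightarrow> t < d \<Longrightarrow> z \<in> E \<Longrightarrow> \<bar>F t z\<bar> \<le> e / 2"
      using R[rule_format, of "e / 2"] by (metis half_gt_zero)
    have "dist (supnorm E (F t)) 0 < e" if "0 < t" "t < d" for t
    proof -
      have "supnorm E (F t) \<le> e / 2" using d(2) that by (intro supnorm_le[OF E]) auto
      with C0_supnorm_nonneg[OF F[OF that(1)] E] \<open>e > 0\<close> show ?thesis
        by (simp add: dist_real_def)
    qed
    then show "\<forall>\<^sub>F t in at_right 0. dist (supnorm E (F t)) 0 < e"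
      using eventually_at_right_field[of "\<lambda>t. dist (supnorm E (F t)) 0 < e" 0] d(1) by blast
  qed
qed

lemma supnorm_tendsto_0I:
  fixes F :: "real \<Rightarrow> 'b::topological_space \<Rightarrow> real"
  assumes "E \<noteq> {}" "\<And>t. t > 0 \<Longrightarrow> F t \<in> C0 E"
    and "\<And>e. e > 0 \<Longrightarrow> \<exists>d>0. \<forall>t. 0 < t \<longrightarrow> t < d \<longrightarrow> (\<forall>z\<in>E. \<bar>F t z\<bar> \<le> e)"
  shows "((\<lambda>t. supnorm E (F t)) \<longlongrightarrow> 0) (at_right 0)"
  by (rule iffD2[OF supnorm_tendsto_0_iff[of E F, OF assms(1,2)]]) (use assms(3) in blast)+

section \<open>Functions on the half-line times a space\<close>

lemma closed_time_space: "closed (time_space :: (real \<times> 'b::topological_space) set)"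
  by (intro closed_Times) auto

lemma C0_time_slice:
  fixes f :: "real \<times> 'b::euclidean_space \<Rightarrow> real"
  assumes f: "f \<in> C0 time_space" and s: "0 \<le> s"
  shows "(\<lambda>y. f (s, y)) \<in> C0 UNIV"
proof (rule C0_seqI)
  show "(\<lambda>n. f (s, z n)) \<longlonglongrightarrow> f (s, l)" if "z \<longlonglongrightarrow> l" for z l
    by (rule C0_seq_tendsto[OF f]) (use s that in \<open>auto intro!: tendsto_intros\<close>)
  show "(\<lambda>n. f (s, z n)) \<longlonglongrightarrow> 0" if "filterlim (\<lambda>n. norm (z n)) at_top sequentially" for z
    by (rule C0_seq_infinity[OF f], rule filterlim_at_top_mono[OF that])
       (auto intro!: always_eventually simp: norm_snd_le)
qed auto

lemma C0_time_tail:
  fixes f :: "real \<times> 'b::euclidean_space \<Rightarrow> real"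
  assumes f: "f \<in> C0 time_space" and e: "e > 0"
  obtains N where "N \<ge> 0" "\<And>s x. s \<ge> N \<Longrightarrow> \<bar>f (s, x)\<bar> \<le> e"
proof -
  obtain K where K: "compact K" "\<And>z. z \<notin> K \<Longrightarrow> \<bar>f z\<bar> < e"
    using C0_compactE[OF f e] by metis
  from compact_imp_bounded[OF K(1)] obtain b where b: "\<And>z. z \<in> K \<Longrightarrow> norm z \<le> b"
    unfolding bounded_iff by auto
  have "\<bar>f (s, x)\<bar> \<le> e" if "s \<ge> max 0 (b + 1)" for s x
  proof -
    have "\<bar>s\<bar> \<le> norm (s, x)" using norm_fst_le[of s x] by simp
    with that have "norm (s, x) > b" by auto
    with b[of "(s, x)"] K(2)[of "(s, x)"] show ?thesis by force
  qed
  then show ?thesis by (intro that[of "max 0 (b + 1)"]) auto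
qed

text \<open>For the transition operators only slices are accessible: each lies in \<open>C0\<close>,
  they depend on time continuously in norm, and they are uniformly small at late times. A sequence
  that escapes to infinity with values bounded away from 0 has bounded times, hence convergent times
  along a subsequence; its space component then escapes, while the limiting slice vanishes at
  infinity.\<close>

lemma C0_timeI:
  fixes f :: "real \<times> 'b::euclidean_space \<Rightarrow> real"
  assumes zero: "\<And>s x. s < 0 \<Longrightarrow> f (s, x) = 0"
    and slice: "\<And>s. s \<ge> 0 \<Longrightarrow> (\<lambda>y. f (s, y)) \<in> C0 UNIV"
    and cont: "\<And>s e. s \<ge> 0 \<Longrightarrow> e > 0 \<Longrightarrow> \<exists>d>0. \<forall>s'\<ge>0. \<bar>s' - s\<bar> < d \<longrightarrow> (\<forall>x. \<bar>f (s', x) - f (s, x)\<bar> \<le> e)"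
    and tail: "\<And>e. e > 0 \<Longrightarrow> \<exists>N. \<forall>s\<ge>N. \<forall>x. \<bar>f (s, x)\<bar> \<le> e"
  shows "f \<in> C0 time_space"
proof (rule C0_seqI[OF closed_time_space])
  show "f z = 0" if "z \<notin> time_space" for z
    using zero that by (cases z) auto
  \<comment> \<open>Uniformity in x lets the time be frozen at its limit although the space
    component need not converge; both remaining claims use this.\<close>
  have near: "(\<lambda>n. f (z n) - f (s, snd (z n))) \<longlonglongrightarrow> 0"
    if z: "\<And>n. z n \<in> time_space" and s: "(\<lambda>n. fst (z n)) \<longlonglongrightarrow> s" "s \<ge> 0" for z :: "nat \<Rightarrow> real \<times> 'b" and s
  proof (rule LIMSEQ_I)
    fix r :: real assume "r > 0"
    then obtain d where d: "d > 0" "\<And>s' x. s' \<ge> 0 \<Longrightarrow> \<bar>s' - s\<bar> < d \<Longrightarrow> \<bar>f (s', x) - f (s, x)\<bar> \<le> r / 2"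
      using cont[OF s(2), of "r / 2"] by (metis half_gt_zero)
    obtain no where "\<And>n. n \<ge> no \<Longrightarrow> \<bar>fst (z n) - s\<bar> < d"
      using LIMSEQ_D[OF s(1) d(1)] by auto
    then have "norm (f (z n) - f (s, snd (z n)) - 0) < r" if "n \<ge> no" for n
      using d(2)[of "fst (z n)" "snd (z n)"] z[of n] that \<open>r > 0\<close> by (force simp: mem_Times_iff)
    then show "\<exists>no. \<forall>n\<ge>no. norm (f (z n) - f (s, snd (z n)) - 0) < r" by blast
  qed
  show "(\<lambda>n. f (z n)) \<longlonglongrightarrow> f l" if z: "\<And>n. z n \<in> time_space" "l \<in> time_space" "z \<longlonglongrightarrow> l" for z l
  proof -
    have s: "fst l \<ge> 0" using z(2) by auto
    have "(\<lambda>n. f (fst l, snd (z n))) \<longlonglongrightarrow> f (fst l, snd l)"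
      by (rule C0_seq_tendsto[OF slice[OF s]]) (use tendsto_snd[OF z(3)] in auto)
    from tendsto_add[OF near[OF z(1) tendsto_fst[OF z(3)] s] this] show ?thesis by simp
  qed
  show "(\<lambda>n. f (z n)) \<longlonglongrightarrow> 0"
    if z: "\<And>n. z n \<in> time_space" and inf: "filterlim (\<lambda>n. norm (z n)) at_top sequentially" for z
  proof (rule ccontr)
    assume "\<not> ?thesis"
    then obtain r where r: "r > 0" "\<And>m. \<exists>n\<ge>m. \<bar>f (z n)\<bar> \<ge> r"
      unfolding lim_sequentially by (auto simp: dist_real_def not_less)
    define A where "A = {n. \<bar>f (z n)\<bar> \<ge> r}"
    have "infinite A" unfolding infinite_nat_iff_unbounded_le A_def using r(2) by auto
    define q where "q = enumerate A"
    have q: "strict_mono q" "\<And>n. \<bar>f (z (q n))\<bar> \<ge> r"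
      using strict_mono_enumerate[OF \<open>infinite A\<close>] enumerate_in_set[OF \<open>infinite A\<close>]
      unfolding q_def A_def by auto
    obtain N where N: "\<And>s x. s \<ge> N \<Longrightarrow> \<bar>f (s, x)\<bar> \<le> r / 2"
      using tail[of "r / 2"] r by auto
    have "fst (z (q n)) \<in> {0..N}" for n
      using z[of "q n"] q(2)[of n] N[of "fst (z (q n))" "snd (z (q n))"] r(1) by (force simp: mem_Times_iff)
    then obtain s p where s: "s \<in> {0..N}" and p: "strict_mono p"
      and ps: "((\<lambda>n. fst (z (q n))) \<circ> p) \<longlonglongrightarrow> s"
      using compact_Icc[of 0 N, unfolded compact_def] by meson
    define w where "w = (\<lambda>n. z (q (p n)))"
    have w: "\<And>n. w n \<in> time_space" "(\<lambda>n. fst (w n)) \<longlonglongrightarrow> s"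
      using z ps by (auto simp: w_def o_def)
    have "filterlim (q \<circ> p) sequentially sequentially"
      by (rule filterlim_subseq) (rule strict_mono_o[OF q(1) p])
    then have winf: "filterlim (\<lambda>n. norm (w n)) at_top sequentially"
      unfolding w_def using filterlim_compose[OF inf] by (auto simp: o_def)
    \<comment> \<open>Along the subsequence the times are at most N, so the norm can grow only
      through the space component.\<close>
    have snd_inf: "filterlim (\<lambda>n. norm (snd (w n))) at_top sequentially"
    proof (rule filterlim_at_top_mono)
      show "filterlim (\<lambda>n. - N + norm (w n)) at_top sequentially"
        by (rule filterlim_tendsto_add_at_top[OF tendsto_const winf])
      have "norm (w n) \<le> norm (snd (w n)) + N" for n
      proof -
        have "0 \<le> fst (w n)" "fst (w n) \<le> N"
          using \<open>\<And>n. fst (z (q n)) \<in> {0..N}\<close>[of "p n"] by (auto simp: w_def)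
        with norm_Pair_le[of "fst (w n)" "snd (w n)"] show ?thesis by simp
      qed
      then show "\<forall>\<^sub>F n in sequentially. - N + norm (w n) \<le> norm (snd (w n))"
        by (intro always_eventually) (auto simp: algebra_simps)
    qed
    have s0: "s \<ge> 0" using s by auto
    from tendsto_add[OF near[OF w s0] C0_seq_infinity[OF slice[OF s0] snd_inf]]
    have "(\<lambda>n. f (w n)) \<longlonglongrightarrow> 0" by simp
    then obtain n where "\<bar>f (w n)\<bar> < r"
      using \<open>r > 0\<close> by (auto simp: lim_sequentially dist_real_def)
    with q(2)[of "p n"] show False by (simp add: w_def)
  qed
qed

lemma C0_time_uniform:
  fixes f :: "real \<times> 'b::euclidean_space \<Rightarrow> real"
  assumes f: "f \<in> C0 time_space" and e: "e > 0"
  obtains d where "d > 0"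
    "\<And>s s' x. 0 \<le> s \<Longrightarrow> 0 \<le> s' \<Longrightarrow> \<bar>s - s'\<bar> < d \<Longrightarrow> \<bar>f (s, x) - f (s', x)\<bar> \<le> e"
proof -
  obtain d where d: "d > 0" "\<And>z z'. z \<in> time_space \<Longrightarrow> z' \<in> time_space \<Longrightarrow> dist z z' < d \<Longrightarrow> \<bar>f z - f z'\<bar> \<le> e"
    using C0_uniformly_continuous[OF closed_time_space f e] by metis
  show ?thesis
    by (rule that[OF d(1)]) (use d(2) in \<open>auto simp: dist_Pair_Pair dist_real_def\<close>)
qed

section \<open>Strongly continuous contraction semigroups\<close>

lemma set_integrable_continuous_Icc:
  fixes f :: "real \<Rightarrow> real"
  shows "continuous_on {a..b} f \<Longrightarrow> set_integrable lborel {a..b} f"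
  unfolding set_integrable_def by (rule borel_integrable_compact) auto

lemma set_integral_Icc_combine:
  fixes f :: "real \<Rightarrow> real"
  assumes f: "set_integrable lborel {a..c} f" and "a \<le> b" "b \<le> c"
  shows "(LINT u:{a..b}|lborel. f u) + (LINT u:{b..c}|lborel. f u) = (LINT u:{a..c}|lborel. f u)"
proof -
  have "{a..c} = {a..b} \<union> {b..c}" using assms by auto
  moreover have "(LINT u:{a..b} \<union> {b..c}|lborel. f u) = (LINT u:{a..b}|lborel. f u) + (LINT u:{b..c}|lborel. f u)"
  proof (rule set_integral_Un_AE)
    have "{a..b} \<inter> {b..c} = {b}" using assms by auto
    then show "AE u in lborel. \<not> (u \<in> {a..b} \<and> u \<in> {b..c})"
      using AE_lborel_singleton[of b] by (auto simp: set_eq_iff elim!: eventually_mono)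
  qed (use assms in \<open>auto intro: set_integrable_subset[OF f]\<close>)
  ultimately show ?thesis by simp
qed

text \<open>Continuity of the indefinite integral is taken from the gauge integral, with which the
  set integral of \<open>k\<close> agrees.\<close>

lemma set_integral_Icc_continuous:
  fixes k :: "real \<Rightarrow> real"
  assumes k: "set_integrable lborel {a..b} k"
  shows "continuous_on {a..b} (\<lambda>t. LINT u:{a..t}|lborel. k u)"
proof -
  have "continuous_on {a..b} (\<lambda>t. integral {a..t} k)"
    by (rule indefinite_integral_continuous_1) (rule set_borel_integral_eq_integral(1)[OF k])
  moreover have "(LINT u:{a..t}|lborel. k u) = integral {a..t} k" if "t \<in> {a..b}" for t
    by (rule set_borel_integral_eq_integral(2)[OF set_integrable_subset[OF k]]) (use that in auto)
  ultimately show ?thesis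
    using continuous_on_cong[of "{a..b}" "{a..b}" "\<lambda>t. LINT u:{a..t}|lborel. k u" "\<lambda>t. integral {a..t} k"] by simp
qed

lemma set_integral_Icc_shift:
  fixes p :: "real \<Rightarrow> real"
  shows "(LINT u:{a..b}|lborel. p (h + u)) = (LINT u:{h + a..h + b}|lborel. p u)"
proof -
  have "(LINT u|lborel. indicat_real {h + a..h + b} u * p u) =
      \<bar>1\<bar> *\<^sub>R (LINT u|lborel. indicat_real {h + a..h + b} (h + 1 * u) * p (h + 1 * u))"
    by (rule lborel_integral_real_affine) simp
  moreover have "indicat_real {h + a..h + b} (h + u) = indicat_real {a..b} u" for u by (auto simp: indicator_def)
  ultimately show ?thesis unfolding set_lebesgue_integral_def by simp
qed

lemma set_integral_abs_le:
  fixes f :: "real \<Rightarrow> real"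
  assumes f: "set_integrable lborel {a..b} f" and "a \<le> b" and C: "\<And>u. u \<in> {a..b} \<Longrightarrow> \<bar>f u\<bar> \<le> C"
  shows "\<bar>LINT u:{a..b}|lborel. f u\<bar> \<le> C * (b - a)"
proof -
  have "\<bar>LINT u:{a..b}|lborel. f u\<bar> \<le> (LINT u:{a..b}|lborel. \<bar>f u\<bar>)"
    using set_integral_norm_bound[OF f] by simp
  also have "\<dots> \<le> (LINT u:{a..b}|lborel. C)"
    by (rule set_integral_mono[OF set_integrable_abs[OF f]])
      (use C in \<open>auto intro: set_integrable_continuous_Icc\<close>)
  also have "\<dots> = C * (b - a)" using \<open>a \<le> b\<close> by (simp add: set_lebesgue_integral_def)
  finally show ?thesis .
qed

text \<open>Both candidates are limits of one difference quotient, so evaluating it at a single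
  small t separates them by at most e. This justifies the definite description in
  \<open>generator\<close>; the assumption on \<open>T t f\<close> keeps the norms in
  \<open>generator_graph\<close> meaningful.\<close>

lemma generator_graph_unique:
  fixes E :: "'b::euclidean_space set"
  assumes E: "closed E" "E \<noteq> {}"
    and T: "\<And>t. t > 0 \<Longrightarrow> T t f \<in> C0 E"
    and g1: "generator_graph E T f h" and g2: "generator_graph E T f k"
  shows "h = k"
proof
  fix z
  have C: "f \<in> C0 E" "h \<in> C0 E" "k \<in> C0 E"
    using g1 g2 by (auto simp: generator_graph_def)
  have mem: "(\<lambda>z. (T t f z - f z) / t - l z) \<in> C0 E" if "t > 0" "l \<in> C0 E" for t l
    using C0_lincomb[OF E(1) C0_diff[OF E(1) T[OF that(1)] C(1)] that(2), of "1/t" "-1"] by simp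
  show "h z = k z"
  proof (cases "z \<in> E")
    case True
    have "\<bar>h z - k z\<bar> \<le> e" if "e > 0" for e
    proof -
      have "\<exists>d>0. \<forall>t. 0 < t \<longrightarrow> t < d \<longrightarrow> (\<forall>z\<in>E. \<bar>(T t f z - f z) / t - l z\<bar> \<le> e / 2)"
        if "generator_graph E T f l" for l
      proof -
        have l: "l \<in> C0 E" and "((\<lambda>t. supnorm E (\<lambda>z. (T t f z - f z) / t - l z)) \<longlongrightarrow> 0) (at_right 0)"
          using that by (auto simp: generator_graph_def)
        from supnorm_tendsto_0_iff[of E "\<lambda>t z. (T t f z - f z) / t - l z", THEN iffD1,
            OF E(2) mem[OF _ l] this(2)] \<open>e > 0\<close>
        show ?thesis by (metis half_gt_zero)
      qed
      note ex = this
      from ex[OF g1] obtain d1 where d1: "d1 > 0"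
        "\<forall>t. 0 < t \<longrightarrow> t < d1 \<longrightarrow> (\<forall>z\<in>E. \<bar>(T t f z - f z) / t - h z\<bar> \<le> e / 2)"
        by (elim exE conjE)
      from ex[OF g2] obtain d2 where d2: "d2 > 0"
        "\<forall>t. 0 < t \<longrightarrow> t < d2 \<longrightarrow> (\<forall>z\<in>E. \<bar>(T t f z - f z) / t - k z\<bar> \<le> e / 2)"
        by (elim exE conjE)
      define t where "t = min d1 d2 / 2"
      have t: "0 < t" "t < d1" "t < d2" using d1(1) d2(1) by (auto simp: t_def min_def)
      show ?thesis
        using d1(2)[rule_format, OF t(1,2) True] d2(2)[rule_format, OF t(1,3) True] by linarith
    qed
    then have "\<bar>h z - k z\<bar> \<le> 0" by (metis add.left_neutral field_le_epsilon)
    then show ?thesis by simp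
  next
    case False
    then show ?thesis using C0_zero[OF C(2)] C0_zero[OF C(3)] by simp
  qed
qed

lemma generator_eqI:
  fixes E :: "'b::euclidean_space set"
  assumes "closed E" "E \<noteq> {}" "\<And>t. t > 0 \<Longrightarrow> T t f \<in> C0 E" "generator_graph E T f h"
  shows "generator E T f = h"
  unfolding generator_def
proof (rule the_equality)
  show "h' = h" if "generator_graph E T f h'" for h'
    using generator_graph_unique[of E T f h' h] assms that by blast
qed fact

text \<open>Kept general in \<open>E\<close> because it is used twice: with \<open>UNIV\<close> for
  the semigroup of X and with \<open>time_space\<close> for that of (D,Y).\<close>

locale feller =
  fixes E :: "'b::euclidean_space set" and P :: "real \<Rightarrow> ('b \<Rightarrow> real) \<Rightarrow> 'b \<Rightarrow> real"
  assumes closed_E: "closed E" and E_nonempty: "E \<noteq> {}" and semigroup: "feller_semigroup E P"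
begin

lemma P_C0: "0 \<le> t \<Longrightarrow> v \<in> C0 E \<Longrightarrow> P t v \<in> C0 E"
  using semigroup by (auto simp: feller_semigroup_def)

lemma P_lincomb:
  "0 \<le> t \<Longrightarrow> v \<in> C0 E \<Longrightarrow> w \<in> C0 E \<Longrightarrow>
    P t (\<lambda>z. a * v z + b * w z) = (\<lambda>z. a * P t v z + b * P t w z)"
  using semigroup by (auto simp: feller_semigroup_def)

lemma P_diff:
  "0 \<le> t \<Longrightarrow> v \<in> C0 E \<Longrightarrow> w \<in> C0 E \<Longrightarrow> P t (\<lambda>z. v z - w z) = (\<lambda>z. P t v z - P t w z)"
  using P_lincomb[of t v w 1 "-1"] by simp

lemma P_bound:
  assumes "0 \<le> t" "v \<in> C0 E" "\<And>y. \<bar>v y\<bar> \<le> B"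
  shows "\<bar>P t v x\<bar> \<le> B"
proof (cases "x \<in> E")
  case True
  have "\<bar>P t v x\<bar> \<le> supnorm E (P t v)"
    using P_C0[OF assms(1,2)] True by (rule C0_abs_le_supnorm)
  also have "\<dots> \<le> supnorm E v"
    using semigroup assms by (auto simp: feller_semigroup_def)
  also have "\<dots> \<le> B" by (rule supnorm_le[OF E_nonempty]) (use assms in auto)
  finally show ?thesis .
next
  case False
  then show ?thesis using C0_zero[OF P_C0[OF assms(1,2)]] assms(3)[of x] by simp
qed

lemma P_0: "v \<in> C0 E \<Longrightarrow> P 0 v = v"
  using semigroup by (auto simp: feller_semigroup_def)

lemma P_add: "0 \<le> s \<Longrightarrow> 0 \<le> t \<Longrightarrow> v \<in> C0 E \<Longrightarrow> P (s + t) v = P s (P t v)"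
  using semigroup by (auto simp: feller_semigroup_def)

lemma P_strong:
  assumes v: "v \<in> C0 E" and e: "e > 0"
  obtains d where "d > 0" "\<And>t x. 0 \<le> t \<Longrightarrow> t < d \<Longrightarrow> \<bar>P t v x - v x\<bar> \<le> e"
proof -
  have "((\<lambda>t. supnorm E (\<lambda>z. P t v z - v z)) \<longlongrightarrow> 0) (at_right 0)"
    using semigroup v by (auto simp: feller_semigroup_def)
  then obtain d where d: "d > 0" "\<And>t z. 0 < t \<Longrightarrow> t < d \<Longrightarrow> z \<in> E \<Longrightarrow> \<bar>P t v z - v z\<bar> \<le> e"
    using supnorm_tendsto_0_iff[of E "\<lambda>t z. P t v z - v z", THEN iffD1, rule_format, of e]
      C0_diff[OF closed_E P_C0[OF _ v] v] e E_nonempty by auto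
  have "\<bar>P t v x - v x\<bar> \<le> e" if "0 \<le> t" "t < d" for t x
    using d(2)[of t x] that P_0[OF v] e C0_zero[OF v, of x] C0_zero[OF P_C0[OF that(1) v], of x]
    by (cases "t = 0"; cases "x \<in> E") auto
  with d(1) show ?thesis by (rule that)
qed

text \<open>With a the smaller and b the larger time, P_b v - P_a v = P_a (P_(b-a) v - v), and P_a
  is a contraction. The estimate is uniform in x and depends on the times only through their
  distance.\<close>

lemma P_diff_time:
  assumes "0 \<le> r" "0 \<le> r'" and v: "v \<in> C0 E" and e: "\<And>y. \<bar>P \<bar>r - r'\<bar> v y - v y\<bar> \<le> e"
  shows "\<bar>P r v x - P r' v x\<bar> \<le> e"
proof -
  have *: "\<bar>P b v x - P a v x\<bar> \<le> e" if "0 \<le> a" "a \<le> b" "\<And>y. \<bar>P (b - a) v y - v y\<bar> \<le> e" for a b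
  proof -
    have "P b v x - P a v x = P a (\<lambda>y. P (b - a) v y - v y) x"
      using P_add[of a "b - a" v] that v by (simp add: P_diff P_C0)
    also have "\<bar>\<dots>\<bar> \<le> e" by (rule P_bound) (use that v in \<open>auto intro!: C0_diff closed_E P_C0\<close>)
    finally show ?thesis .
  qed
  show ?thesis
  proof (cases "r \<le> r'")
    case True
    with *[of r r'] assms show ?thesis by (auto simp: abs_minus_commute)
  next
    case False
    with *[of r' r] assms show ?thesis by auto
  qed
qed

text \<open>Strong continuity moves the time to its limit uniformly in space, after which only
  continuity of the single function \<open>P l v\<close> is used.\<close>

lemma P_joint_tendsto:
  assumes v: "v \<in> C0 E" and "\<And>n. 0 \<le> r n" "0 \<le> l" "r \<longlonglongrightarrow> l" "y \<longlonglongrightarrow> z"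
    and "\<And>n. y n \<in> E" "z \<in> E"
  shows "(\<lambda>n. P (r n) v (y n)) \<longlonglongrightarrow> P l v z"
proof -
  have "(\<lambda>n. P (r n) v (y n) - P l v (y n)) \<longlonglongrightarrow> 0"
  proof (rule LIMSEQ_I)
    fix e :: real assume "e > 0"
    then obtain d where d: "d > 0" "\<And>t x. 0 \<le> t \<Longrightarrow> t < d \<Longrightarrow> \<bar>P t v x - v x\<bar> \<le> e / 2"
      using P_strong[OF v, of "e / 2"] by auto
    obtain no where no: "\<And>n. n \<ge> no \<Longrightarrow> \<bar>r n - l\<bar> < d"
      using LIMSEQ_D[OF assms(4) d(1)] by auto
    have "norm (P (r n) v (y n) - P l v (y n) - 0) < e" if "n \<ge> no" for n
      using P_diff_time[OF assms(2,3) v, of n "e/2" "y n"] d(2)[of "\<bar>r n - l\<bar>"] no[OF that] \<open>e > 0\<close> by auto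
    then show "\<exists>no. \<forall>n\<ge>no. norm (P (r n) v (y n) - P l v (y n) - 0) < e" by blast
  qed
  moreover have "(\<lambda>n. P l v (y n)) \<longlonglongrightarrow> P l v z"
    using C0_seq_tendsto[OF P_C0[OF assms(3) v], of y z] assms by auto
  ultimately have "(\<lambda>n. P (r n) v (y n) - P l v (y n) + P l v (y n)) \<longlonglongrightarrow> 0 + P l v z"
    by (rule tendsto_add)
  then show ?thesis by simp
qed

lemma P_joint_continuous:
  assumes "v \<in> C0 E"
  shows "continuous_on (UNIV \<times> E) (\<lambda>z. P (max 0 (fst z)) v (snd z))"
  unfolding continuous_on_sequentially
proof (safe, unfold o_def)
  fix z :: "nat \<Rightarrow> real \<times> 'b" and a b
  assume "\<forall>n. z n \<in> UNIV \<times> E" "b \<in> E" "z \<longlonglongrightarrow> (a, b)"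
  then show "(\<lambda>n. P (max 0 (fst (z n))) v (snd (z n))) \<longlonglongrightarrow> P (max 0 (fst (a, b))) v (snd (a, b))"
    by (intro P_joint_tendsto[OF assms] tendsto_max tendsto_const tendsto_fst tendsto_snd)
      (auto simp: mem_Times_iff)
qed

text \<open>The semigroup axioms say nothing about negative times. Clamping the time gives a jointly
  continuous function on \<open>UNIV \<times> E\<close>, which vanishes off the closed set
  \<open>E\<close> and is therefore Borel.\<close>

lemma P_measurable[measurable]:
  assumes "v \<in> C0 E" "R \<in> borel_measurable N" "Y \<in> N \<rightarrow>\<^sub>M borel"
  shows "(\<lambda>\<omega>. P (max 0 (R \<omega>)) v (Y \<omega>)) \<in> borel_measurable N"
proof -
  have "(\<lambda>z. indicator (UNIV \<times> E) z *\<^sub>R P (max 0 (fst z)) v (snd z)) \<in> borel_measurable borel"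
    using P_joint_continuous[OF assms(1)]
    by (intro borel_measurable_continuous_on_indicator) (auto intro!: borel_closed closed_Times closed_E)
  also have "(\<lambda>z. indicator (UNIV \<times> E) z *\<^sub>R P (max 0 (fst z)) v (snd z)) = (\<lambda>z. P (max 0 (fst z)) v (snd z))"
    using C0_zero[OF P_C0[OF _ assms(1)]] by (auto simp: indicator_def fun_eq_iff)
  finally have "(\<lambda>z. P (max 0 (fst z)) v (snd z)) \<in> borel_measurable (borel \<Otimes>\<^sub>M borel)"
    by (simp add: borel_prod)
  from measurable_compose[OF measurable_Pair[OF assms(2,3)] this] show ?thesis by simp
qed

lemma P_measurable':
  assumes "v \<in> C0 E" "R \<in> borel_measurable N" "Y \<in> N \<rightarrow>\<^sub>M borel" "\<And>\<omega>. \<omega> \<in> space N \<Longrightarrow> 0 \<le> R \<omega>"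
  shows "(\<lambda>\<omega>. P (R \<omega>) v (Y \<omega>)) \<in> borel_measurable N"
  using P_measurable[OF assms(1-3)] by (rule measurable_cong[THEN iffD1, rotated]) (use assms(4) in auto)

text \<open>The definition of the generator gives only a right derivative at 0. Applying P_a to the
  difference quotient over [0, b - a] moves it to [a, b] without loss, and
  \<open>P_diff_time\<close> then allows either end point as base point.\<close>

lemma P_deriv:
  assumes g: "generator_graph E P v w" and r: "0 \<le> r"
  shows "((\<lambda>r. P r v x) has_real_derivative P r w x) (at r within {0..})"
proof -
  have v: "v \<in> C0 E" and w: "w \<in> C0 E" using g by (auto simp: generator_graph_def)
  show ?thesis unfolding has_field_derivative_def has_derivative_within_alt
  proof (intro conjI allI impI)
    show "bounded_linear ((*) (P r w x))" by (rule bounded_linear_mult_right)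
    fix e :: real assume e: "e > 0"
    have "((\<lambda>t. supnorm E (\<lambda>z. (P t v z - v z) / t - w z)) \<longlongrightarrow> 0) (at_right 0)"
      using g by (auto simp: generator_graph_def)
    moreover have "(\<lambda>z. (P t v z - v z) / t - w z) \<in> C0 E" if "t > 0" for t
      using C0_lincomb[OF closed_E C0_diff[OF closed_E P_C0[OF _ v] v] w, of t "1/t" "-1"] that by simp
    ultimately obtain d1 where d1: "d1 > 0" "\<And>t z. 0 < t \<Longrightarrow> t < d1 \<Longrightarrow> \<bar>(P t v z - v z) / t - w z\<bar> \<le> e / 2"
      using supnorm_tendsto_0_iff[of E "\<lambda>t z. (P t v z - v z) / t - w z",
          THEN iffD1, rule_format, of "e / 2"] e E_nonempty C0_zero[OF v] C0_zero[OF w] C0_zero[OF P_C0[OF _ v]]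
      by (smt (verit) diff_self div_0 divide_pos_pos)
    obtain d2 where d2: "d2 > 0" "\<And>t x. 0 \<le> t \<Longrightarrow> t < d2 \<Longrightarrow> \<bar>P t w x - w x\<bar> \<le> e / 2"
      using P_strong[OF w, of "e / 2"] e by auto
    \<comment> \<open>The case \<open>c = a\<close> serves the right difference quotients at r, the
      case \<open>c = b\<close> the left ones.\<close>
    have main: "\<bar>P b v x - P a v x - P c w x * (b - a)\<bar> \<le> e * (b - a)"
      if "0 \<le> a" "a < b" "b - a < min d1 d2" "c = a \<or> c = b" for a b c
    proof -
      let ?h = "b - a"
      let ?u = "\<lambda>z. (1/?h) * (P ?h v z - v z) + (-1) * w z"
      have h: "?h > 0" "?h < d1" "?h < d2" using that by auto
      have uC: "(\<lambda>z. P ?h v z - v z) \<in> C0 E"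
        using h v by (intro C0_diff closed_E P_C0) auto
      have uC2: "?u \<in> C0 E" by (rule C0_lincomb[OF closed_E uC w])
      have "P a ?u x = (P b v x - P a v x) / ?h - P a w x"
        using P_lincomb[OF that(1) uC w, of "1/?h" "-1"] P_diff[OF that(1) P_C0[of ?h v] v]
          P_add[of a ?h v] h v that(1)
        by (simp add: fun_eq_iff)
      moreover have "\<bar>P a ?u x\<bar> \<le> e / 2"
        by (rule P_bound[OF that(1) uC2]) (use d1(2)[OF h(1,2)] in simp)
      ultimately have "\<bar>(P b v x - P a v x) / ?h - P a w x\<bar> \<le> e / 2" by simp
      moreover have "\<bar>P a w x - P c w x\<bar> \<le> e / 2"
        by (rule P_diff_time[OF that(1) _ w]) (use that h d2(2) e in \<open>auto simp: P_0 w\<close>)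
      ultimately have "\<bar>(P b v x - P a v x) / ?h - P c w x\<bar> \<le> e" by linarith
      then have "\<bar>(P b v x - P a v x) / ?h - P c w x\<bar> * ?h \<le> e * ?h"
        using h by (intro mult_right_mono) auto
      moreover have "\<bar>(P b v x - P a v x) / ?h - P c w x\<bar> * ?h = \<bar>P b v x - P a v x - P c w x * ?h\<bar>"
      proof -
        have "((P b v x - P a v x) / ?h - P c w x) * ?h = P b v x - P a v x - P c w x * ?h"
          using h by (simp add: field_simps)
        then show ?thesis using h by (metis abs_mult abs_of_pos)
      qed
      ultimately show ?thesis by simp
    qed
    show "\<exists>d>0. \<forall>y\<in>{0..}. norm (y - r) < d \<longrightarrow>
        norm (P y v x - P r v x - P r w x * (y - r)) \<le> e * norm (y - r)"
    proof (intro exI[of _ "min d1 d2"] conjI ballI impI)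
      show "0 < min d1 d2" using d1 d2 by auto
      fix y assume y: "y \<in> {0..}" "norm (y - r) < min d1 d2"
      consider "y = r" | "r < y" | "y < r" by linarith
      then show "norm (P y v x - P r v x - P r w x * (y - r)) \<le> e * norm (y - r)"
      proof cases
        case 2
        with main[of r y r] y r show ?thesis by simp
      next
        case 3
        with main[of y r r] y have "\<bar>P r v x - P y v x - P r w x * (r - y)\<bar> \<le> e * (r - y)" by simp
        moreover have "\<bar>P y v x - P r v x - P r w x * (y - r)\<bar> = \<bar>P r v x - P y v x - P r w x * (r - y)\<bar>"
          by (subst abs_minus_commute) (auto simp: algebra_simps)
        ultimately show ?thesis using 3 by simp
      qed simp
    qed
  qed
qed

lemma P_tendsto_time:
  assumes v: "v \<in> C0 E" and "\<And>n. 0 \<le> r n" "0 \<le> l" "r \<longlonglongrightarrow> l"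
  shows "(\<lambda>n. P (r n) v x) \<longlonglongrightarrow> P l v x"
proof (cases "x \<in> E")
  case True
  then show ?thesis using P_joint_tendsto[OF assms tendsto_const] by auto
next
  case False
  then show ?thesis using C0_zero[OF P_C0[OF _ v]] assms by simp
qed

lemma P_continuous_time:
  assumes v: "v \<in> C0 E"
  shows "continuous_on {0..} (\<lambda>r. P r v x)"
  unfolding continuous_on_sequentially
  using P_tendsto_time[OF v] by (auto simp: o_def)

lemma P_set_integrable:
  assumes v: "v \<in> C0 E" and "0 \<le> a"
  shows "set_integrable lborel {a..b} (\<lambda>u. P u v x)"
  using assms by (intro set_integrable_continuous_Icc continuous_on_subset[OF P_continuous_time[OF v]]) auto

text \<open>The difference quotient minus h is the average of P_u h - h over [0,t], which strong
  continuity makes small uniformly in z.\<close>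

lemma generator_graphI_integral:
  assumes f: "f \<in> C0 E" and h: "h \<in> C0 E"
    and int: "\<And>t z. 0 < t \<Longrightarrow> z \<in> E \<Longrightarrow> P t f z - f z = (LINT u:{0..t}|lborel. P u h z)"
  shows "generator_graph E P f h"
  unfolding generator_graph_def
proof (intro conjI f h)
  show "((\<lambda>t. supnorm E (\<lambda>z. (P t f z - f z) / t - h z)) \<longlongrightarrow> 0) (at_right 0)"
  proof (rule supnorm_tendsto_0I[OF E_nonempty, where F="\<lambda>t z. (P t f z - f z) / t - h z"])
    show "(\<lambda>z. (P t f z - f z) / t - h z) \<in> C0 E" if "0 < t" for t
      using C0_lincomb[OF closed_E C0_diff[OF closed_E P_C0[OF _ f] f] h, of t "1/t" "-1"] that by simp
    fix e :: real assume "e > 0"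
    then obtain d where d: "d > 0" "\<And>t x. 0 \<le> t \<Longrightarrow> t < d \<Longrightarrow> \<bar>P t h x - h x\<bar> \<le> e"
      by (rule P_strong[OF h]) blast
    have "\<bar>(P t f z - f z) / t - h z\<bar> \<le> e" if t: "0 < t" "t < d" "z \<in> E" for t z
    proof -
      have i1: "set_integrable lborel {0..t} (\<lambda>u. P u h z)" by (rule P_set_integrable[OF h]) simp
      have i2: "set_integrable lborel {0..t} (\<lambda>u. h z)" by (rule set_integrable_continuous_Icc) simp
      have "P t f z - f z - t * h z = (LINT u:{0..t}|lborel. P u h z - h z)"
        using t unfolding set_integral_diff(2)[OF i1 i2] int[OF t(1,3)]
        by (simp add: set_lebesgue_integral_def)
      also have "\<bar>\<dots>\<bar> \<le> e * (t - 0)"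
        by (rule set_integral_abs_le[OF set_integral_diff(1)[OF i1 i2]]) (use d(2) t in auto)
      finally have "\<bar>P t f z - f z - t * h z\<bar> / t \<le> e" using t by (simp add: field_simps)
      moreover have "\<bar>P t f z - f z - t * h z\<bar> / t = \<bar>(P t f z - f z) / t - h z\<bar>"
        using t by (subst abs_div_pos) (auto simp: field_simps)
      ultimately show ?thesis by simp
    qed
    with d(1) show "\<exists>d>0. \<forall>t. 0 < t \<longrightarrow> t < d \<longrightarrow> (\<forall>z\<in>E. \<bar>(P t f z - f z) / t - h z\<bar> \<le> e)" by blast
  qed
qed

end

section \<open>Right-continuous processes at random times\<close>

text \<open>Rounding strictly upwards to the grid of mesh \<open>1 / (m + 1)\<close>, so that right continuity applies.\<close>

definition disc :: "nat \<Rightarrow> real \<Rightarrow> real" where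
  "disc m t = real (Suc (nat \<lfloor>real (Suc m) * t\<rfloor>)) / real (Suc m)"

lemma disc_gt: "0 \<le> t \<Longrightarrow> t < disc m t"
proof -
  assume t: "0 \<le> t"
  have "real (Suc m) * t < real (Suc (nat \<lfloor>real (Suc m) * t\<rfloor>))"
    using t by (simp del: of_nat_Suc add: of_nat_Suc[of "nat _"] of_nat_nat) linarith
  then show ?thesis unfolding disc_def by (simp add: pos_less_divide_eq mult.commute)
qed

lemma disc_le: "0 \<le> t \<Longrightarrow> disc m t \<le> t + 1 / real (Suc m)"
proof -
  assume t: "0 \<le> t"
  have "real (nat \<lfloor>real (Suc m) * t\<rfloor>) \<le> real (Suc m) * t"
    using t by simp
  moreover have "(t + 1 / real (Suc m)) * real (Suc m) = real (Suc m) * t + 1"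
    by (simp only: distrib_right) simp
  ultimately have "real (Suc (nat \<lfloor>real (Suc m) * t\<rfloor>)) \<le> (t + 1 / real (Suc m)) * real (Suc m)"
    by linarith
  then show ?thesis unfolding disc_def by (subst pos_divide_le_eq) auto
qed

lemma disc_mono: "s \<le> t \<Longrightarrow> disc m s \<le> disc m t"
  unfolding disc_def
  by (intro divide_right_mono) (auto intro!: nat_mono floor_mono mult_left_mono)

lemma disc_nonneg: "0 \<le> disc m t"
  unfolding disc_def by simp

lemma disc_tendsto: "0 \<le> t \<Longrightarrow> (\<lambda>m. disc m t) \<longlonglongrightarrow> t"
proof (rule tendsto_sandwich)
  assume t: "0 \<le> t"
  show "\<forall>\<^sub>F m in sequentially. t \<le> disc m t" using disc_gt[OF t] by (auto intro!: always_eventually less_imp_le)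
  show "\<forall>\<^sub>F m in sequentially. disc m t \<le> t + inverse (real (Suc m))"
    using disc_le[OF t] by (auto intro!: always_eventually simp: inverse_eq_divide)
  show "(\<lambda>m. t + inverse (real (Suc m))) \<longlonglongrightarrow> t"
    using tendsto_add[OF tendsto_const[of t] LIMSEQ_inverse_real_of_nat] by simp
qed auto

lemma right_continuous_disc:
  assumes "continuous (at_right t) p" "0 \<le> t"
  shows "(\<lambda>m. p (disc m t)) \<longlonglongrightarrow> p t"
proof -
  have "filterlim (\<lambda>m. disc m t) (at_right t) sequentially"
    unfolding filterlim_at using disc_tendsto[OF assms(2)] disc_gt[OF assms(2)]
    by (auto intro!: always_eventually simp: less_imp_neq[symmetric])
  moreover have "(p \<longlongrightarrow> p t) (at_right t)" using assms(1) by (simp add: continuous_within)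
  ultimately show ?thesis by (rule filterlim_compose[rotated])
qed

lemma disc_floor_measurable:
  "(\<lambda>t. nat \<lfloor>real (Suc m) * t\<rfloor>) \<in> borel \<rightarrow>\<^sub>M count_space UNIV"
  by measurable

text \<open>A rounded time takes countably many values, so the rounded variable is patched from
  countably many measurable ones, and right continuity passes to the limit. \<open>F\<close> is
  arbitrary because the lemma is applied to sub-sigma-algebras as well as to the whole one.\<close>

lemma right_continuous_process_measurable:
  fixes Y :: "real \<Rightarrow> 'w \<Rightarrow> 'b::euclidean_space"
  assumes m: "\<And>t. 0 \<le> t \<Longrightarrow> Y t \<in> borel_measurable F"
    and rc: "\<And>\<omega> t. \<omega> \<in> space F \<Longrightarrow> 0 \<le> t \<Longrightarrow> continuous (at_right t) (\<lambda>t. Y t \<omega>)"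
    and R: "R \<in> borel_measurable F" "\<And>\<omega>. \<omega> \<in> space F \<Longrightarrow> 0 \<le> R \<omega>"
  shows "(\<lambda>\<omega>. Y (R \<omega>) \<omega>) \<in> borel_measurable F"
proof (rule borel_measurable_LIMSEQ_metric)
  show "(\<lambda>\<omega>. Y (disc n (R \<omega>)) \<omega>) \<in> borel_measurable F" for n
  proof -
    have "(\<lambda>\<omega>. nat \<lfloor>real (Suc n) * R \<omega>\<rfloor>) \<in> F \<rightarrow>\<^sub>M count_space UNIV"
      by (rule measurable_compose[OF R(1) disc_floor_measurable])
    moreover have "(\<lambda>\<omega>. Y (real (Suc k) / real (Suc n)) \<omega>) \<in> borel_measurable F" for k
      by (rule m) simp
    ultimately show ?thesis unfolding disc_def
      by (rule measurable_compose_countable[rotated, where f="\<lambda>k \<omega>. Y (real (Suc k) / real (Suc n)) \<omega>"])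
  qed
  show "(\<lambda>n. Y (disc n (R \<omega>)) \<omega>) \<longlonglongrightarrow> Y (R \<omega>) \<omega>" if "\<omega> \<in> space F" for \<omega>
    using right_continuous_disc[OF rc[OF that] R(2)[OF that]] R(2)[OF that] by simp
qed

section \<open>Generated \<open>\<sigma>\<close>-algebras\<close>

lemma space_generated_by[simp]: "space (generated_by N I U) = space N"
  unfolding generated_by_def by (subst space_measure_of) auto

lemma sets_generated_by:
  "sets (generated_by N I U) = sigma_sets (space N) (\<Union>u\<in>I. {U u -` A \<inter> space N | A. A \<in> sets borel})"
  unfolding generated_by_def by (subst sets_measure_of) auto

lemma measurable_generated_by:
  "u \<in> I \<Longrightarrow> U u \<in> borel_measurable (generated_by N I U)"
  by (rule measurableI) (auto simp: sets_generated_by intro!: sigma_sets.Basic)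

lemma sets_generated_by_least:
  assumes "space F = space N" "\<And>u. u \<in> I \<Longrightarrow> U u \<in> borel_measurable F"
  shows "sets (generated_by N I U) \<subseteq> sets F"
proof -
  have "U u -` A \<inter> space N \<in> sets F" if "u \<in> I" "A \<in> sets borel" for u A
    using measurable_sets[OF assms(2)[OF that(1)] that(2)] assms(1) by simp
  then have "(\<Union>u\<in>I. {U u -` A \<inter> space N | A. A \<in> sets borel}) \<subseteq> sets F" by blast
  from sets.sigma_sets_subset[OF this] show ?thesis
    unfolding sets_generated_by assms(1) .
qed

lemma subalgebra_generated_by:
  "(\<And>u. u \<in> I \<Longrightarrow> U u \<in> borel_measurable N) \<Longrightarrow> subalgebra N (generated_by N I U)"
  using sets_generated_by_least[of N N I U] by (auto simp: subalgebra_def)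

lemma generated_by_mono:
  "I \<subseteq> J \<Longrightarrow> sets (generated_by N I U) \<subseteq> sets (generated_by N J U)"
  by (rule sets_generated_by_least) (auto intro: measurable_generated_by)

text \<open>Generated by intersections rather than by unions: these form an intersection-stable
  family, so vanishing integrals and independence can be checked on them.\<close>

definition join_sigma :: "'w measure \<Rightarrow> 'w measure \<Rightarrow> 'w measure \<Rightarrow> 'w measure" where
  "join_sigma N F G = sigma (space N) {A \<inter> B | A B. A \<in> sets F \<and> B \<in> sets G}"

lemma
  assumes "subalgebra N F" "subalgebra N G"
  shows space_join_sigma: "space (join_sigma N F G) = space N"
    and sets_join_sigma: "sets (join_sigma N F G) = sigma_sets (space N) {A \<inter> B | A B. A \<in> sets F \<and> B \<in> sets G}"
proof -
  have "{A \<inter> B | A B. A \<in> sets F \<and> B \<in> sets G} \<subseteq> Pow (space N)"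
    using assms sets.sets_into_space[of _ N] by (auto simp: subalgebra_def)
  then show "space (join_sigma N F G) = space N"
    "sets (join_sigma N F G) = sigma_sets (space N) {A \<inter> B | A B. A \<in> sets F \<and> B \<in> sets G}"
    unfolding join_sigma_def by (auto simp: space_measure_of sets_measure_of)
qed

lemma Int_stable_join: "Int_stable {A \<inter> B | A B. A \<in> sets F \<and> B \<in> sets G}"
proof (rule Int_stableI)
  fix a b assume "a \<in> {A \<inter> B | A B. A \<in> sets F \<and> B \<in> sets G}" "b \<in> {A \<inter> B | A B. A \<in> sets F \<and> B \<in> sets G}"
  then obtain A B A' B' where *: "a = A \<inter> B" "b = A' \<inter> B'" "A \<in> sets F" "B \<in> sets G" "A' \<in> sets F" "B' \<in> sets G"
    by blast
  then have "a \<inter> b = (A \<inter> A') \<inter> (B \<inter> B')" by auto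
  with * show "a \<inter> b \<in> {A \<inter> B | A B. A \<in> sets F \<and> B \<in> sets G}" by blast
qed

lemma join_sigma_upper:
  assumes "subalgebra N F" "subalgebra N G"
  shows "sets F \<subseteq> sets (join_sigma N F G)" "sets G \<subseteq> sets (join_sigma N F G)"
proof -
  have sp: "space F = space N" "space G = space N" using assms by (auto simp: subalgebra_def)
  show "sets F \<subseteq> sets (join_sigma N F G)"
  proof
    fix A assume A: "A \<in> sets F"
    have "A = A \<inter> space G" using sets.sets_into_space[OF A] sp by auto
    with A have "A \<in> {A \<inter> B | A B. A \<in> sets F \<and> B \<in> sets G}" by blast
    then show "A \<in> sets (join_sigma N F G)" unfolding sets_join_sigma[OF assms] by (rule sigma_sets.Basic)
  qed
  show "sets G \<subseteq> sets (join_sigma N F G)"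
  proof
    fix A assume A: "A \<in> sets G"
    have "A = space F \<inter> A" using sets.sets_into_space[OF A] sp by auto
    with A have "A \<in> {A \<inter> B | A B. A \<in> sets F \<and> B \<in> sets G}" by blast
    then show "A \<in> sets (join_sigma N F G)" unfolding sets_join_sigma[OF assms] by (rule sigma_sets.Basic)
  qed
qed

lemma subalgebra_join:
  assumes "subalgebra N F" "subalgebra N G"
  shows "subalgebra N (join_sigma N F G)"
proof -
  have "{A \<inter> B | A B. A \<in> sets F \<and> B \<in> sets G} \<subseteq> sets N"
    using assms by (auto simp: subalgebra_def)
  from sets.sigma_sets_subset[OF this] show ?thesis
    using sets_join_sigma[OF assms] space_join_sigma[OF assms] by (simp add: subalgebra_def)
qed

lemma measurable_larger:
  assumes "f \<in> F \<rightarrow>\<^sub>M T" "space F = space G" "sets F \<subseteq> sets G"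
  shows "f \<in> G \<rightarrow>\<^sub>M T"
  using assms unfolding measurable_def by auto

section \<open>Independent variables and integrals over countable partitions\<close>

context prob_space
begin

lemma indep_var_subalgebras:
  assumes ind: "indep_set (sets F) (sets G)" and F: "subalgebra M F" and G: "subalgebra M G"
    and U: "U \<in> F \<rightarrow>\<^sub>M S" and V: "V \<in> G \<rightarrow>\<^sub>M T"
  shows "indep_var S U T V"
proof -
  have sp: "space F = space M" "space G = space M" and
    sub: "sets F \<subseteq> sets M" "sets G \<subseteq> sets M" using F G by (auto simp: subalgebra_def)
  have 1: "sigma_sets (space M) {U -` A \<inter> space M | A. A \<in> sets S} \<subseteq> sets F"
    using sets.sigma_sets_subset[of "{U -` A \<inter> space M | A. A \<in> sets S}" F] measurable_sets[OF U] sp by auto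
  have 2: "sigma_sets (space M) {V -` A \<inter> space M | A. A \<in> sets T} \<subseteq> sets G"
    using sets.sigma_sets_subset[of "{V -` A \<inter> space M | A. A \<in> sets T}" G] measurable_sets[OF V] sp by auto
  have "U \<in> M \<rightarrow>\<^sub>M S" "V \<in> M \<rightarrow>\<^sub>M T"
    using measurable_larger[OF U sp(1) sub(1)] measurable_larger[OF V sp(2) sub(2)] by auto
  moreover have "indep_set (sigma_sets (space M) {U -` A \<inter> space M | A. A \<in> sets S})
      (sigma_sets (space M) {V -` A \<inter> space M | A. A \<in> sets T})"
    using ind 1 2 unfolding indep_sets2_eq by blast
  ultimately show ?thesis unfolding indep_var_eq by blast
qed

text \<open>Under independence the joint law is the product law, so the second variable can be
  frozen while the first is integrated out.\<close>

lemma indep_var_integral_fubini: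
  fixes \<Phi> :: "_ \<Rightarrow> real"
  assumes ind: "indep_var S U T V" and m[measurable]: "\<Phi> \<in> borel_measurable (S \<Otimes>\<^sub>M T)"
    and B: "\<And>z. \<bar>\<Phi> z\<bar> \<le> B"
  shows "(LINT \<omega>|M. \<Phi> (U \<omega>, V \<omega>)) = (LINT \<omega>|M. LINT \<omega>'|M. \<Phi> (U \<omega>', V \<omega>))"
proof -
  have U[measurable]: "random_variable S U" and V[measurable]: "random_variable T V"
    using indep_var_rv1[OF ind] indep_var_rv2[OF ind] by auto
  have d: "distr M S U \<Otimes>\<^sub>M distr M T V = distr M (S \<Otimes>\<^sub>M T) (\<lambda>x. (U x, V x))"
    using ind U V indep_var_distribution_eq by blast
  interpret U: prob_space "distr M S U" by (rule prob_space_distr) fact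
  interpret V: prob_space "distr M T V" by (rule prob_space_distr) fact
  interpret UV: pair_prob_space "distr M S U" "distr M T V" ..
  have "(LINT \<omega>|M. \<Phi> (U \<omega>, V \<omega>)) = (LINT z|distr M (S \<Otimes>\<^sub>M T) (\<lambda>x. (U x, V x)). \<Phi> z)"
    by (subst integral_distr) auto
  also have "\<dots> = (LINT z|(distr M S U \<Otimes>\<^sub>M distr M T V). \<Phi> z)"
    by (simp only: d)
  also have "\<dots> = (LINT y|distr M T V. LINT x|distr M S U. \<Phi> (x, y))"
  proof (subst UV.integral_snd)
    show "integrable (distr M S U \<Otimes>\<^sub>M distr M T V) (\<lambda>(x, y). \<Phi> (x, y))"
      by (rule UV.integrable_const_bound[where B=B]) (use B in auto)
  qed (auto simp: case_prod_unfold)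
  also have "\<dots> = (LINT \<omega>|M. LINT \<omega>'|M. \<Phi> (U \<omega>', V \<omega>))"
  proof -
    have "(LINT y|distr M T V. LINT x|distr M S U. \<Phi> (x, y)) = (LINT \<omega>|M. LINT x|distr M S U. \<Phi> (x, V \<omega>))"
      by (subst integral_distr) auto
    also have "\<dots> = (LINT \<omega>|M. LINT \<omega>'|M. \<Phi> (U \<omega>', V \<omega>))"
    proof (rule Bochner_Integration.integral_cong[OF refl])
      fix \<omega> assume "\<omega> \<in> space M"
      then have "V \<omega> \<in> space T" using measurable_space[OF V] by auto
      then show "(LINT x|distr M S U. \<Phi> (x, V \<omega>)) = (LINT \<omega>'|M. \<Phi> (U \<omega>', V \<omega>))"
        by (subst integral_distr) auto
    qed
    finally show ?thesis .
  qed
  finally show ?thesis .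
qed

lemma set_integral_0_partition:
  fixes \<phi> :: "'a \<Rightarrow> real"
  assumes A: "A \<in> sets M" and B: "\<And>i::nat. A \<inter> B i \<in> sets M" "\<And>i j. i \<noteq> j \<Longrightarrow> B i \<inter> B j = {}"
    and cov: "A \<subseteq> (\<Union>i. B i)" and int: "integrable M \<phi>"
    and 0: "\<And>i. (LINT \<omega>:A \<inter> B i|M. \<phi> \<omega>) = 0"
  shows "(LINT \<omega>:A|M. \<phi> \<omega>) = 0"
proof -
  have eq: "A = (\<Union>i. A \<inter> B i)" using cov by auto
  have "set_integrable M (\<Union>i. A \<inter> B i) \<phi>"
    unfolding eq[symmetric] set_integrable_def using integrable_mult_indicator[OF A int] by simp
  then have "(LINT \<omega>:(\<Union>i. A \<inter> B i)|M. \<phi> \<omega>) = (\<Sum>i. (LINT \<omega>:(A \<inter> B i)|M. \<phi> \<omega>))"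
    using B by (intro lebesgue_integral_countable_add) auto
  then show ?thesis unfolding eq[symmetric] using 0 by simp
qed

end

section \<open>Markov processes at independent random times\<close>

text \<open>Works under one fixed starting law. The Markov property enters as an equality of
  integrals over events of the past, so conditional expectations occur only where the hypotheses are
  translated into this form and where the final result is translated back.\<close>

locale time_change = prob_space N + feller UNIV P
  for N :: "'w measure" and P :: "real \<Rightarrow> ('b::euclidean_space \<Rightarrow> real) \<Rightarrow> 'b \<Rightarrow> real" +
  fixes X :: "real \<Rightarrow> 'w \<Rightarrow> 'b" and Z :: "real \<Rightarrow> 'w \<Rightarrow> real"
  assumes X_meas: "\<And>t. 0 \<le> t \<Longrightarrow> X t \<in> borel_measurable N"
    and X_rc: "\<And>\<omega> t. \<omega> \<in> space N \<Longrightarrow> 0 \<le> t \<Longrightarrow> continuous (at_right t) (\<lambda>t. X t \<omega>)"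
    and X_markov: "\<And>q r A f. 0 \<le> q \<Longrightarrow> 0 \<le> r \<Longrightarrow> f \<in> C0 UNIV \<Longrightarrow> A \<in> sets (natural_filtration N X q) \<Longrightarrow>
      (LINT \<omega>:A|N. f (X (q + r) \<omega>)) = (LINT \<omega>:A|N. P r f (X q \<omega>))"
    and Z_meas: "\<And>t. 0 \<le> t \<Longrightarrow> Z t \<in> borel_measurable N"
    and Z_nonneg: "\<And>\<omega> t. \<omega> \<in> space N \<Longrightarrow> 0 \<le> t \<Longrightarrow> 0 \<le> Z t \<omega>"
    and Z_mono: "\<And>\<omega> s t. \<omega> \<in> space N \<Longrightarrow> 0 \<le> s \<Longrightarrow> s \<le> t \<Longrightarrow> Z s \<omega> \<le> Z t \<omega>"
    and Z_indep_increments: "\<And>s t. 0 \<le> s \<Longrightarrow> s < t \<Longrightarrow> indep_set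
        (sets (vimage_algebra (space N) (\<lambda>\<omega>. Z t \<omega> - Z s \<omega>) borel))
        (sets (natural_filtration N Z s))"
    and X_Z_indep: "indep_processes N X Z"
begin

abbreviation "FX \<equiv> generated_by N {0..} X"
abbreviation "FZ \<equiv> generated_by N {0..} Z"
text \<open>The past of X up to q enlarged by the whole path of Z. All times Z_t are known from the
  start, while independence preserves the Markov property of X.\<close>

definition "H q = join_sigma N (natural_filtration N X q) FZ"

lemma subalgebra_X: "I \<subseteq> {0..} \<Longrightarrow> subalgebra N (generated_by N I X)"
  by (intro subalgebra_generated_by X_meas) auto

lemma subalgebra_Z: "I \<subseteq> {0..} \<Longrightarrow> subalgebra N (generated_by N I Z)"
  by (intro subalgebra_generated_by Z_meas) auto

lemma subalgebra_H: "subalgebra N (H q)"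
  unfolding H_def by (intro subalgebra_join subalgebra_X subalgebra_Z) auto

lemma space_H[simp]: "space (H q) = space N"
  using subalgebra_H by (simp add: subalgebra_def)

lemma sets_H: "sets (H q) = sigma_sets (space N) {A \<inter> B | A B. A \<in> sets (natural_filtration N X q) \<and> B \<in> sets FZ}"
  unfolding H_def by (intro sets_join_sigma subalgebra_X subalgebra_Z) auto

lemma H_upper: "sets (natural_filtration N X q) \<subseteq> sets (H q)" "sets FZ \<subseteq> sets (H q)"
  unfolding H_def by (intro join_sigma_upper subalgebra_X subalgebra_Z; auto)+

lemma sets_H_N: "A \<in> sets (H q) \<Longrightarrow> A \<in> sets N"
  using subalgebra_H by (auto simp: subalgebra_def)

lemma FZ_N: "R \<in> borel_measurable FZ \<Longrightarrow> R \<in> borel_measurable N"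
  using subalgebra_Z[of "{0..}"] by (auto simp: subalgebra_def intro: measurable_larger)

lemma X_random_time_measurable:
  assumes "R \<in> borel_measurable N" "\<And>\<omega>. \<omega> \<in> space N \<Longrightarrow> 0 \<le> R \<omega>"
  shows "(\<lambda>\<omega>. X (R \<omega>) \<omega>) \<in> borel_measurable N"
  by (rule right_continuous_process_measurable) (use assms X_meas X_rc in auto)

lemma C0_comp_measurable:
  fixes f :: "'c::euclidean_space \<Rightarrow> real"
  shows "f \<in> C0 UNIV \<Longrightarrow> Y \<in> N' \<rightarrow>\<^sub>M borel \<Longrightarrow> (\<lambda>\<omega>. f (Y \<omega>)) \<in> borel_measurable N'"
  by (rule measurable_compose[OF _ C0_borel_measurable[OF closed_UNIV, of f]])

lemma indep_FX_FZ: "indep_set (sets FX) (sets FZ)"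
  using X_Z_indep by (simp add: indep_processes_def)

text \<open>On an intersection of a past event C of X with an event D of Z, independence factors the
  integral into the probability of D and an integral over C, which the Markov property makes 0. The
  events over which the integral vanishes form a Dynkin system.\<close>

lemma H_markov:
  assumes q: "0 \<le> q" and r: "0 \<le> r" and f: "f \<in> C0 UNIV" and A: "A \<in> sets (H q)"
  shows "(LINT \<omega>:A|N. f (X (q + r) \<omega>) - P r f (X q \<omega>)) = 0"
proof -
  define \<phi> where "\<phi> = (\<lambda>\<omega>. f (X (q + r) \<omega>) - P r f (X q \<omega>))"
  obtain B where B: "B \<ge> 0" "\<And>y. \<bar>f y\<bar> \<le> B" by (rule C0_boundE[OF f]) blast
  have Xm: "X (q + r) \<in> borel_measurable FX" "X q \<in> borel_measurable FX"
    using q r by (auto intro!: measurable_generated_by)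
  have \<phi>_FX: "\<phi> \<in> borel_measurable FX" unfolding \<phi>_def
    by (intro borel_measurable_diff C0_comp_measurable[OF f] C0_comp_measurable[OF P_C0[OF r f]] Xm)
  have sub: "subalgebra N FX" "subalgebra N FZ" by (auto intro: subalgebra_X subalgebra_Z)
  have m[measurable]: "\<phi> \<in> borel_measurable N"
    using measurable_larger[OF \<phi>_FX] sub by (auto simp: subalgebra_def)
  have bnd: "\<bar>\<phi> \<omega>\<bar> \<le> 2 * B" for \<omega>
    using B(2)[of "X (q + r) \<omega>"] P_bound[OF r f B(2), of "X q \<omega>"] unfolding \<phi>_def by linarith
  have int: "integrable N \<phi>"
    by (rule integrable_const_bound[where B="2 * B"]) (use bnd in auto)
  have gen: "{A \<inter> B |A B. A \<in> sets (natural_filtration N X q) \<and> B \<in> sets FZ} \<subseteq> Pow (space N)"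
    using sets.sets_into_space[of _ FZ] by auto
  have "(LINT \<omega>:A|N. \<phi> \<omega>) = 0"
    using Int_stable_join gen A[unfolded sets_H]
  proof (induction rule: sigma_sets_induct_disjoint)
    case (basic A)
    then obtain C D where A: "A = C \<inter> D" "C \<in> sets (natural_filtration N X q)" "D \<in> sets FZ" by blast
    have C: "C \<in> sets FX" using A(2) generated_by_mono[of "{0..q}" "{0..}" N X] by auto
    have CN: "C \<in> sets N" and DN: "D \<in> sets N" using C A(3) sub by (auto simp: subalgebra_def)
    \<comment> \<open>The function \<open>\<phi>\<close> involves the later value X_(q+r), so D must
      be independent of the whole path of X and not just of its past.\<close>
    have "indep_var borel (\<lambda>\<omega>. indicator C \<omega> * \<phi> \<omega>) borel (indicator D :: _ \<Rightarrow> real)"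
      by (rule indep_var_subalgebras[OF indep_FX_FZ sub])
        (use C A(3) \<phi>_FX in \<open>auto intro!: borel_measurable_times borel_measurable_indicator\<close>)
    then have "(LINT \<omega>|N. (indicator C \<omega> * \<phi> \<omega>) * indicator D \<omega>) =
        (LINT \<omega>|N. indicator C \<omega> * \<phi> \<omega>) * (LINT \<omega>|N. indicator D \<omega>)"
    proof (rule indep_var_lebesgue_integral)
      show "integrable N (\<lambda>\<omega>. indicator C \<omega> * \<phi> \<omega>)"
        using integrable_mult_indicator[OF CN int] by simp
      show "integrable N (indicator D :: _ \<Rightarrow> real)"
        using DN by (intro integrable_const_bound[where B=1]) (auto simp: indicator_def)
    qed
    moreover have "(LINT \<omega>|N. indicator C \<omega> * \<phi> \<omega>) = 0"
    proof -
      have "set_integrable N C (\<lambda>\<omega>. f (X (q + r) \<omega>))" "set_integrable N C (\<lambda>\<omega>. P r f (X q \<omega>))"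
        unfolding set_integrable_def
        by (intro integrable_mult_indicator[OF CN] integrable_const_bound[where B=B] AE_I2
            C0_comp_measurable[OF f] C0_comp_measurable[OF P_C0[OF r f]] X_meas; use B P_bound[OF r f B(2)] q r in simp)+
      then have "(LINT \<omega>:C|N. \<phi> \<omega>) = 0"
        unfolding \<phi>_def using X_markov[OF q r f A(2)] by (subst set_integral_diff) auto
      then show ?thesis by (simp add: set_lebesgue_integral_def)
    qed
    moreover have "(LINT \<omega>:A|N. \<phi> \<omega>) = (LINT \<omega>|N. (indicator C \<omega> * \<phi> \<omega>) * indicator D \<omega>)"
      unfolding set_lebesgue_integral_def A(1)
      by (intro Bochner_Integration.integral_cong) (auto simp: indicator_def)
    ultimately show ?case by simp
  next
    case empty
    show ?case by (simp add: set_lebesgue_integral_def)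
  next
    case (compl A)
    have AN: "A \<in> sets N" using compl(1) sets_H_N[of A q] by (simp add: sets_H)
    have "space N \<in> sets (natural_filtration N X q)"
      using sets.top[of "natural_filtration N X q"] by simp
    then have "(LINT \<omega>:space N|N. f (X (q + r) \<omega>)) = (LINT \<omega>:space N|N. P r f (X q \<omega>))"
      by (rule X_markov[OF q r f])
    moreover have "set_integrable N (space N) (\<lambda>\<omega>. f (X (q + r) \<omega>))" "set_integrable N (space N) (\<lambda>\<omega>. P r f (X q \<omega>))"
      unfolding set_integrable_def
      by (intro integrable_mult_indicator[OF sets.top] integrable_const_bound[where B=B] AE_I2
          C0_comp_measurable[OF f] C0_comp_measurable[OF P_C0[OF r f]] X_meas; use B P_bound[OF r f B(2)] q r in simp)+
    ultimately have all: "(LINT \<omega>:space N|N. \<phi> \<omega>) = 0"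
      unfolding \<phi>_def by (subst set_integral_diff) auto
    have "(LINT \<omega>:A \<union> (space N - A)|N. \<phi> \<omega>) = (LINT \<omega>:A|N. \<phi> \<omega>) + (LINT \<omega>:space N - A|N. \<phi> \<omega>)"
      by (rule set_integral_Un)
        (use AN integrable_mult_indicator[OF _ int, of A] integrable_mult_indicator[OF _ int, of "space N - A"]
          in \<open>auto simp: set_integrable_def\<close>)
    moreover have "A \<union> (space N - A) = space N" using sets.sets_into_space[OF AN] by auto
    ultimately show ?case using all compl by simp
  next
    case (union A)
    have AN: "A i \<in> sets N" for i using union(2) sets_H_N[of "A i" q] by (auto simp: sets_H)
    then have "(LINT \<omega>:(\<Union>i. A i)|N. \<phi> \<omega>) = (\<Sum>i. (LINT \<omega>:A i|N. \<phi> \<omega>))"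
      using union(1)
      by (intro lebesgue_integral_countable_add)
        (auto simp: disjoint_family_on_def set_integrable_def
          intro!: integrable_mult_indicator[OF _ int, unfolded real_scaleR_def])
    then show ?case using union by simp
  qed
  then show ?thesis unfolding \<phi>_def .
qed

text \<open>Both times are rounded to a grid. On each cell of the grid they are constant, and the Markov
  property with respect to \<open>H q\<close> applies.\<close>

lemma random_time_markov:
  assumes S: "S \<in> borel_measurable FZ" and T: "T \<in> borel_measurable FZ"
    and ST: "\<And>\<omega>. \<omega> \<in> space N \<Longrightarrow> 0 \<le> S \<omega>" "\<And>\<omega>. \<omega> \<in> space N \<Longrightarrow> S \<omega> \<le> T \<omega>"
    and A: "A \<in> sets N" "\<And>q. 0 \<le> q \<Longrightarrow> A \<inter> {\<omega> \<in> space N. S \<omega> \<le> q} \<in> sets (H q)"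
    and f: "f \<in> C0 UNIV"
  shows "(LINT \<omega>:A|N. f (X (T \<omega>) \<omega>)) = (LINT \<omega>:A|N. P (T \<omega> - S \<omega>) f (X (S \<omega>) \<omega>))"
proof -
  obtain B where B: "B \<ge> 0" "\<And>y. \<bar>f y\<bar> \<le> B" by (rule C0_boundE[OF f]) blast
  have ST': "\<omega> \<in> space N \<Longrightarrow> 0 \<le> T \<omega>" for \<omega> using ST[of \<omega>] by linarith
  note SN = FZ_N[OF S] and TN = FZ_N[OF T]
  have discm: "disc m \<in> borel_measurable borel" for m
    unfolding disc_def by measurable
  have Sm: "(\<lambda>\<omega>. disc m (S \<omega>)) \<in> borel_measurable N" "(\<lambda>\<omega>. disc m (T \<omega>)) \<in> borel_measurable N" for m
    using measurable_compose[OF SN discm] measurable_compose[OF TN discm] by auto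
  define \<phi> where "\<phi> m \<omega> = f (X (disc m (T \<omega>)) \<omega>) - P (disc m (T \<omega>) - disc m (S \<omega>)) f (X (disc m (S \<omega>)) \<omega>)" for m \<omega>
  have bnd: "\<bar>\<phi> m \<omega>\<bar> \<le> 2 * B" if "\<omega> \<in> space N" for m \<omega>
  proof -
    have "0 \<le> disc m (T \<omega>) - disc m (S \<omega>)" using disc_mono[OF ST(2)[OF that]] by simp
    from P_bound[OF this f B(2), of "X (disc m (S \<omega>)) \<omega>"] B(2)[of "X (disc m (T \<omega>)) \<omega>"]
    show ?thesis unfolding \<phi>_def by linarith
  qed
  have m: "\<phi> m \<in> borel_measurable N" for m unfolding \<phi>_def
    by (intro borel_measurable_diff C0_comp_measurable[OF f] P_measurable'[OF f] X_random_time_measurable Sm)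
      (use disc_mono[OF ST(2)] disc_nonneg in auto)
  have int: "integrable N (\<phi> m)" for m
    by (rule integrable_const_bound[where B="2 * B"]) (use bnd m in auto)
  have step: "(LINT \<omega>:A|N. \<phi> m \<omega>) = 0" for m
  proof (rule set_integral_0_partition[OF A(1) _ _ _ int])
    define J where "J k U = {\<omega> \<in> space N. nat \<lfloor>real (Suc m) * U \<omega>\<rfloor> = k}" for k and U :: "'w \<Rightarrow> real"
    have JFZ: "J k U \<in> sets FZ" if "U \<in> borel_measurable FZ" for k U
      using measurable_sets[OF measurable_compose[OF that disc_floor_measurable[of m]], of "{k}"]
      unfolding J_def by (auto simp: vimage_def Int_def conj_commute)
    \<comment> \<open>\<open>set_integral_0_partition\<close> takes cells indexed by
      \<open>nat\<close>, so the pair of grid indices is encoded.\<close>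
    define D where "D i = (case prod_decode i of (k, l) \<Rightarrow> J k S \<inter> J l T)" for i
    show "D i \<inter> D j = {}" if "i \<noteq> j" for i j
    proof -
      have "i = j" if "\<omega> \<in> D i" "\<omega> \<in> D j" for \<omega>
      proof -
        let ?c = "(nat \<lfloor>real (Suc m) * S \<omega>\<rfloor>, nat \<lfloor>real (Suc m) * T \<omega>\<rfloor>)"
        have "prod_decode i = ?c" "prod_decode j = ?c"
          using that unfolding D_def J_def by (auto split: prod.splits)
        then show ?thesis by (metis prod_decode_inverse)
      qed
      then show ?thesis using that by blast
    qed
    show "A \<subseteq> (\<Union>i. D i)"
    proof
      fix \<omega> assume "\<omega> \<in> A"
      then have "\<omega> \<in> space N" using A(1) sets.sets_into_space by auto
      then have "\<omega> \<in> D (prod_encode (nat \<lfloor>real (Suc m) * S \<omega>\<rfloor>, nat \<lfloor>real (Suc m) * T \<omega>\<rfloor>))"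
        unfolding D_def J_def by simp
      then show "\<omega> \<in> (\<Union>i. D i)" by blast
    qed
    fix i
    obtain k l where kl: "prod_decode i = (k, l)" by fastforce
    have Di: "D i = J k S \<inter> J l T" by (simp add: D_def kl)
    define q where "q = real (Suc k) / real (Suc m)"
    define q' where "q' = real (Suc l) / real (Suc m)"
    have dS: "disc m (S \<omega>) = q" and dT: "disc m (T \<omega>) = q'" if "\<omega> \<in> D i" for \<omega>
      using that unfolding Di J_def disc_def q_def q'_def by auto
    have q: "0 \<le> q" "0 \<le> q'" unfolding q_def q'_def by auto
    \<comment> \<open>Rounding goes upwards, so on the cell S lies below q, and A may be cut down to
      the part that belongs to \<open>H q\<close>.\<close>
    have "A \<inter> D i = (A \<inter> {\<omega> \<in> space N. S \<omega> \<le> q}) \<inter> (J k S \<inter> J l T)"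
    proof -
      have "S \<omega> \<le> q" if "\<omega> \<in> D i" for \<omega>
      proof -
        have "\<omega> \<in> space N" using that by (auto simp: Di J_def)
        from disc_gt[OF ST(1)[OF this], of m] show ?thesis using dS[OF that] by simp
      qed
      then show ?thesis unfolding Di J_def by auto
    qed
    moreover have "J k S \<inter> J l T \<in> sets (H q)"
      using JFZ[OF S] JFZ[OF T] H_upper(2)[of q] by auto
    ultimately have AH: "A \<inter> D i \<in> sets (H q)"
      using A(2)[OF q(1)] by auto
    then show "A \<inter> D i \<in> sets N" by (rule sets_H_N)
    show "(LINT \<omega>:A \<inter> D i|N. \<phi> m \<omega>) = 0"
    proof (cases "q \<le> q'")
      case True
      have "(LINT \<omega>:A \<inter> D i|N. \<phi> m \<omega>) = (LINT \<omega>:A \<inter> D i|N. f (X (q + (q' - q)) \<omega>) - P (q' - q) f (X q \<omega>))"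
        unfolding set_lebesgue_integral_def \<phi>_def
        by (intro Bochner_Integration.integral_cong refl) (auto simp: indicator_def dS dT)
      then show ?thesis using H_markov[OF q(1) _ f AH, of "q' - q"] True by simp
    next
      \<comment> \<open>A cell whose rounded end time precedes its rounded start time is empty,
        since rounding is monotone.\<close>
      case False
      have "D i = {}"
      proof (rule ccontr)
        assume "D i \<noteq> {}"
        then obtain \<omega> where \<omega>: "\<omega> \<in> D i" by auto
        then have "\<omega> \<in> space N" by (auto simp: Di J_def)
        from disc_mono[OF ST(2)[OF this], of m] False show False using dS[OF \<omega>] dT[OF \<omega>] by simp
      qed
      then show ?thesis by (simp add: set_lebesgue_integral_def)
    qed
  qed
  define \<psi> where "\<psi> \<omega> = f (X (T \<omega>) \<omega>) - P (T \<omega> - S \<omega>) f (X (S \<omega>) \<omega>)" for \<omega>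
  have lim: "(\<lambda>m. \<phi> m \<omega>) \<longlonglongrightarrow> \<psi> \<omega>" if "\<omega> \<in> space N" for \<omega>
  proof -
    have 1: "(\<lambda>m. X (disc m (T \<omega>)) \<omega>) \<longlonglongrightarrow> X (T \<omega>) \<omega>" "(\<lambda>m. X (disc m (S \<omega>)) \<omega>) \<longlonglongrightarrow> X (S \<omega>) \<omega>"
      by (rule right_continuous_disc[OF X_rc]; use that ST ST' in simp)+
    show ?thesis unfolding \<phi>_def \<psi>_def
    proof (rule tendsto_diff)
      show "(\<lambda>m. f (X (disc m (T \<omega>)) \<omega>)) \<longlonglongrightarrow> f (X (T \<omega>) \<omega>)"
        using 1 by (intro C0_seq_tendsto[OF f]) auto
      show "(\<lambda>m. P (disc m (T \<omega>) - disc m (S \<omega>)) f (X (disc m (S \<omega>)) \<omega>)) \<longlonglongrightarrow> P (T \<omega> - S \<omega>) f (X (S \<omega>) \<omega>)"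
        using ST[OF that] ST'[OF that] disc_mono[OF ST(2)[OF that]]
        by (intro P_joint_tendsto[OF f] tendsto_diff disc_tendsto 1) auto
    qed
  qed
  have m\<psi>: "\<psi> \<in> borel_measurable N"
    by (rule borel_measurable_LIMSEQ_real[OF lim m])
  have "(\<lambda>m. LINT \<omega>:A|N. \<phi> m \<omega>) \<longlonglongrightarrow> (LINT \<omega>:A|N. \<psi> \<omega>)"
    unfolding set_lebesgue_integral_def
  proof (rule integral_dominated_convergence[where w="\<lambda>_. 2 * B"])
    show "AE \<omega> in N. (\<lambda>m. indicat_real A \<omega> *\<^sub>R \<phi> m \<omega>) \<longlonglongrightarrow> indicat_real A \<omega> *\<^sub>R \<psi> \<omega>"
      by (intro AE_I2 tendsto_scaleR tendsto_const lim)
    show "AE \<omega> in N. norm (indicat_real A \<omega> *\<^sub>R \<phi> m \<omega>) \<le> 2 * B" for m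
      by (intro AE_I2) (use bnd B in \<open>auto simp: indicator_def\<close>)
  qed (use A m m\<psi> in auto)
  then have 0: "(LINT \<omega>:A|N. \<psi> \<omega>) = 0"
    unfolding step by (simp add: LIMSEQ_const_iff)
  have "set_integrable N A (\<lambda>\<omega>. f (X (T \<omega>) \<omega>))"
    unfolding set_integrable_def
    by (intro integrable_mult_indicator[OF A(1)] integrable_const_bound[where B=B] AE_I2
        C0_comp_measurable[OF f] X_random_time_measurable TN) (use B ST' in auto)
  moreover have "set_integrable N A (\<lambda>\<omega>. P (T \<omega> - S \<omega>) f (X (S \<omega>) \<omega>))"
    unfolding set_integrable_def
    by (intro integrable_mult_indicator[OF A(1)] integrable_const_bound[where B=B] AE_I2
        P_measurable'[OF f] X_random_time_measurable SN TN borel_measurable_diff)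
      (use P_bound[OF _ f B(2)] ST in auto)
  ultimately show ?thesis using 0 unfolding \<psi>_def by (subst (asm) set_integral_diff) auto
qed

section \<open>From X at random times to the Markov property of (D,Y)\<close>

lemma Z_FZ: "0 \<le> t \<Longrightarrow> Z t \<in> borel_measurable FZ"
  by (rule measurable_generated_by) auto

lemma expectation_X_random_time:
  assumes R: "R \<in> borel_measurable FZ" "\<And>\<omega>. \<omega> \<in> space N \<Longrightarrow> 0 \<le> R \<omega>" and f: "f \<in> C0 UNIV"
  shows "(LINT \<omega>|N. f (X (R \<omega>) \<omega>)) = (LINT \<omega>|N. P (R \<omega>) f (X 0 \<omega>))"
proof -
  have "(LINT \<omega>:space N|N. f (X (R \<omega>) \<omega>)) = (LINT \<omega>:space N|N. P (R \<omega> - 0) f (X 0 \<omega>))"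
  proof (rule random_time_markov[OF _ R(1) _ _ _ _ f])
    show "space N \<inter> {\<omega> \<in> space N. 0 \<le> q} \<in> sets (H q)" if "0 \<le> q" for q
      using that sets.top[of "H q"] by (auto simp: Int_def)
  qed (use R(2) in auto)
  moreover have "set_lebesgue_integral N (space N) h = integral\<^sup>L N h" for h :: "'w \<Rightarrow> real"
    unfolding set_lebesgue_integral_def
    by (intro Bochner_Integration.integral_cong) (auto simp: indicator_def)
  ultimately show ?thesis by simp
qed

text \<open>The analogue of the stopping-time property: once Z_(s+t) is at most q, so are all
  earlier times Z_(s+u), and the past of (D,Y) up to t is determined by X on [0,q] together with
  Z.\<close>

lemma DY_filtration_H:
  assumes s: "0 \<le> s" "0 \<le> t" and q: "0 \<le> q" and A: "A \<in> sets (natural_filtration N (DY X Z s) t)"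
  shows "A \<inter> {\<omega> \<in> space N. Z (s + t) \<omega> \<le> q} \<in> sets (H q)"
  using A[unfolded sets_generated_by]
proof (induction)
  let ?B = "{\<omega> \<in> space N. Z (s + t) \<omega> \<le> q}"
  have B: "?B \<in> sets (H q)"
  proof -
    have "Z (s + t) \<in> borel_measurable (H q)"
      using measurable_larger[OF Z_FZ[of "s + t"]] H_upper(2)[of q] s by auto
    from borel_measurable_le[OF this borel_measurable_const[of q]] show ?thesis by simp
  qed
  {
    case (Basic a)
    then obtain u D where u: "0 \<le> u" "u \<le> t" "D \<in> sets borel" "a = DY X Z s u -` D \<inter> space N" by auto
    \<comment> \<open>\<open>H q\<close> contains only the past of X up to q; capping the time at q
      restores measurability and changes nothing on \<open>?B\<close>.\<close>
    have m: "(\<lambda>\<omega>. X (min (Z (s + u) \<omega>) q) \<omega>) \<in> borel_measurable (H q)"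
    proof (rule right_continuous_process_measurable[where Y="\<lambda>v. X (min v q)" and R="Z (s + u)"])
      show "X (min v q) \<in> borel_measurable (H q)" if "0 \<le> v" for v
        using measurable_larger[OF measurable_generated_by[of "min v q" "{0..q}" X N], of "H q"]
          H_upper(1)[of q] that q by auto
      \<comment> \<open>The capped path stays right-continuous: it agrees with X before q and is
        constant from q on.\<close>
      show "continuous (at_right v) (\<lambda>t. X (min t q) \<omega>)" if "\<omega> \<in> space (H q)" "0 \<le> v" for \<omega> v
      proof (cases "v < q")
        case True
        have "eventually (\<lambda>t. X t \<omega> = X (min t q) \<omega>) (at_right v)"
          using True unfolding eventually_at_right_field by (intro exI[of _ q]) auto
        moreover have "((\<lambda>t. X t \<omega>) \<longlongrightarrow> X v \<omega>) (at_right v)"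
          using X_rc[of \<omega> v] that by (simp add: continuous_within)
        ultimately have "((\<lambda>t. X (min t q) \<omega>) \<longlongrightarrow> X v \<omega>) (at_right v)"
          by (rule Lim_transform_eventually[rotated])
        then show ?thesis using True by (simp add: continuous_within min_def)
      next
        case False
        have "eventually (\<lambda>t. X q \<omega> = X (min t q) \<omega>) (at_right v)"
          using False unfolding eventually_at_right_field by (intro exI[of _ "v + 1"]) (auto simp: min_def)
        then have "((\<lambda>t. X (min t q) \<omega>) \<longlongrightarrow> X q \<omega>) (at_right v)"
          by (rule Lim_transform_eventually[OF tendsto_const])
        moreover have "min v q = q" using False by auto
        ultimately show ?thesis by (simp add: continuous_within)
      qed
      show "Z (s + u) \<in> borel_measurable (H q)"
        using measurable_larger[OF Z_FZ[of "s + u"]] H_upper(2)[of q] s u by auto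
      show "0 \<le> Z (s + u) \<omega>" if "\<omega> \<in> space (H q)" for \<omega>
        using Z_nonneg[of \<omega>] that s u by auto
    qed
    have "(\<lambda>\<omega>. (s + u, X (min (Z (s + u) \<omega>) q) \<omega>)) \<in> borel_measurable (H q)"
      using m by (intro borel_measurable_Pair) auto
    from measurable_sets[OF this u(3)]
    have "(\<lambda>\<omega>. (s + u, X (min (Z (s + u) \<omega>) q) \<omega>)) -` D \<inter> space N \<in> sets (H q)" by simp
    from sets.Int[OF this B]
    show ?case
    proof (rule back_subst[where P="\<lambda>A. A \<in> sets (H q)"])
      have "Z (s + u) \<omega> \<le> q" if "\<omega> \<in> space N" "Z (s + t) \<omega> \<le> q" for \<omega>
        using Z_mono[OF that(1), of "s + u" "s + t"] that(2) s u by linarith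
      then show "(\<lambda>\<omega>. (s + u, X (min (Z (s + u) \<omega>) q) \<omega>)) -` D \<inter> space N \<inter> ?B = a \<inter> ?B"
        unfolding u(4) DY_def by (auto simp: min_def)
    qed
  next
    case (Compl a)
    have "(space N - a) \<inter> ?B = ?B - a \<inter> ?B" by auto
    then show ?case using Compl B by auto
  next
    case (Union a)
    have *: "\<Union> (range a) \<inter> ?B = (\<Union>i. a i \<inter> ?B)" by auto
    show ?case unfolding * by (rule sets.countable_UN) (use Union in auto)
  }
qed simp

lemma DY_measurable:
  assumes "0 \<le> s" "0 \<le> t"
  shows "DY X Z s t \<in> borel_measurable N"
  unfolding DY_def
  by (intro borel_measurable_Pair borel_measurable_const X_random_time_measurable Z_meas)
    (use assms Z_nonneg in auto)

lemma DY_markov_increment: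
  assumes s: "0 \<le> s" "0 \<le> t" "0 \<le> h" and A: "A \<in> sets (natural_filtration N (DY X Z s) t)" and f: "f \<in> C0 UNIV"
  shows "(LINT \<omega>:A|N. f (X (Z (s + t + h) \<omega>) \<omega>)) =
    (LINT \<omega>:A|N. P (Z (s + t + h) \<omega> - Z (s + t) \<omega>) f (X (Z (s + t) \<omega>) \<omega>))"
proof (rule random_time_markov[OF _ _ _ _ _ _ f])
  show "A \<in> sets N"
    using A subalgebra_generated_by[of "{0..t}" "DY X Z s" N] DY_measurable[OF s(1)]
    by (auto simp: subalgebra_def)
  show "A \<inter> {\<omega> \<in> space N. Z (s + t) \<omega> \<le> q} \<in> sets (H q)" if "0 \<le> q" for q
    by (rule DY_filtration_H[OF s(1,2) that A])
qed (use s Z_nonneg Z_mono Z_FZ in auto)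

text \<open>The hypotheses give independence of X from Z and of an increment from the past of Z.
  Splitting off the event of X first and the increment afterwards yields independence of the
  increment from X and the past of Z jointly.\<close>

lemma Z_increment_indep:
  assumes s: "0 \<le> s" "s < t"
  shows "indep_set (sets (vimage_algebra (space N) (\<lambda>\<omega>. Z t \<omega> - Z s \<omega>) borel))
    (sets (join_sigma N FX (natural_filtration N Z s)))"
proof -
  let ?R = "\<lambda>\<omega>. Z t \<omega> - Z s \<omega>"
  let ?V = "vimage_algebra (space N) ?R borel"
  let ?G = "{A \<inter> B | A B. A \<in> sets FX \<and> B \<in> sets (natural_filtration N Z s)}"
  have sub: "subalgebra N FX" "subalgebra N (natural_filtration N Z s)" "subalgebra N FZ"
    by (auto intro: subalgebra_X subalgebra_Z)
  have RFZ: "?R \<in> borel_measurable FZ" using s by (intro borel_measurable_diff Z_FZ) auto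
  have V: "A \<in> sets FZ" if "A \<in> sets ?V" for A
    using that measurable_sets[OF RFZ] by (auto simp: sets_vimage_algebra2)
  have Zs: "sets (natural_filtration N Z s) \<subseteq> sets FZ" by (rule generated_by_mono) auto
  have "indep_set (sets ?V) ?G"
  proof (rule indep_setI)
    show "sets ?V \<subseteq> events" using V sub(3) by (auto simp: subalgebra_def)
    show "?G \<subseteq> events" using sub by (auto simp: subalgebra_def)
    fix a b assume a: "a \<in> sets ?V" and "b \<in> ?G"
    then obtain A B where b: "b = A \<inter> B" "A \<in> sets FX" "B \<in> sets (natural_filtration N Z s)" by blast
    have aB: "a \<inter> B \<in> sets FZ" "B \<in> sets FZ" using V[OF a] b(3) Zs by auto
    have "prob (a \<inter> b) = prob (A \<inter> (a \<inter> B))" unfolding b(1) by (simp add: Int_ac)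
    also have "\<dots> = prob A * prob (a \<inter> B)" by (rule indep_setD[OF indep_FX_FZ b(2) aB(1)])
    also have "prob (a \<inter> B) = prob a * prob B" by (rule indep_setD[OF Z_indep_increments[OF s] a b(3)])
    also have "prob A * (prob a * prob B) = prob a * (prob A * prob B)" by simp
    also have "prob A * prob B = prob b" unfolding b(1) by (rule indep_setD[OF indep_FX_FZ b(2) aB(2), symmetric])
    finally show "prob (a \<inter> b) = prob a * prob b" .
  qed
  from indep_set_sigma_sets[OF this _ Int_stable_join]
  have "indep_set (sigma_sets (space N) (sets ?V)) (sigma_sets (space N) ?G)"
    using sets.Int_stable[of ?V] by simp
  moreover have "sigma_sets (space N) (sets ?V) = sets ?V"
    using sets.sigma_sets_eq[of ?V] by simp
  ultimately show ?thesis unfolding sets_join_sigma[OF sub(1,2)] by simp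
qed

lemma Z_increment_indep_var:
  assumes s: "0 \<le> s" "s < t" and h: "h \<in> borel \<rightarrow>\<^sub>M S"
    and W: "W \<in> join_sigma N FX (natural_filtration N Z s) \<rightarrow>\<^sub>M T"
  shows "indep_var S (\<lambda>\<omega>. h (Z t \<omega> - Z s \<omega>)) T W"
proof (rule indep_var_subalgebras[OF Z_increment_indep[OF s] _ _ _ W])
  have "(\<lambda>\<omega>. Z t \<omega> - Z s \<omega>) \<in> borel_measurable N"
    using s by (intro borel_measurable_diff Z_meas) auto
  then show "subalgebra N (vimage_algebra (space N) (\<lambda>\<omega>. Z t \<omega> - Z s \<omega>) borel)"
    by (auto simp: subalgebra_def sets_vimage_algebra2)
  show "subalgebra N (join_sigma N FX (natural_filtration N Z s))"
    by (intro subalgebra_join subalgebra_X subalgebra_Z) auto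
  show "(\<lambda>\<omega>. h (Z t \<omega> - Z s \<omega>)) \<in> vimage_algebra (space N) (\<lambda>\<omega>. Z t \<omega> - Z s \<omega>) borel \<rightarrow>\<^sub>M S"
    by (rule measurable_compose[OF measurable_vimage_algebra1 h]) auto
qed

lemma Z_increments_indep_var:
  assumes s: "0 \<le> s" "s \<le> t" "t < u"
  shows "indep_var borel (\<lambda>\<omega>. Z u \<omega> - Z t \<omega>) borel (\<lambda>\<omega>. Z t \<omega> - Z s \<omega>)"
proof (rule Z_increment_indep_var[where h="\<lambda>r. r"])
  have "(\<lambda>\<omega>. Z t \<omega> - Z s \<omega>) \<in> borel_measurable (natural_filtration N Z t)"
    using s by (intro borel_measurable_diff measurable_generated_by) auto
  then show "(\<lambda>\<omega>. Z t \<omega> - Z s \<omega>) \<in> borel_measurable (join_sigma N FX (natural_filtration N Z t))"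
    by (rule measurable_larger)
      (use join_sigma_upper(2)[of N FX "natural_filtration N Z t"] subalgebra_X subalgebra_Z
        space_join_sigma[of N FX "natural_filtration N Z t"] in auto)
qed (use s in auto)

end

context time_change
begin

text \<open>In \<open>DY_markov_increment\<close> the increment of Z and the position are taken at
  the same outcome. The position and A are measurable in X and the past of Z, from which the
  increment is independent, so the increment may be replaced by an independent copy.\<close>

lemma DY_markov_integral:
  assumes s: "0 \<le> s" "0 \<le> t" "0 \<le> h" and A: "A \<in> sets (natural_filtration N (DY X Z s) t)" and f: "f \<in> C0 UNIV"
  shows "(LINT \<omega>:A|N. f (X (Z (s + t + h) \<omega>) \<omega>)) =
    (LINT \<omega>:A|N. LINT \<omega>'|N. P (Z (s + t + h) \<omega>' - Z (s + t) \<omega>') f (X (Z (s + t) \<omega>) \<omega>))"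
\<comment> \<open>Independence of increments is available only for strictly increasing
  times.\<close>
proof (cases "h = 0")
  case True
  then show ?thesis by (simp add: P_0 f prob_space)
next
  case False
  let ?R = "\<lambda>\<omega>. Z (s + t + h) \<omega> - Z (s + t) \<omega>"
  let ?J = "join_sigma N FX (natural_filtration N Z (s + t))"
  have sub: "subalgebra N FX" "subalgebra N (natural_filtration N Z (s + t))" using s by (auto intro: subalgebra_X subalgebra_Z)
  have spJ: "space ?J = space N" by (rule space_join_sigma[OF sub])
  have Zm: "Z (s + u) \<in> borel_measurable ?J" if "0 \<le> u" "u \<le> t" for u
    by (rule measurable_larger[OF measurable_generated_by[of "s + u" "{0..s+t}" Z N]])
      (use that s join_sigma_upper(2)[OF sub] spJ in auto)
  have Ym: "(\<lambda>\<omega>. X (Z (s + u) \<omega>) \<omega>) \<in> borel_measurable ?J" if "0 \<le> u" "u \<le> t" for u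
  proof (rule right_continuous_process_measurable[where Y=X and R="Z (s + u)"])
    show "Z (s + u) \<in> borel_measurable ?J" by (rule Zm[OF that])
    show "X v \<in> borel_measurable ?J" if "0 \<le> v" for v
      by (rule measurable_larger[OF measurable_generated_by[of v "{0..}" X N]])
        (use that join_sigma_upper(1)[OF sub] spJ in auto)
  qed (use that s spJ X_rc Z_nonneg in auto)
  \<comment> \<open>The whole path of X is adjoined because the times Z_(s+u) have no deterministic
    bound.\<close>
  have AJ: "A \<in> sets ?J"
  proof -
    have "DY X Z s u \<in> borel_measurable ?J" if "u \<in> {0..t}" for u
      unfolding DY_def using Ym[of u] that by (intro borel_measurable_Pair) auto
    from sets_generated_by_least[of ?J N "{0..t}" "DY X Z s", OF spJ this] A show ?thesis
      by (rule subsetD)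
  qed
  have AN: "A \<in> sets N" using AJ subalgebra_join[OF sub] by (auto simp: subalgebra_def)
  obtain B where B: "B \<ge> 0" "\<And>y. \<bar>f y\<bar> \<le> B" by (rule C0_boundE[OF f]) blast
  define W where "W = (\<lambda>\<omega>. (indicat_real A \<omega>, X (Z (s + t) \<omega>) \<omega>))"
  have W: "W \<in> ?J \<rightarrow>\<^sub>M borel \<Otimes>\<^sub>M borel"
    unfolding W_def by (intro measurable_Pair borel_measurable_indicator AJ Ym[of t]) (use s in simp_all)
  \<comment> \<open>\<open>indep_var\<close> wants both variables in the same type, hence the dummy component.\<close>
  define V where "V = (\<lambda>\<omega>. (?R \<omega>, 0 :: 'b))"
  \<comment> \<open>The clamps make \<open>\<Phi>\<close> bounded and measurable on the whole
    product. On the values that occur they change nothing: indicators lie in [0,1] and increments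
    are nonnegative.\<close>
  define \<Phi> where "\<Phi> = (\<lambda>z :: (real \<times> 'b) \<times> (real \<times> 'b).
    (min 1 (max 0 (fst (snd z)))) * P (max 0 (fst (fst z))) f (snd (snd z)))"
  have "(LINT \<omega>|N. \<Phi> (V \<omega>, W \<omega>)) = (LINT \<omega>|N. LINT \<omega>'|N. \<Phi> (V \<omega>', W \<omega>))"
  proof (rule indep_var_integral_fubini[where \<Phi>=\<Phi> and U=V and V=W])
    show "indep_var (borel \<Otimes>\<^sub>M borel) V (borel \<Otimes>\<^sub>M borel) W"
      unfolding V_def by (rule Z_increment_indep_var[OF _ _ _ W, where h="\<lambda>r. (r, 0)"]) (use s False in auto)
    show "\<Phi> \<in> borel_measurable ((borel \<Otimes>\<^sub>M borel) \<Otimes>\<^sub>M (borel \<Otimes>\<^sub>M borel))"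
      unfolding \<Phi>_def by (intro borel_measurable_times P_measurable[OF f]) measurable
    show "\<bar>\<Phi> z\<bar> \<le> B" for z
    proof -
      have "\<bar>min 1 (max 0 (fst (snd z)))\<bar> * \<bar>P (max 0 (fst (fst z))) f (snd (snd z))\<bar> \<le> 1 * B"
        by (intro mult_mono P_bound f B) auto
      then show ?thesis by (simp add: \<Phi>_def abs_mult)
    qed
  qed
  moreover have "\<Phi> (V \<omega>', W \<omega>) = indicat_real A \<omega> *\<^sub>R P (?R \<omega>') f (X (Z (s + t) \<omega>) \<omega>)"
    if "\<omega>' \<in> space N" for \<omega> \<omega>'
    using Z_mono[OF that, of "s + t" "s + t + h"] s unfolding \<Phi>_def W_def V_def
    by (auto simp: indicator_def max_def)
  ultimately show ?thesis
    unfolding DY_markov_increment[OF s A f] unfolding set_lebesgue_integral_def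
    by (simp cong: Bochner_Integration.integral_cong)
qed

end

section \<open>The transition operators of the time-changed process\<close>

locale subordinated_feller =
  fixes M :: "'b::euclidean_space \<Rightarrow> 'w measure"
    and X :: "real \<Rightarrow> 'w \<Rightarrow> 'b"
    and Z :: "real \<Rightarrow> 'w \<Rightarrow> real"
    and \<beta> :: "real \<Rightarrow> real"
    and g :: "real \<Rightarrow> real \<Rightarrow> real"
  assumes X_feller: "\<And>x. feller_process (M x) UNIV X (semigroup_of M X)"
    and X_start: "\<And>x. AE \<omega> in M x. X 0 \<omega> = x"
    and X_cadlag: "\<And>x \<omega>. \<omega> \<in> space (M x) \<Longrightarrow> cadlag (\<lambda>t. X t \<omega>)"
    and \<beta>_cont: "continuous_on {0..} \<beta>"
    and \<beta>_nonneg: "\<And>s. 0 \<le> s \<Longrightarrow> 0 \<le> \<beta> s"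
    and g_cont: "continuous_on ({0..} \<times> {0..}) (\<lambda>(s, r). g s r)"
    and g_nonneg: "\<And>s r. 0 \<le> s \<Longrightarrow> 0 \<le> r \<Longrightarrow> 0 \<le> g s r"
    and g_integrable: "\<And>s. 0 \<le> s \<Longrightarrow> set_integrable lborel {0<..} (\<lambda>r. min 1 r * g s r)"
    and Z_additive: "\<And>x. additive_subordinator (M x) Z"
    and Z_laplace: "\<And>x. has_laplace_exponent (M x) Z (psi \<beta> g)"
    and X_Z_indep: "\<And>x. indep_processes (M x) X Z"
begin

abbreviation P :: "real \<Rightarrow> ('b \<Rightarrow> real) \<Rightarrow> 'b \<Rightarrow> real" where "P \<equiv> semigroup_of M X"

sublocale feller UNIV P
  using X_feller[of undefined] by unfold_locales (auto simp: feller_process_def)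

lemma time_change: "time_change (M x) P X Z"
proof -
  have mp: "markov_process (M x) UNIV X P" using X_feller[of x] by (simp add: feller_process_def)
  then interpret prob_space "M x" by (simp add: markov_process_def)
  have Xm: "X t \<in> borel_measurable (M x)" if "0 \<le> t" for t
    using mp that by (simp add: markov_process_def)
  show ?thesis
  proof
    show "X t \<in> borel_measurable (M x)" if "0 \<le> t" for t by (rule Xm[OF that])
    show "continuous (at_right t) (\<lambda>t. X t \<omega>)" if "\<omega> \<in> space (M x)" "0 \<le> t" for \<omega> t
      using X_cadlag[OF that(1)] that(2) by (simp add: cadlag_def)
    show "(LINT \<omega>:A|M x. f (X (q + r) \<omega>)) = (LINT \<omega>:A|M x. P r f (X q \<omega>))"
      if q: "0 \<le> q" and r: "0 \<le> r" and f: "f \<in> C0 UNIV" and A: "A \<in> sets (natural_filtration (M x) X q)"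
      for q r A f
    proof -
      have sub: "subalgebra (M x) (natural_filtration (M x) X q)"
        using Xm by (intro subalgebra_generated_by) auto
      interpret F: finite_measure_subalgebra "M x" "natural_filtration (M x) X q"
        by unfold_locales (rule sub)
      have mf: "(\<lambda>\<omega>. f (X (q + r) \<omega>)) \<in> borel_measurable (M x)"
        using measurable_compose[OF Xm[of "q + r"] C0_borel_measurable[OF closed_UNIV f]] q r by simp
      obtain B where B: "\<And>y. \<bar>f y\<bar> \<le> B" by (rule C0_boundE[OF f]) blast
      have "integrable (M x) (\<lambda>\<omega>. f (X (q + r) \<omega>))"
        by (rule integrable_const_bound[where B=B]) (use B mf in auto)
      from F.real_cond_exp_intA[OF this A]
      have "(LINT \<omega>:A|M x. f (X (q + r) \<omega>)) =
        (LINT \<omega>:A|M x. real_cond_exp (M x) (natural_filtration (M x) X q) (\<lambda>\<omega>. f (X (q + r) \<omega>)) \<omega>)" .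
      also have "\<dots> = (LINT \<omega>:A|M x. P r f (X q \<omega>))"
      proof (rule set_lebesgue_integral_cong_AE)
        show "A \<in> events" using A sub by (auto simp: subalgebra_def)
        show "(\<lambda>\<omega>. P r f (X q \<omega>)) \<in> borel_measurable (M x)"
          using measurable_compose[OF Xm[OF q] C0_borel_measurable[OF closed_UNIV P_C0[OF r f]]] .
        show "AE \<omega>\<in>A in M x. real_cond_exp (M x) (natural_filtration (M x) X q) (\<lambda>\<omega>. f (X (q + r) \<omega>)) \<omega> = P r f (X q \<omega>)"
        proof -
          have "AE \<omega> in M x. real_cond_exp (M x) (natural_filtration (M x) X q) (\<lambda>\<omega>. f (X (q + r) \<omega>)) \<omega> = P r f (X q \<omega>)"
            using mp q r f unfolding markov_process_def by blast
          then show ?thesis by eventually_elim simp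
        qed
      qed simp
      finally show ?thesis .
    qed
    show "Z t \<in> borel_measurable (M x)" if "0 \<le> t" for t
      using Z_additive[of x] that by (simp add: additive_subordinator_def)
    show "0 \<le> Z t \<omega>" if "\<omega> \<in> space (M x)" "0 \<le> t" for \<omega> t
      using Z_additive[of x] that by (simp add: additive_subordinator_def)
    show "Z s \<omega> \<le> Z t \<omega>" if "\<omega> \<in> space (M x)" "0 \<le> s" "s \<le> t" for \<omega> s t
      using Z_additive[of x] that by (auto simp: additive_subordinator_def mono_on_def)
    show "indep_set (sets (vimage_algebra (space (M x)) (\<lambda>\<omega>. Z t \<omega> - Z s \<omega>) borel))
        (sets (natural_filtration (M x) Z s))" if "0 \<le> s" "s < t" for s t
      using Z_additive[of x] that by (simp add: additive_subordinator_def)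
    show "indep_processes (M x) X Z" by (rule X_Z_indep)
  qed
qed

sublocale tc: time_change "M x" P X Z for x
  by (rule time_change)

lemma Z_nonneg: "\<omega> \<in> space (M x) \<Longrightarrow> 0 \<le> t \<Longrightarrow> 0 \<le> Z t \<omega>"
  by (rule tc.Z_nonneg)

lemma Z_mono: "\<omega> \<in> space (M x) \<Longrightarrow> 0 \<le> s \<Longrightarrow> s \<le> t \<Longrightarrow> Z s \<omega> \<le> Z t \<omega>"
  by (rule tc.Z_mono)

lemma incr_measurable: "0 \<le> s \<Longrightarrow> 0 \<le> t \<Longrightarrow> (\<lambda>\<omega>. Z t \<omega> - Z s \<omega>) \<in> borel_measurable (M x)"
  by (intro borel_measurable_diff tc.Z_meas)

section \<open>Laws of the increments of Z\<close>

lemma indep_incr_Z: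
  assumes "0 \<le> s" "s < t"
  shows "tc.indep_var x borel (\<lambda>\<omega>. Z t \<omega> - Z s \<omega>) borel (Z s)"
proof (rule tc.Z_increment_indep_var[OF assms, where h="\<lambda>r. r"])
  show "Z s \<in> borel_measurable (join_sigma (M x) (generated_by (M x) {0..} X) (natural_filtration (M x) Z s))"
    by (rule measurable_larger[OF measurable_generated_by[of s "{0..s}" Z "M x"]])
      (use assms join_sigma_upper(2)[of "M x" "generated_by (M x) {0..} X" "natural_filtration (M x) Z s"]
        tc.subalgebra_X tc.subalgebra_Z
        space_join_sigma[of "M x" "generated_by (M x) {0..} X" "natural_filtration (M x) Z s"] in auto)
qed simp

lemma laplace:
  assumes "0 \<le> t" "0 \<le> Re u"
  shows "(LINT \<omega>|M x. exp (- u * complex_of_real (Z t \<omega>))) = exp (LINT s:{0..t}|lborel. psi \<beta> g s u)"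
    and "set_integrable lborel {0..t} (\<lambda>s. psi \<beta> g s u)"
  using Z_laplace[of x] Z_laplace[of undefined] assms unfolding has_laplace_exponent_def by blast+

text \<open>Z_t is the sum of Z_s and an independent increment, so Laplace transforms multiply; that
  of Z_s is an exponential and can be divided out.\<close>

lemma laplace_increment:
  assumes st: "0 \<le> s" "s \<le> t" and u: "0 \<le> Re u"
  shows "(LINT \<omega>|M x. exp (- u * complex_of_real (Z t \<omega> - Z s \<omega>))) =
    exp ((LINT s:{0..t}|lborel. psi \<beta> g s u) - (LINT s:{0..s}|lborel. psi \<beta> g s u))"
proof (cases "s = t")
  case True
  then show ?thesis by (simp add: tc.prob_space)
next
  case False
  let ?e = "\<lambda>z. exp (- u * complex_of_real z)"
  have em: "?e \<in> borel_measurable borel" by measurable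
  have ind: "tc.indep_var x borel (?e \<circ> (\<lambda>\<omega>. Z t \<omega> - Z s \<omega>)) borel (?e \<circ> Z s)"
    by (rule tc.indep_var_compose[OF indep_incr_Z em em]) (use st False in auto)
  have int: "integrable (M x) (\<lambda>\<omega>. ?e (R \<omega>))"
    if "R \<in> borel_measurable (M x)" "\<And>\<omega>. \<omega> \<in> space (M x) \<Longrightarrow> 0 \<le> R \<omega>" for R
    by (rule tc.integrable_const_bound[where B=1])
      (use measurable_compose[OF that(1) em] that(2) u in \<open>auto simp: norm_exp_eq_Re intro!: AE_I2\<close>)
  have Zm: "Z s \<in> borel_measurable (M x)" using st by (intro tc.Z_meas) auto
  have "(LINT \<omega>|M x. ?e (Z t \<omega> - Z s \<omega>) * ?e (Z s \<omega>)) =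
      (LINT \<omega>|M x. ?e (Z t \<omega> - Z s \<omega>)) * (LINT \<omega>|M x. ?e (Z s \<omega>))"
    using tc.indep_var_lebesgue_integral[OF ind[unfolded o_def]
      int[OF incr_measurable] int[OF Zm]] st Z_mono Z_nonneg by simp
  moreover have "?e (Z t \<omega> - Z s \<omega>) * ?e (Z s \<omega>) = ?e (Z t \<omega>)" for \<omega>
    by (simp add: exp_add[symmetric] algebra_simps)
  ultimately have "exp (LINT s:{0..t}|lborel. psi \<beta> g s u) =
      (LINT \<omega>|M x. ?e (Z t \<omega> - Z s \<omega>)) * exp (LINT s:{0..s}|lborel. psi \<beta> g s u)"
    using laplace(1)[of t u x] laplace(1)[of s u x] st u by simp
  then show ?thesis by (simp add: exp_diff field_simps)
qed

text \<open>The starting laws share the Laplace exponent, whose values on the imaginary axis give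
  the characteristic function of the increment and thereby determine its law.\<close>

lemma increment_law:
  assumes st: "0 \<le> s" "s \<le> t"
  shows "distr (M x) borel (\<lambda>\<omega>. Z t \<omega> - Z s \<omega>) = distr (M y) borel (\<lambda>\<omega>. Z t \<omega> - Z s \<omega>)"
proof (rule Levy_uniqueness)
  have "char (distr (M x) borel (\<lambda>\<omega>. Z t \<omega> - Z s \<omega>)) \<theta> =
    exp ((LINT s:{0..t}|lborel. psi \<beta> g s (- \<i> * \<theta>)) - (LINT s:{0..s}|lborel. psi \<beta> g s (- \<i> * \<theta>)))" for x \<theta>
  proof -
    have "char (distr (M x) borel (\<lambda>\<omega>. Z t \<omega> - Z s \<omega>)) \<theta> =
        (LINT \<omega>|M x. exp (- (- \<i> * \<theta>) * complex_of_real (Z t \<omega> - Z s \<omega>)))"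
      unfolding char_def using st
      by (subst integral_distr[OF incr_measurable]) (auto simp: algebra_simps)
    also have "\<dots> = exp ((LINT s:{0..t}|lborel. psi \<beta> g s (- \<i> * \<theta>)) - (LINT s:{0..s}|lborel. psi \<beta> g s (- \<i> * \<theta>)))"
      by (rule laplace_increment[OF st]) simp
    finally show ?thesis .
  qed
  then show "char (distr (M x) borel (\<lambda>\<omega>. Z t \<omega> - Z s \<omega>)) = char (distr (M y) borel (\<lambda>\<omega>. Z t \<omega> - Z s \<omega>))"
    by auto
qed (use st incr_measurable in \<open>auto intro!: tc.real_distribution_distr\<close>)

text \<open>By \<open>increment_law\<close> the starting point \<open>0\<close> stands for any other.\<close>

definition U :: "real \<Rightarrow> real \<Rightarrow> ('b \<Rightarrow> real) \<Rightarrow> 'b \<Rightarrow> real" where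
  "U s t v x = (LINT \<omega>|M 0. P (Z t \<omega> - Z s \<omega>) v x)"

lemma P_incr_measurable:
  assumes "0 \<le> s" "s \<le> t" "v \<in> C0 UNIV"
  shows "(\<lambda>\<omega>. P (Z t \<omega> - Z s \<omega>) v y) \<in> borel_measurable (M x)"
  by (rule P_measurable'[OF assms(3) incr_measurable]) (use assms Z_mono in auto)

lemma U_eq:
  assumes st: "0 \<le> s" "s \<le> t" and v: "v \<in> C0 UNIV"
  shows "U s t v x = (LINT \<omega>|M y. P (Z t \<omega> - Z s \<omega>) v x)"
proof -
  have *: "(LINT \<omega>|M y. P (Z t \<omega> - Z s \<omega>) v x) =
      (LINT r|distr (M y) borel (\<lambda>\<omega>. Z t \<omega> - Z s \<omega>). P (max 0 r) v x)" for y
  proof -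
    have "(LINT \<omega>|M y. P (Z t \<omega> - Z s \<omega>) v x) = (LINT \<omega>|M y. P (max 0 (Z t \<omega> - Z s \<omega>)) v x)"
      by (intro Bochner_Integration.integral_cong refl) (use Z_mono st in auto)
    also have "\<dots> = (LINT r|distr (M y) borel (\<lambda>\<omega>. Z t \<omega> - Z s \<omega>). P (max 0 r) v x)"
      using st by (intro integral_distr[symmetric] incr_measurable P_measurable[OF v]) auto
    finally show ?thesis .
  qed
  show ?thesis unfolding U_def * using increment_law[OF st, of 0 y] by simp
qed

text \<open>Connects the definition of \<open>DY_semigroup\<close>, an expectation of X at a random
  time, with \<open>U\<close>, where the randomness of X is absorbed into P and only that of Z
  remains.\<close>

lemma expectation_X_increment:
  assumes st: "0 \<le> s" "s \<le> t" and v: "v \<in> C0 UNIV"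
  shows "(LINT \<omega>|M x. v (X (Z t \<omega> - Z s \<omega>) \<omega>)) = U s t v x"
proof -
  have "(LINT \<omega>|M x. v (X (Z t \<omega> - Z s \<omega>) \<omega>)) = (LINT \<omega>|M x. P (Z t \<omega> - Z s \<omega>) v (X 0 \<omega>))"
    by (rule tc.expectation_X_random_time[OF _ _ v, where R="\<lambda>\<omega>. Z t \<omega> - Z s \<omega>"])
      (use st Z_mono tc.Z_FZ in auto)
  also have "\<dots> = (LINT \<omega>|M x. P (Z t \<omega> - Z s \<omega>) v x)"
  proof (rule integral_cong_AE)
    show "(\<lambda>\<omega>. P (Z t \<omega> - Z s \<omega>) v (X 0 \<omega>)) \<in> borel_measurable (M x)"
      by (rule P_measurable'[OF v incr_measurable tc.X_meas]) (use st Z_mono in auto)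
    show "AE \<omega> in M x. P (Z t \<omega> - Z s \<omega>) v (X 0 \<omega>) = P (Z t \<omega> - Z s \<omega>) v x"
      using X_start[of x] by eventually_elim simp
  qed (rule P_incr_measurable[OF st v])
  finally show ?thesis using U_eq[OF st v, of x x] by simp
qed

lemma U_refl: "v \<in> C0 UNIV \<Longrightarrow> U s s v = v"
  unfolding U_def by (simp add: P_0 tc.prob_space)

lemma U_C0:
  assumes st: "0 \<le> s" "s \<le> t" and v: "v \<in> C0 UNIV"
  shows "U s t v \<in> C0 UNIV"
proof -
  obtain B where B: "\<And>y. \<bar>v y\<bar> \<le> B" by (rule C0_boundE[OF v]) blast
  have "(\<lambda>x. LINT \<omega>|M 0. P (Z t \<omega> - Z s \<omega>) v x) \<in> C0 UNIV"
    by (rule C0_integral[where B=B, OF closed_UNIV tc.finite_measure_axioms])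
      (use P_C0[OF _ v] P_bound[OF _ v B] P_incr_measurable[OF st v] Z_mono st in auto)
  then show ?thesis by (simp add: U_def[abs_def])
qed

lemma U_integrable:
  assumes st: "0 \<le> s" "s \<le> t" and v: "v \<in> C0 UNIV"
  shows "integrable (M 0) (\<lambda>\<omega>. P (Z t \<omega> - Z s \<omega>) v x)"
proof -
  obtain B where B: "\<And>y. \<bar>v y\<bar> \<le> B" by (rule C0_boundE[OF v]) blast
  show ?thesis
    by (rule tc.integrable_const_bound[where B=B])
      (use P_bound[OF _ v B] P_incr_measurable[OF st v] Z_mono st in auto)
qed

lemma U_bound:
  assumes st: "0 \<le> s" "s \<le> t" and v: "v \<in> C0 UNIV" and B: "\<And>y. \<bar>v y\<bar> \<le> B"
  shows "\<bar>U s t v x\<bar> \<le> B"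
proof -
  have "\<bar>U s t v x\<bar> \<le> (LINT \<omega>|M 0. \<bar>P (Z t \<omega> - Z s \<omega>) v x\<bar>)"
    unfolding U_def by (rule integral_abs_bound)
  also have "\<dots> \<le> (LINT \<omega>|M 0. B)"
    by (rule integral_mono) (use U_integrable[OF st v] P_bound[OF _ v B] Z_mono st in auto)
  also have "\<dots> = B" by (simp add: tc.prob_space)
  finally show ?thesis .
qed

lemma U_lincomb:
  assumes st: "0 \<le> s" "s \<le> t" and v: "v \<in> C0 UNIV" "w \<in> C0 UNIV"
  shows "U s t (\<lambda>z. a * v z + b * w z) x = a * U s t v x + b * U s t w x"
proof -
  have "U s t (\<lambda>z. a * v z + b * w z) x =
      (LINT \<omega>|M 0. a * P (Z t \<omega> - Z s \<omega>) v x + b * P (Z t \<omega> - Z s \<omega>) w x)"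
    unfolding U_def by (intro Bochner_Integration.integral_cong refl) (use Z_mono st P_lincomb v in auto)
  also have "\<dots> = a * U s t v x + b * U s t w x"
    unfolding U_def using U_integrable[OF st v(1)] U_integrable[OF st v(2)] by simp
  finally show ?thesis .
qed

lemma U_diff:
  assumes "0 \<le> s" "s \<le> t" "v \<in> C0 UNIV" "w \<in> C0 UNIV"
  shows "U s t (\<lambda>z. v z - w z) x = U s t v x - U s t w x"
  using U_lincomb[OF assms, of 1 "-1"] by simp

lemma U_nonneg:
  assumes st: "0 \<le> s" "s \<le> t" and v: "v \<in> C0 UNIV" "\<And>y. 0 \<le> v y"
  shows "0 \<le> U s t v x"
  using expectation_X_increment[OF st v(1), of x] v(2)
  by (metis Bochner_Integration.integral_nonneg)

lemma U_P:
  assumes st: "0 \<le> s" "s \<le> t" and r: "0 \<le> r" and v: "v \<in> C0 UNIV"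
  shows "U s t (P r v) x = (LINT \<omega>|M 0. P (Z t \<omega> - Z s \<omega> + r) v x)"
  unfolding U_def by (intro Bochner_Integration.integral_cong refl) (use Z_mono st P_add r v in auto)

text \<open>P_r commutes with the expectation in \<open>U t u\<close> by Fubini, the semigroup law
  adds the two times, and independence of successive increments merges the two expectations into one
  over Z_u - Z_s.\<close>

lemma U_chain:
  assumes st: "0 \<le> s" "s \<le> t" "t \<le> u" and v: "v \<in> C0 UNIV"
  shows "U s t (U t u v) x = U s u v x"
proof (cases "t = u")
  case True
  then show ?thesis by (simp add: U_refl v)
next
  case False
  obtain B where B: "\<And>y. \<bar>v y\<bar> \<le> B" by (rule C0_boundE[OF v]) blast
  let ?R = "\<lambda>\<omega>. Z t \<omega> - Z s \<omega>" and ?R' = "\<lambda>\<omega>. Z u \<omega> - Z t \<omega>"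
  have R: "0 \<le> ?R \<omega>" "0 \<le> ?R' \<omega>" if "\<omega> \<in> space (M 0)" for \<omega>
    using Z_mono[OF that] st by auto
  have Rm: "?R \<in> borel_measurable (M 0)" "?R' \<in> borel_measurable (M 0)"
    using st by (auto intro: incr_measurable)
  have P_U: "P r (U t u v) x = (LINT \<omega>|M 0. P (r + ?R' \<omega>) v x)" if r: "0 \<le> r" for r
  proof -
    interpret pair_prob_space "M x" "M 0" ..
    \<comment> \<open>P_r is unfolded as an expectation under \<open>M x\<close> while U stays under
      \<open>M 0\<close>, which produces the product measure for Fubini.\<close>
    have "P r (U t u v) x = (LINT \<omega>|M x. LINT \<omega>'|M 0. P (?R' \<omega>') v (X r \<omega>))"
      unfolding semigroup_of_def[of M X r] U_def ..
    also have "\<dots> = (LINT \<omega>'|M 0. LINT \<omega>|M x. P (?R' \<omega>') v (X r \<omega>))"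
    proof (rule Fubini_integral[symmetric])
      have "(\<lambda>z. P (?R' (snd z)) v (X r (fst z))) \<in> borel_measurable (M x \<Otimes>\<^sub>M M 0)"
        by (rule P_measurable'[OF v measurable_compose[OF measurable_snd Rm(2)]
              measurable_compose[OF measurable_fst tc.X_meas[OF r]]])
          (use R in \<open>auto simp: space_pair_measure\<close>)
      then show "integrable (M x \<Otimes>\<^sub>M M 0) (\<lambda>(\<omega>, \<omega>'). P (?R' \<omega>') v (X r \<omega>))"
        unfolding case_prod_unfold
        by (intro integrable_const_bound[where B=B])
          (use P_bound[OF _ v B] R in \<open>auto simp: space_pair_measure intro!: AE_I2\<close>)
    qed
    also have "\<dots> = (LINT \<omega>'|M 0. P (r + ?R' \<omega>') v x)"
    proof (rule Bochner_Integration.integral_cong[OF refl])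
      fix \<omega>' assume "\<omega>' \<in> space (M 0)"
      from P_add[OF r R(2)[OF this] v]
      show "(LINT \<omega>|M x. P (?R' \<omega>') v (X r \<omega>)) = P (r + ?R' \<omega>') v x"
        unfolding semigroup_of_def[of M X r] by simp
    qed
    finally show ?thesis .
  qed
  \<comment> \<open>The later increment is the first component, in the order of
    \<open>Z_increments_indep_var\<close>; averaging over it with the earlier increment frozen at r
    gives P_r applied to \<open>U t u v\<close>.\<close>
  define \<Phi> where "\<Phi> = (\<lambda>z. P (max 0 (snd z + fst z)) v x)"
  have "(LINT \<omega>|M 0. \<Phi> (?R' \<omega>, ?R \<omega>)) = (LINT \<omega>|M 0. LINT \<omega>'|M 0. \<Phi> (?R' \<omega>', ?R \<omega>))"
  proof (rule tc.indep_var_integral_fubini[where \<Phi>=\<Phi> and U="?R'" and V="?R"])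
    show "tc.indep_var 0 borel ?R' borel ?R"
      by (rule tc.Z_increments_indep_var) (use st False in auto)
    show "\<Phi> \<in> borel_measurable (borel \<Otimes>\<^sub>M borel)"
      unfolding \<Phi>_def by (intro P_measurable[OF v]) auto
    show "\<bar>\<Phi> z\<bar> \<le> B" for z unfolding \<Phi>_def by (intro P_bound[OF _ v B]) auto
  qed
  moreover have "(LINT \<omega>|M 0. \<Phi> (?R' \<omega>, ?R \<omega>)) = U s u v x"
    unfolding U_def \<Phi>_def
    by (intro Bochner_Integration.integral_cong refl) (use R in \<open>force simp: max_def\<close>)
  moreover have "(LINT \<omega>|M 0. LINT \<omega>'|M 0. \<Phi> (?R' \<omega>', ?R \<omega>)) = U s t (U t u v) x"
  proof -
    have "(LINT \<omega>'|M 0. \<Phi> (?R' \<omega>', ?R \<omega>)) = P (?R \<omega>) (U t u v) x" if "\<omega> \<in> space (M 0)" for \<omega>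
      unfolding P_U[OF R(1)[OF that]] \<Phi>_def
      by (intro Bochner_Integration.integral_cong refl) (use R that in \<open>simp add: max_def add_nonneg_nonneg\<close>)
    then show ?thesis unfolding U_def[of s t] by (simp cong: Bochner_Integration.integral_cong)
  qed
  ultimately show ?thesis by simp
qed

end

section \<open>The Feller property\<close>

text \<open>1 - exp(-|x|) serves as a bounded distance for convergence in probability whose
  expectation can be read off the Laplace transform; subadditivity separates the displacements of
  the two end points of an increment. It amounts to (1 - exp(-a)) (1 - exp(-b)) >= 0.\<close>

lemma one_minus_exp_subadditive:
  fixes a b c :: real
  assumes "0 \<le> a" "0 \<le> b" "c \<le> a + b"
  shows "1 - exp (- c) \<le> (1 - exp (- a)) + (1 - exp (- b))"
proof -
  have "0 \<le> (1 - exp (- a)) * (1 - exp (- b))" using assms by (intro mult_nonneg_nonneg) auto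
  moreover have "exp (- a) * exp (- b) \<le> exp (- c)" using assms by (simp add: exp_add[symmetric])
  ultimately show ?thesis by (simp add: algebra_simps)
qed

context subordinated_feller
begin

section \<open>The Laplace exponent at real arguments and continuity in probability\<close>

definition psir :: "real \<Rightarrow> real \<Rightarrow> real" where
  "psir l s = - l * \<beta> s + (LINT r:{0<..}|lborel. (exp (- l * r) - 1) * g s r)"

lemma exp_of_real_mult:
  "exp (- complex_of_real l * complex_of_real r) = complex_of_real (exp (- l * r))"
  by (simp flip: exp_of_real)

lemma psi_of_real: "psi \<beta> g s (of_real l) = of_real (psir l s)"
proof -
  have "(exp (- complex_of_real l * complex_of_real r) - 1) * complex_of_real (g s r) =
      complex_of_real ((exp (- l * r) - 1) * g s r)" for r
    by (simp only: exp_of_real_mult of_real_mult of_real_diff of_real_1)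
  then show ?thesis
    unfolding psi_def psir_def by (simp only: set_integral_complex_of_real) simp
qed

lemma psir_integrable:
  assumes "0 \<le> l" "0 \<le> t"
  shows "set_integrable lborel {0..t} (psir l)"
proof -
  have "set_integrable lborel {0..t} (\<lambda>s. complex_of_real (psir l s))"
    using laplace(2)[of t "of_real l"] assms by (simp add: psi_of_real)
  moreover have "indicat_real {0..t} s *\<^sub>R complex_of_real (psir l s) =
      complex_of_real (indicat_real {0..t} s *\<^sub>R psir l s)" for s
    by (simp add: scaleR_conv_of_real)
  ultimately show ?thesis unfolding set_integrable_def by (simp only: complex_of_real_integrable_eq)
qed

definition Psi :: "real \<Rightarrow> real \<Rightarrow> real" where
  "Psi l t = (LINT s:{0..t}|lborel. psir l s)"

lemma laplace_real:
  assumes "0 \<le> s" "s \<le> t" "0 \<le> l"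
  shows "(LINT \<omega>|M x. exp (- l * (Z t \<omega> - Z s \<omega>))) = exp (Psi l t - Psi l s)"
proof -
  have "complex_of_real (LINT \<omega>|M x. exp (- l * (Z t \<omega> - Z s \<omega>))) =
      (LINT \<omega>|M x. exp (- of_real l * complex_of_real (Z t \<omega> - Z s \<omega>)))"
    by (simp only: exp_of_real_mult integral_complex_of_real)
  also have "\<dots> = exp ((LINT s:{0..t}|lborel. psi \<beta> g s (of_real l)) - (LINT s:{0..s}|lborel. psi \<beta> g s (of_real l)))"
    using assms by (intro laplace_increment) auto
  also have "\<dots> = complex_of_real (exp (Psi l t - Psi l s))"
    unfolding psi_of_real Psi_def set_integral_complex_of_real by (simp flip: exp_of_real)
  finally show ?thesis by (simp only: of_real_eq_iff)
qed

lemma Psi_continuous: "0 \<le> l \<Longrightarrow> 0 \<le> T \<Longrightarrow> continuous_on {0..T} (Psi l)"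
  unfolding Psi_def[abs_def] by (intro set_integral_Icc_continuous psir_integrable)

text \<open>For a <= b the expectation is 1 - exp(Psi(b) - Psi(a)) at argument 1, hence at most
  Psi(a) - Psi(b) by 1 + x <= exp x, and Psi is uniformly continuous on [0,T] as an indefinite
  integral.\<close>

lemma increments_small:
  assumes "0 \<le> T" "0 < e"
  obtains d where "d > 0" "\<And>a b. 0 \<le> a \<Longrightarrow> 0 \<le> b \<Longrightarrow> a \<le> T \<Longrightarrow> b \<le> T \<Longrightarrow> \<bar>b - a\<bar> < d \<Longrightarrow>
    (LINT \<omega>|M 0. 1 - exp (- \<bar>Z b \<omega> - Z a \<omega>\<bar>)) \<le> e"
proof -
  have "uniformly_continuous_on {0..T} (Psi 1)"
    by (rule compact_uniformly_continuous[OF Psi_continuous]) (use assms in auto)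
  then obtain d where d: "d > 0" "\<And>a b. a \<in> {0..T} \<Longrightarrow> b \<in> {0..T} \<Longrightarrow> dist b a < d \<Longrightarrow> dist (Psi 1 b) (Psi 1 a) < e"
    using assms unfolding uniformly_continuous_on_def by metis
  have *: "(LINT \<omega>|M 0. 1 - exp (- \<bar>Z b \<omega> - Z a \<omega>\<bar>)) \<le> e"
    if ab: "0 \<le> a" "a \<le> b" "b \<le> T" "b - a < d" for a b
  proof -
    have "(LINT \<omega>|M 0. 1 - exp (- \<bar>Z b \<omega> - Z a \<omega>\<bar>)) = (LINT \<omega>|M 0. 1 - exp (- 1 * (Z b \<omega> - Z a \<omega>)))"
      by (intro Bochner_Integration.integral_cong refl) (use Z_mono ab in auto)
    also have "\<dots> = 1 - (LINT \<omega>|M 0. exp (- 1 * (Z b \<omega> - Z a \<omega>)))"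
    proof (subst Bochner_Integration.integral_diff)
      show "integrable (M 0) (\<lambda>\<omega>. exp (- 1 * (Z b \<omega> - Z a \<omega>)))"
      proof (rule tc.integrable_const_bound[where B=1])
        show "(\<lambda>\<omega>. exp (- 1 * (Z b \<omega> - Z a \<omega>))) \<in> borel_measurable (M 0)"
          using measurable_compose[OF incr_measurable[of a b 0], of "\<lambda>r. exp (- 1 * r)" borel] ab by simp
      qed (use Z_mono ab in auto)
    qed (auto simp: tc.prob_space)
    also have "\<dots> = 1 - exp (Psi 1 b - Psi 1 a)"
      using laplace_real[of a b 1 0] ab by simp
    also have "\<dots> \<le> - (Psi 1 b - Psi 1 a)"
      using exp_ge_add_one_self[of "Psi 1 b - Psi 1 a"] by linarith
    also have "\<dots> \<le> e"
      using d(2)[of a b] ab by (auto simp: dist_real_def)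
    finally show ?thesis .
  qed
  have "(LINT \<omega>|M 0. 1 - exp (- \<bar>Z b \<omega> - Z a \<omega>\<bar>)) \<le> e"
    if "0 \<le> a" "0 \<le> b" "a \<le> T" "b \<le> T" "\<bar>b - a\<bar> < d" for a b
    using *[of a b] *[of b a] that by (cases "a \<le> b") (auto simp: abs_minus_commute)
  with d(1) show ?thesis by (rule that)
qed

text \<open>Families on which strong continuity of P is uniform. In \<open>Q t f\<close> the slice
  of f moves with the starting time, so a modulus for each single function would not
  suffice.\<close>

definition equi :: "('b \<Rightarrow> real) set \<Rightarrow> bool" where
  "equi W \<longleftrightarrow> W \<subseteq> C0 UNIV \<and> (\<exists>B. \<forall>v\<in>W. \<forall>y. \<bar>v y\<bar> \<le> B) \<and>
    (\<forall>e>0. \<exists>d>0. \<forall>v\<in>W. \<forall>r. 0 \<le> r \<longrightarrow> r < d \<longrightarrow> (\<forall>y. \<bar>P r v y - v y\<bar> \<le> e))"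

text \<open>Slices vary uniformly with time and are small at late times, so finitely many of them on
  a grid carry the modulus; as a contraction P transfers it to the slices in between.\<close>

lemma equi_slices:
  assumes f: "f \<in> C0 time_space"
  shows "equi ((\<lambda>s y. f (s, y)) ` {0..})"
  unfolding equi_def
proof (intro conjI allI impI)
  show "(\<lambda>s y. f (s, y)) ` {0..} \<subseteq> C0 UNIV" using C0_time_slice[OF f] by auto
  obtain B where "\<And>z. \<bar>f z\<bar> \<le> B" by (rule C0_boundE[OF f]) blast
  then show "\<exists>B. \<forall>v\<in>(\<lambda>s y. f (s, y)) ` {0..}. \<forall>y. \<bar>v y\<bar> \<le> B" by auto
  fix e :: real assume e: "e > 0"
  obtain n where n: "n \<ge> 0" "\<And>s x. s \<ge> n \<Longrightarrow> \<bar>f (s, x)\<bar> \<le> e / 2"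
    by (rule C0_time_tail[OF f, of "e / 2"]) (use e in auto)
  obtain c where c: "c > 0" "\<And>s s' x. 0 \<le> s \<Longrightarrow> 0 \<le> s' \<Longrightarrow> \<bar>s - s'\<bar> < c \<Longrightarrow> \<bar>f (s, x) - f (s', x)\<bar> \<le> e / 3"
    by (rule C0_time_uniform[OF f, of "e / 3"]) (use e in auto)
  define grid where "grid k = real k * (c / 2)" for k
  obtain m where m: "n < real m * (c / 2)" using ex_less_of_nat_mult[of "c / 2" n] c by auto
  have "\<exists>d>0. \<forall>r. 0 \<le> r \<longrightarrow> r < d \<longrightarrow> (\<forall>y. \<bar>P r (\<lambda>y. f (grid k, y)) y - f (grid k, y)\<bar> \<le> e / 3)" for k
  proof -
    have "0 \<le> grid k" using c by (simp add: grid_def)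
    show ?thesis by (rule P_strong[OF C0_time_slice[OF f \<open>0 \<le> grid k\<close>], of "e / 3"]) (use e in auto)
  qed
  then obtain D where D: "\<And>k. D k > 0"
    "\<And>k r y. 0 \<le> r \<Longrightarrow> r < D k \<Longrightarrow> \<bar>P r (\<lambda>y. f (grid k, y)) y - f (grid k, y)\<bar> \<le> e / 3"
    by metis
  \<comment> \<open>Every time below n has a grid point of index at most m within distance c to its
    left, so the least of these finitely many moduli serves them all.\<close>
  define d where "d = Min (D ` {..m})"
  have d: "d > 0" unfolding d_def using D(1) by (subst Min_gr_iff) auto
  have dD: "d \<le> D k" if "k \<le> m" for k unfolding d_def using that by (intro Min_le) auto
  have "\<bar>P r (\<lambda>y. f (s, y)) y - f (s, y)\<bar> \<le> e" if s: "0 \<le> s" and r: "0 \<le> r" "r < d" for s r y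
  proof (cases "n \<le> s")
    case True
    have "\<bar>P r (\<lambda>y. f (s, y)) y\<bar> \<le> e / 2"
      by (rule P_bound[OF r(1) C0_time_slice[OF f s]]) (use n True in auto)
    with n(2)[OF True, of y] show ?thesis by linarith
  next
    case False
    define k where "k = nat \<lfloor>s / (c / 2)\<rfloor>"
    have k1: "grid k \<le> s" and k2: "s < grid k + c"
    proof -
      have "real k \<le> s / (c / 2)" "s / (c / 2) < real k + 1"
        unfolding k_def using s c(1) by (auto simp: of_nat_nat)
      then have "real k * (c / 2) \<le> s" "s < (real k + 1) * (c / 2)"
        using c(1) by (simp_all add: pos_le_divide_eq pos_divide_less_eq)
      then show "grid k \<le> s" "s < grid k + c" unfolding grid_def using c(1) by (auto simp: algebra_simps)
    qed
    have "real k * (c / 2) < real m * (c / 2)" using k1 m False unfolding grid_def by linarith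
    then have "k \<le> m" using c(1) by (simp add: mult_less_cancel_right)
    have g0: "0 \<le> grid k" using c by (simp add: grid_def)
    have close: "\<bar>f (s, y) - f (grid k, y)\<bar> \<le> e / 3" for y
      using c(2)[OF s g0, of y] k1 k2 by auto
    have "\<bar>P r (\<lambda>y. f (s, y) - f (grid k, y)) y\<bar> \<le> e / 3"
      by (rule P_bound[OF r(1) C0_diff[OF closed_UNIV C0_time_slice[OF f s] C0_time_slice[OF f g0]] close])
    then have "\<bar>P r (\<lambda>y. f (s, y)) y - P r (\<lambda>y. f (grid k, y)) y\<bar> \<le> e / 3"
      by (simp add: P_diff[OF r(1) C0_time_slice[OF f s] C0_time_slice[OF f g0]])
    moreover have "\<bar>P r (\<lambda>y. f (grid k, y)) y - f (grid k, y)\<bar> \<le> e / 3"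
      by (rule D(2)) (use r dD[OF \<open>k \<le> m\<close>] in auto)
    ultimately show ?thesis using close[of y] by linarith
  qed
  with d show "\<exists>d>0. \<forall>v\<in>(\<lambda>s y. f (s, y)) ` {0..}. \<forall>r. 0 \<le> r \<longrightarrow> r < d \<longrightarrow> (\<forall>y. \<bar>P r v y - v y\<bar> \<le> e)"
    by blast
qed

text \<open>If the two increments differ by less than c, strong continuity applies; otherwise the
  difference is at most 2 B, and the probability of this event is controlled by the expectation of 1
  - exp(-|difference|).\<close>

lemma U_equicontinuous:
  assumes W: "equi W" and T: "0 \<le> T" and e: "0 < e"
  obtains d where "d > 0"
    "\<And>v s t s' t' x. v \<in> W \<Longrightarrow> 0 \<le> s \<Longrightarrow> s \<le> t \<Longrightarrow> t \<le> T \<Longrightarrow> 0 \<le> s' \<Longrightarrow> s' \<le> t' \<Longrightarrow> t' \<le> T \<Longrightarrow>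
      \<bar>s - s'\<bar> < d \<Longrightarrow> \<bar>t - t'\<bar> < d \<Longrightarrow> \<bar>U s t v x - U s' t' v x\<bar> \<le> e"
proof -
  obtain B0 where B0: "\<And>v y. v \<in> W \<Longrightarrow> \<bar>v y\<bar> \<le> B0" using W unfolding equi_def by blast
  \<comment> \<open>For an empty W the given bound could be negative.\<close>
  define B where "B = max 0 B0"
  have B: "0 \<le> B" "\<And>v y. v \<in> W \<Longrightarrow> \<bar>v y\<bar> \<le> B"
    unfolding B_def using B0 by (simp, meson le_max_iff_disj)
  obtain c where c: "c > 0" "\<And>v r y. v \<in> W \<Longrightarrow> 0 \<le> r \<Longrightarrow> r < c \<Longrightarrow> \<bar>P r v y - v y\<bar> \<le> e / 2"
    using W e unfolding equi_def by (metis half_gt_zero)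
  \<comment> \<open>Chosen so that C (1 - exp(-x)) is at least 1 for x >= c, as in Markov's
    inequality.\<close>
  define C where "C = 1 / (1 - exp (- c))"
  have C: "C > 0" unfolding C_def using c by simp
  have pt: "\<bar>P r v x - P r' v x\<bar> \<le> e / 2 + 2 * B * C * (1 - exp (- \<bar>r - r'\<bar>))"
    if "v \<in> W" "0 \<le> r" "0 \<le> r'" for v r r' x
  proof -
    have v: "v \<in> C0 UNIV" using W that by (auto simp: equi_def)
    show ?thesis
    proof (cases "\<bar>r - r'\<bar> < c")
      case True
      have "\<bar>P r v x - P r' v x\<bar> \<le> e / 2"
        by (rule P_diff_time[OF that(2,3) v]) (use c(2)[OF that(1)] True in auto)
      moreover have "0 \<le> 2 * B * C * (1 - exp (- \<bar>r - r'\<bar>))" using B C by simp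
      ultimately show ?thesis by linarith
    next
      case False
      then have "exp (- \<bar>r - r'\<bar>) \<le> exp (- c)" by simp
      then have "1 \<le> C * (1 - exp (- \<bar>r - r'\<bar>))" unfolding C_def using c(1) by (simp add: field_simps)
      then have "2 * B * 1 \<le> 2 * B * (C * (1 - exp (- \<bar>r - r'\<bar>)))" using B by (intro mult_left_mono) auto
      moreover have "\<bar>P r v x\<bar> \<le> B" "\<bar>P r' v x\<bar> \<le> B"
        using P_bound[OF that(2) v B(2)[OF that(1)]] P_bound[OF that(3) v B(2)[OF that(1)]] by auto
      ultimately show ?thesis using e by (simp add: mult.assoc)
    qed
  qed
  \<comment> \<open>The two end points contribute 4 B C e', which is at most e/2; B + 1 avoids
    division by 0.\<close>
  define e' where "e' = e / (8 * (B + 1) * C)"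
  have e': "e' > 0" unfolding e'_def using B C e by simp
  obtain d where d: "d > 0" "\<And>a b. 0 \<le> a \<Longrightarrow> 0 \<le> b \<Longrightarrow> a \<le> T \<Longrightarrow> b \<le> T \<Longrightarrow> \<bar>b - a\<bar> < d \<Longrightarrow>
    (LINT \<omega>|M 0. 1 - exp (- \<bar>Z b \<omega> - Z a \<omega>\<bar>)) \<le> e'"
    by (rule increments_small[OF T e']) blast
  have "\<bar>U s t v x - U s' t' v x\<bar> \<le> e"
    if v: "v \<in> W" and st: "0 \<le> s" "s \<le> t" "t \<le> T" "0 \<le> s'" "s' \<le> t'" "t' \<le> T" "\<bar>s - s'\<bar> < d" "\<bar>t - t'\<bar> < d"
    for v s t s' t' x
  proof -
    have vC: "v \<in> C0 UNIV" using W v by (auto simp: equi_def)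
    note i = U_integrable[OF st(1,2) vC, of x] U_integrable[OF st(4,5) vC, of x]
    let ?h = "\<lambda>a b \<omega>. 1 - exp (- \<bar>Z b \<omega> - Z a \<omega>\<bar>)"
    have ih: "integrable (M 0) (?h a b)" if "0 \<le> a" "0 \<le> b" for a b
      by (rule tc.integrable_const_bound[where B=1])
        (use incr_measurable[OF that] in \<open>auto intro!: borel_measurable_diff borel_measurable_exp\<close>)
    have "\<bar>U s t v x - U s' t' v x\<bar> = \<bar>LINT \<omega>|M 0. P (Z t \<omega> - Z s \<omega>) v x - P (Z t' \<omega> - Z s' \<omega>) v x\<bar>"
      unfolding U_def using i by simp
    also have "\<dots> \<le> (LINT \<omega>|M 0. \<bar>P (Z t \<omega> - Z s \<omega>) v x - P (Z t' \<omega> - Z s' \<omega>) v x\<bar>)"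
      by (rule integral_abs_bound)
    also have "\<dots> \<le> (LINT \<omega>|M 0. e / 2 + 2 * B * C * (?h t t' \<omega> + ?h s s' \<omega>))"
    proof (rule integral_mono)
      show "integrable (M 0) (\<lambda>\<omega>. \<bar>P (Z t \<omega> - Z s \<omega>) v x - P (Z t' \<omega> - Z s' \<omega>) v x\<bar>)" using i by simp
      show "integrable (M 0) (\<lambda>\<omega>. e / 2 + 2 * B * C * (?h t t' \<omega> + ?h s s' \<omega>))"
        using ih[of t t'] ih[of s s'] st
        by (intro Bochner_Integration.integrable_add integrable_mult_right) auto
      fix \<omega> assume \<omega>: "\<omega> \<in> space (M 0)"
      have "1 - exp (- \<bar>(Z t \<omega> - Z s \<omega>) - (Z t' \<omega> - Z s' \<omega>)\<bar>) \<le> ?h t t' \<omega> + ?h s s' \<omega>"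
        by (rule one_minus_exp_subadditive) auto
      then have "2 * B * C * (1 - exp (- \<bar>(Z t \<omega> - Z s \<omega>) - (Z t' \<omega> - Z s' \<omega>)\<bar>)) \<le> 2 * B * C * (?h t t' \<omega> + ?h s s' \<omega>)"
        using B C by (intro mult_left_mono) auto
      with pt[OF v, of "Z t \<omega> - Z s \<omega>" "Z t' \<omega> - Z s' \<omega>" x] Z_mono[OF \<omega> st(1,2)] Z_mono[OF \<omega> st(4,5)]
      show "\<bar>P (Z t \<omega> - Z s \<omega>) v x - P (Z t' \<omega> - Z s' \<omega>) v x\<bar> \<le> e / 2 + 2 * B * C * (?h t t' \<omega> + ?h s s' \<omega>)"
        by linarith
    qed
    also have "\<dots> = e / 2 + 2 * B * C * ((LINT \<omega>|M 0. ?h t t' \<omega>) + (LINT \<omega>|M 0. ?h s s' \<omega>))"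
    proof -
      note h = ih[of t t'] ih[of s s']
      have 1: "integrable (M 0) (?h t t')" "integrable (M 0) (?h s s')" using h st by auto
      have "(LINT \<omega>|M 0. e / 2 + 2 * B * C * (?h t t' \<omega> + ?h s s' \<omega>)) =
          (LINT \<omega>|M 0. e / 2) + (LINT \<omega>|M 0. 2 * B * C * (?h t t' \<omega> + ?h s s' \<omega>))"
        by (intro Bochner_Integration.integral_add integrable_mult_right Bochner_Integration.integrable_add 1) auto
      also have "(LINT \<omega>|M 0. 2 * B * C * (?h t t' \<omega> + ?h s s' \<omega>)) = 2 * B * C * (LINT \<omega>|M 0. ?h t t' \<omega> + ?h s s' \<omega>)"
        by (rule integral_mult_right_zero)
      also have "(LINT \<omega>|M 0. ?h t t' \<omega> + ?h s s' \<omega>) = (LINT \<omega>|M 0. ?h t t' \<omega>) + (LINT \<omega>|M 0. ?h s s' \<omega>)"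
        by (rule Bochner_Integration.integral_add[OF 1])
      finally show ?thesis by (simp add: tc.prob_space)
    qed
    also have "\<dots> \<le> e / 2 + 2 * B * C * (e' + e')"
      using d(2)[of t t'] d(2)[of s s'] st B C
      by (intro add_left_mono mult_left_mono add_mono) (auto simp: abs_minus_commute)
    also have "\<dots> \<le> e"
    proof -
      have "8 * (B + 1) * C * e' = e" unfolding e'_def using B C by simp
      then have "e = 8 * (B * C * e') + 8 * (C * e')" by (simp add: algebra_simps)
      moreover have "0 \<le> C * e'" using C e' by simp
      moreover have "2 * B * C * (e' + e') = 4 * (B * C * e')" by (simp add: algebra_simps)
      ultimately show ?thesis by linarith
    qed
    finally show ?thesis .
  qed
  with d(1) show ?thesis by (rule that)
qed

section \<open>The semigroup axioms for (D,Y)\<close>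

abbreviation Q :: "real \<Rightarrow> (real \<times> 'b \<Rightarrow> real) \<Rightarrow> real \<times> 'b \<Rightarrow> real" where "Q \<equiv> DY_semigroup M X Z"

lemma Q_eq:
  assumes "0 \<le> s" "0 \<le> t" "f \<in> C0 time_space"
  shows "Q t f (s, x) = U s (s + t) (\<lambda>y. f (s + t, y)) x"
  using expectation_X_increment[of s "s + t" "\<lambda>y. f (s + t, y)" x] C0_time_slice[OF assms(3), of "s + t"] assms
  by (simp add: DY_semigroup_def zero_ext_def)

lemma Q_outside: "s < 0 \<Longrightarrow> Q t f (s, x) = 0"
  by (simp add: DY_semigroup_def zero_ext_def)

text \<open>Continuity in s splits into moving the time window under a fixed slice, where
  equicontinuity acts, and moving the slice under a fixed window, where contraction acts.\<close>

lemma Q_C0: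
  assumes t: "0 \<le> t" and f: "f \<in> C0 time_space"
  shows "Q t f \<in> C0 time_space"
proof (rule C0_timeI)
  note sl = C0_time_slice[OF f]
  show "Q t f (s, x) = 0" if "s < 0" for s x by (rule Q_outside[OF that])
  show "(\<lambda>y. Q t f (s, y)) \<in> C0 UNIV" if "0 \<le> s" for s
    using U_C0[of s "s + t", OF _ _ sl] that t by (simp add: Q_eq[OF that t f])
  show "\<exists>d>0. \<forall>s'\<ge>0. \<bar>s' - s\<bar> < d \<longrightarrow> (\<forall>x. \<bar>Q t f (s', x) - Q t f (s, x)\<bar> \<le> e)"
    if s: "0 \<le> s" and e: "0 < e" for s e
  proof -
    obtain d1 where d1: "d1 > 0" "\<And>v a b a' b' x. v \<in> (\<lambda>s y. f (s, y)) ` {0..} \<Longrightarrow> 0 \<le> a \<Longrightarrow> a \<le> b \<Longrightarrow> b \<le> s + t + 1 \<Longrightarrow> 0 \<le> a' \<Longrightarrow> a' \<le> b' \<Longrightarrow> b' \<le> s + t + 1 \<Longrightarrow>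
      \<bar>a - a'\<bar> < d1 \<Longrightarrow> \<bar>b - b'\<bar> < d1 \<Longrightarrow> \<bar>U a b v x - U a' b' v x\<bar> \<le> e / 2"
      by (rule U_equicontinuous[OF equi_slices[OF f], of "s + t + 1" "e / 2"]) (use s t e in auto)
    obtain d2 where d2: "d2 > 0" "\<And>a b x. 0 \<le> a \<Longrightarrow> 0 \<le> b \<Longrightarrow> \<bar>a - b\<bar> < d2 \<Longrightarrow> \<bar>f (a, x) - f (b, x)\<bar> \<le> e / 2"
      by (rule C0_time_uniform[OF f, of "e / 2"]) (use e in auto)
    have "\<bar>Q t f (s', x) - Q t f (s, x)\<bar> \<le> e" if s': "0 \<le> s'" "\<bar>s' - s\<bar> < min 1 (min d1 d2)" for s' x
    proof -
      have "\<bar>U s' (s' + t) (\<lambda>y. f (s' + t, y)) x - U s (s + t) (\<lambda>y. f (s' + t, y)) x\<bar> \<le> e / 2"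
        by (rule d1(2)) (use s t s' in auto)
      moreover have "\<bar>U s (s + t) (\<lambda>y. f (s' + t, y) - f (s + t, y)) x\<bar> \<le> e / 2"
        by (rule U_bound) (use s t s' d2 sl in \<open>auto intro!: C0_diff\<close>)
      moreover have "Q t f (s', x) = U s' (s' + t) (\<lambda>y. f (s' + t, y)) x"
        "Q t f (s, x) = U s (s + t) (\<lambda>y. f (s + t, y)) x"
        "U s (s + t) (\<lambda>y. f (s' + t, y) - f (s + t, y)) x =
          U s (s + t) (\<lambda>y. f (s' + t, y)) x - U s (s + t) (\<lambda>y. f (s + t, y)) x"
        using s t s' by (auto simp: Q_eq f intro!: U_diff sl)
      ultimately show ?thesis by linarith
    qed
    then show ?thesis using d1(1) d2(1) by (intro exI[of _ "min 1 (min d1 d2)"]) auto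
  qed
  show "\<exists>N. \<forall>s\<ge>N. \<forall>x. \<bar>Q t f (s, x)\<bar> \<le> e" if e: "0 < e" for e
  proof -
    obtain n where n: "n \<ge> 0" "\<And>s x. s \<ge> n \<Longrightarrow> \<bar>f (s, x)\<bar> \<le> e" by (rule C0_time_tail[OF f e]) blast
    have "\<bar>Q t f (s, x)\<bar> \<le> e" if "n \<le> s" for s x
      unfolding Q_eq[OF order_trans[OF n(1) that] t f] by (rule U_bound) (use n that t sl in auto)
    then show ?thesis by blast
  qed
qed

text \<open>\<open>U_equicontinuous\<close> covers bounded time horizons only; starting times beyond
  n are handled by the uniform smallness of late slices.\<close>

lemma Q_strong:
  assumes f: "f \<in> C0 time_space" and e: "0 < e"
  shows "\<exists>d>0. \<forall>t. 0 < t \<longrightarrow> t < d \<longrightarrow> (\<forall>z\<in>time_space. \<bar>Q t f z - f z\<bar> \<le> e)"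
proof -
  note sl = C0_time_slice[OF f]
  obtain n where n: "n \<ge> 0" "\<And>s x. s \<ge> n \<Longrightarrow> \<bar>f (s, x)\<bar> \<le> e / 2"
    by (rule C0_time_tail[OF f, of "e / 2"]) (use e in auto)
  obtain d1 where d1: "d1 > 0" "\<And>v a b a' b' x. v \<in> (\<lambda>s y. f (s, y)) ` {0..} \<Longrightarrow> 0 \<le> a \<Longrightarrow> a \<le> b \<Longrightarrow> b \<le> n + 1 \<Longrightarrow> 0 \<le> a' \<Longrightarrow> a' \<le> b' \<Longrightarrow> b' \<le> n + 1 \<Longrightarrow>
      \<bar>a - a'\<bar> < d1 \<Longrightarrow> \<bar>b - b'\<bar> < d1 \<Longrightarrow> \<bar>U a b v x - U a' b' v x\<bar> \<le> e / 2"
    by (rule U_equicontinuous[OF equi_slices[OF f], of "n + 1" "e / 2"]) (use n e in auto)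
  obtain d2 where d2: "d2 > 0" "\<And>a b x. 0 \<le> a \<Longrightarrow> 0 \<le> b \<Longrightarrow> \<bar>a - b\<bar> < d2 \<Longrightarrow> \<bar>f (a, x) - f (b, x)\<bar> \<le> e / 2"
    by (rule C0_time_uniform[OF f, of "e / 2"]) (use e in auto)
  have "\<bar>Q t f (s, x) - f (s, x)\<bar> \<le> e" if t: "0 < t" "t < min 1 (min d1 d2)" and s: "0 \<le> s" for t s x
  proof (cases "n \<le> s")
    case True
    have "\<bar>Q t f (s, x)\<bar> \<le> e / 2"
      unfolding Q_eq[OF s less_imp_le[OF t(1)] f] by (rule U_bound) (use n True t sl s in auto)
    with n(2)[OF True, of x] show ?thesis by linarith
  next
    case False
    have "\<bar>U s (s + t) (\<lambda>y. f (s + t, y)) x - U s s (\<lambda>y. f (s + t, y)) x\<bar> \<le> e / 2"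
      by (rule d1(2)) (use s t False d1 in auto)
    moreover have "\<bar>f (s + t, x) - f (s, x)\<bar> \<le> e / 2" by (rule d2(2)) (use s t in auto)
    moreover have "Q t f (s, x) = U s (s + t) (\<lambda>y. f (s + t, y)) x"
      "U s s (\<lambda>y. f (s + t, y)) x = f (s + t, x)"
      using s t by (auto simp: Q_eq f U_refl sl)
    ultimately show ?thesis by linarith
  qed
  then show ?thesis using d1(1) d2(1) by (intro exI[of _ "min 1 (min d1 d2)"]) auto
qed

lemma feller_semigroup_Q: "feller_semigroup time_space Q"
  unfolding feller_semigroup_def
proof (intro conjI allI ballI impI)
  note sl = C0_time_slice
  have ne: "time_space \<noteq> ({} :: (real \<times> 'b) set)" by auto
  show "Q t f \<in> C0 time_space" if "0 \<le> t" "f \<in> C0 time_space" for t f by (rule Q_C0[OF that])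
  show "Q t (\<lambda>z. a * f z + b * h z) = (\<lambda>z. a * Q t f z + b * Q t h z)"
    if "0 \<le> t" and f: "f \<in> C0 time_space" and h: "h \<in> C0 time_space" for t f h a b
  proof
    fix z :: "real \<times> 'b"
    obtain s x where z: "z = (s, x)" by (cases z)
    show "Q t (\<lambda>z. a * f z + b * h z) z = a * Q t f z + b * Q t h z"
      using that unfolding z
      by (cases "0 \<le> s")
        (simp_all add: Q_eq Q_outside C0_lincomb[OF closed_time_space f h] U_lincomb sl[OF f] sl[OF h])
  qed
  show "supnorm time_space (Q t f) \<le> supnorm time_space f" if "0 \<le> t" and f: "f \<in> C0 time_space" for t f
  proof (rule supnorm_le[OF ne])
    fix z :: "real \<times> 'b" assume "z \<in> time_space"
    then obtain s x where z: "z = (s, x)" "0 \<le> s" by (cases z) auto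
    show "\<bar>Q t f z\<bar> \<le> supnorm time_space f"
      unfolding z Q_eq[OF z(2) that]
      by (rule U_bound) (use z that sl[OF f] C0_abs_le_supnorm[OF f] in auto)
  qed
  show "0 \<le> Q t f z" if "0 \<le> t" and f: "f \<in> C0 time_space" and "\<forall>z\<in>time_space. 0 \<le> f z" and "z \<in> time_space" for t f z
  proof -
    obtain s x where z: "z = (s, x)" "0 \<le> s" using \<open>z \<in> time_space\<close> by (cases z) auto
    show ?thesis unfolding z Q_eq[OF z(2) that(1) f]
      by (rule U_nonneg) (use z that sl[OF f] in auto)
  qed
  show "Q 0 f = f" if f: "f \<in> C0 time_space" for f
  proof
    fix z :: "real \<times> 'b"
    obtain s x where z: "z = (s, x)" by (cases z)
    show "Q 0 f z = f z"
      unfolding z by (cases "0 \<le> s") (auto simp: Q_eq f U_refl sl[OF f] Q_outside C0_zero[OF f])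
  qed
  show "Q (s + t) f = Q s (Q t f)" if "0 \<le> s" "0 \<le> t" and f: "f \<in> C0 time_space" for s t f
  proof
    fix z :: "real \<times> 'b"
    obtain a x where z: "z = (a, x)" by (cases z)
    show "Q (s + t) f z = Q s (Q t f) z"
    proof (cases "0 \<le> a")
      case True
      have "Q s (Q t f) z = U a (a + s) (\<lambda>y. Q t f (a + s, y)) x"
        unfolding z using True that by (intro Q_eq Q_C0)
      also have "(\<lambda>y. Q t f (a + s, y)) = U (a + s) (a + s + t) (\<lambda>y. f (a + s + t, y))"
        using True that by (intro ext Q_eq) auto
      also have "U a (a + s) \<dots> x = U a (a + s + t) (\<lambda>y. f (a + s + t, y)) x"
        by (rule U_chain) (use True that sl[OF f] in auto)
      also have "\<dots> = Q (s + t) f z"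
        unfolding z using True that by (simp add: Q_eq add.assoc)
      finally show ?thesis ..
    qed (auto simp: z Q_outside)
  qed
  show "((\<lambda>t. supnorm time_space (\<lambda>z. Q t f z - f z)) \<longlongrightarrow> 0) (at_right 0)" if f: "f \<in> C0 time_space" for f
    by (rule supnorm_tendsto_0I[where F="\<lambda>t z. Q t f z - f z", OF ne])
      (use f in \<open>auto intro!: C0_diff closed_time_space Q_C0 Q_strong[simplified]\<close>)
qed

sublocale Q: feller time_space Q
  using feller_semigroup_Q closed_time_space by unfold_locales auto

section \<open>The Markov property of (D,Y) as a conditional expectation\<close>

lemma markov_process_DY:
  assumes s: "0 \<le> s"
  shows "markov_process (M x) time_space (DY X Z s) Q"
  unfolding markov_process_def
proof (intro conjI allI impI ballI)
  show "prob_space (M x)" by (rule tc.prob_space_axioms)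
  show meas: "DY X Z s t \<in> borel_measurable (M x)" if "0 \<le> t" for t by (rule tc.DY_measurable[OF s that])
  show "DY X Z s t \<omega> \<in> time_space" if "0 \<le> t" for t \<omega> using s that by (simp add: DY_def)
  fix t h f assume t: "(0::real) \<le> t" and h: "(0::real) \<le> h" and f: "f \<in> C0 (time_space :: (real \<times> 'b) set)"
  let ?F = "natural_filtration (M x) (DY X Z s) t"
  have sub: "subalgebra (M x) ?F" by (intro subalgebra_generated_by meas) auto
  interpret F: finite_measure_subalgebra "M x" ?F by unfold_locales (rule sub)
  obtain B where B: "\<And>z. \<bar>f z\<bar> \<le> B" by (rule C0_boundE[OF f]) blast
  have QC: "Q h f \<in> C0 time_space" by (rule Q_C0[OF h f])
  have QB: "\<bar>Q h f z\<bar> \<le> B" for z by (rule Q.P_bound[OF h f B])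
  have fm: "(\<lambda>\<omega>. f (DY X Z s (t + h) \<omega>)) \<in> borel_measurable (M x)"
    using measurable_compose[OF meas[of "t + h"] C0_borel_measurable[OF closed_time_space f]] t h by simp
  have Qm: "(\<lambda>\<omega>. Q h f (DY X Z s t \<omega>)) \<in> borel_measurable ?F"
    by (rule measurable_compose[OF measurable_generated_by C0_borel_measurable[OF closed_time_space QC]])
      (use t in auto)
  show "AE \<omega> in M x. real_cond_exp (M x) ?F (\<lambda>\<omega>. f (DY X Z s (t + h) \<omega>)) \<omega> = Q h f (DY X Z s t \<omega>)"
  proof (rule F.real_cond_exp_charact)
    show "integrable (M x) (\<lambda>\<omega>. f (DY X Z s (t + h) \<omega>))"
      by (rule tc.integrable_const_bound[where B=B]) (use fm B in auto)
    show "integrable (M x) (\<lambda>\<omega>. Q h f (DY X Z s t \<omega>))"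
      by (rule tc.integrable_const_bound[where B=B])
        (use measurable_larger[OF Qm] sub QB in \<open>auto simp: subalgebra_def\<close>)
    show "(\<lambda>\<omega>. Q h f (DY X Z s t \<omega>)) \<in> borel_measurable ?F" by (rule Qm)
    fix A assume A: "A \<in> sets ?F"
    let ?v = "\<lambda>y. f (s + t + h, y)"
    have v: "?v \<in> C0 UNIV" by (rule C0_time_slice[OF f]) (use s t h in auto)
    have "(LINT \<omega>:A|M x. f (DY X Z s (t + h) \<omega>)) = (LINT \<omega>:A|M x. ?v (X (Z (s + t + h) \<omega>) \<omega>))"
      by (simp add: DY_def add.assoc)
    also have "\<dots> = (LINT \<omega>:A|M x. LINT \<omega>'|M x. P (Z (s + t + h) \<omega>' - Z (s + t) \<omega>') ?v (X (Z (s + t) \<omega>) \<omega>))"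
      by (rule tc.DY_markov_integral[OF s t h A v])
    \<comment> \<open>\<open>U_eq\<close> reads U, which is defined under the reference law, under
      the law \<open>M x\<close> at hand.\<close>
    also have "\<dots> = (LINT \<omega>:A|M x. Q h f (DY X Z s t \<omega>))"
      using s t h by (simp add: DY_def Q_eq f U_eq[OF _ _ v, of "s + t" "s + t + h" _ x])
    finally show "(LINT \<omega>:A|M x. f (DY X Z s (t + h) \<omega>)) = (LINT \<omega>:A|M x. Q h f (DY X Z s t \<omega>))" .
  qed
qed

lemma feller_process_DY: "0 \<le> s \<Longrightarrow> feller_process (M x) time_space (DY X Z s) Q"
  using markov_process_DY feller_semigroup_Q by (simp add: feller_process_def)

section \<open>Time averages and density of the domain\<close>

lemma Q_time_integral_commute:
  assumes f: "f \<in> C0 time_space" and h: "0 \<le> h" and t: "0 \<le> t" and F: "(\<lambda>z. LINT u:{0..t}|lborel. Q u f z) \<in> C0 time_space"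
    and z: "z \<in> time_space"
  shows "Q h (\<lambda>z. LINT u:{0..t}|lborel. Q u f z) z = (LINT u:{0..t}|lborel. Q (h + u) f z)"
proof -
  obtain s x where sx: "z = (s, x)" "0 \<le> s" using z by (cases z) auto
  obtain B where B: "\<And>z. \<bar>f z\<bar> \<le> B" by (rule C0_boundE[OF f]) blast
  have B0: "0 \<le> B" using B[of undefined] by linarith
  interpret pair_sigma_finite lborel "M x"
    by (intro pair_sigma_finite.intro sigma_finite_lborel tc.sigma_finite_measure_axioms)
  let ?Y = "\<lambda>\<omega>. (s + h, X (Z (s + h) \<omega> - Z s \<omega>) \<omega>)"
  have Ym: "?Y \<in> borel_measurable (M x)"
    by (intro borel_measurable_Pair borel_measurable_const tc.X_random_time_measurable incr_measurable)
      (use sx h Z_mono in auto)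
  \<comment> \<open>At a fixed point of the time space \<open>Q h\<close> is the expectation over
    one random point, whatever the integrand; this makes Fubini applicable.\<close>
  have Q_Y: "Q h k z = (LINT \<omega>|M x. k (?Y \<omega>))" for k :: "real \<times> 'b \<Rightarrow> real"
    using sx by (simp add: DY_semigroup_def zero_ext_def)
  have "Q h (\<lambda>z. LINT u:{0..t}|lborel. Q u f z) z =
      (LINT \<omega>|M x. LINT u|lborel. indicat_real {0..t} u * Q u f (?Y \<omega>))"
    unfolding Q_Y set_lebesgue_integral_def by simp
  also have "\<dots> = (LINT u|lborel. LINT \<omega>|M x. indicat_real {0..t} u * Q u f (?Y \<omega>))"
  proof (rule Fubini_integral)
    have eq: "(\<lambda>(u, \<omega>). indicat_real {0..t} u * Q u f (?Y \<omega>)) =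
        (\<lambda>z. indicat_real {0..t} (fst z) * Q (max 0 (fst z)) f (?Y (snd z)))"
      by (auto simp: fun_eq_iff indicator_def)
    show "integrable (lborel \<Otimes>\<^sub>M M x) (\<lambda>(u, \<omega>). indicat_real {0..t} u * Q u f (?Y \<omega>))"
    proof (rule Bochner_Integration.integrable_bound)
      show "integrable (lborel \<Otimes>\<^sub>M M x) (\<lambda>z. indicat_real ({0..t} \<times> space (M x)) z * B)"
        using B0 by (intro integrable_mult_left integrable_real_indicator)
          (auto simp: tc.emeasure_pair_measure_Times tc.emeasure_space_1 emeasure_lborel_Icc[OF t])
      show "(\<lambda>(u, \<omega>). indicat_real {0..t} u * Q u f (?Y \<omega>)) \<in> borel_measurable (lborel \<Otimes>\<^sub>M M x)"
        unfolding eq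
        by (intro borel_measurable_times Q.P_measurable[OF f] measurable_compose[OF measurable_snd Ym]
            measurable_compose[OF measurable_fst borel_measurable_indicator]
            measurable_compose[OF measurable_fst]) auto
      show "AE z in lborel \<Otimes>\<^sub>M M x. norm (case z of (u, \<omega>) \<Rightarrow> indicat_real {0..t} u * Q u f (?Y \<omega>))
          \<le> norm (indicat_real ({0..t} \<times> space (M x)) z * B)"
        using Q.P_bound[OF _ f B] B0 by (intro AE_I2) (auto simp: indicator_def space_pair_measure)
    qed
  qed
  also have "\<dots> = (LINT u:{0..t}|lborel. Q (h + u) f z)"
    unfolding set_lebesgue_integral_def
  proof (rule Bochner_Integration.integral_cong[OF refl])
    fix u
    show "(LINT \<omega>|M x. indicat_real {0..t} u * Q u f (?Y \<omega>)) = indicat_real {0..t} u *\<^sub>R Q (h + u) f z"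
      using Q_Y[of "Q u f"] Q.P_add[OF h _ f, of u] by (auto simp: indicator_def)
  qed
  finally show ?thesis .
qed

text \<open>Applying Q_h to the integral G of Q_u f over [0,t] shifts the window to [h, h + t]. The
  difference to G is the integral of Q_u (Q_t f - f) over [0,h], so
  \<open>generator_graphI_integral\<close> applies to G/t, which is close to f for small t.\<close>

lemma Q_generator_dense: "dense_in_C0 time_space (generator_dom time_space Q)"
  unfolding dense_in_C0_def
proof (intro conjI subsetI ballI allI impI)
  show "f \<in> C0 time_space" if "f \<in> generator_dom time_space Q" for f
    using that by (auto simp: generator_dom_def generator_graph_def)
  fix f :: "real \<times> 'b \<Rightarrow> real" and e :: real assume f: "f \<in> C0 time_space" and e: "0 < e"
  obtain B where B: "\<And>z. \<bar>f z\<bar> \<le> B" by (rule C0_boundE[OF f]) blast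
  obtain d where d: "d > 0" "\<And>t z. 0 \<le> t \<Longrightarrow> t < d \<Longrightarrow> \<bar>Q t f z - f z\<bar> \<le> e / 2"
    by (rule Q.P_strong[OF f, of "e / 2"]) (use e in auto)
  define t where "t = d / 2"
  have t: "0 < t" "t < d" using d by (auto simp: t_def)
  define G where "G z = (LINT u:{0..t}|lborel. Q u f z)" for z
  have GC: "G \<in> C0 time_space"
  proof -
    \<comment> \<open>Restriction to [0,t] supplies the finite measure for
      \<open>C0_integral\<close>.\<close>
    have "(\<lambda>z. LINT u|restrict_space lborel {0..t}. Q u f z) \<in> C0 time_space"
    proof (rule C0_integral[where B=B, OF closed_time_space])
      show "finite_measure (restrict_space lborel {0..t})"
        by (rule finite_measureI) (use t in \<open>auto simp: emeasure_restrict_space space_restrict_space\<close>)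
      show "Q u f \<in> C0 time_space" if "u \<in> space (restrict_space lborel {0..t})" for u
        using that f by (intro Q_C0) (auto simp: space_restrict_space)
      show "\<bar>Q u f z\<bar> \<le> B" if "u \<in> space (restrict_space lborel {0..t})" for u z
        using that by (intro Q.P_bound[OF _ f B]) (auto simp: space_restrict_space)
      show "(\<lambda>u. Q u f z) \<in> borel_measurable (restrict_space lborel {0..t})" for z
        using Q.P_set_integrable[OF f, of 0 t z]
        by (subst borel_measurable_restrict_space_iff) (auto simp: set_integrable_def dest: borel_measurable_integrable)
    qed
    moreover have "(LINT u|restrict_space lborel {0..t}. Q u f z) = G z" for z
      unfolding G_def by (subst integral_restrict_space) (auto simp: set_lebesgue_integral_def)
    ultimately show ?thesis by simp
  qed
  let ?h = "\<lambda>z. Q t f z - f z"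
  have hC: "?h \<in> C0 time_space" using t by (intro C0_diff closed_time_space Q_C0 f) auto
  have key: "Q h G z - G z = (LINT u:{0..h}|lborel. Q u ?h z)" if h: "0 < h" and z: "z \<in> time_space" for h z
  proof -
    let ?q = "\<lambda>u. Q u f z"
    have I: "set_integrable lborel {a..b} ?q" if "0 \<le> a" for a b using Q.P_set_integrable[OF f that] .
    \<comment> \<open>Both windows are completed to [0, h + t], so it does not matter whether they
      overlap.\<close>
    have split: "(LINT u:{0..h + t}|lborel. ?q u) = (LINT u:{0..a}|lborel. ?q u) + (LINT u:{a..h + t}|lborel. ?q u)"
      if "0 \<le> a" "a \<le> h + t" for a
      by (rule set_integral_Icc_combine[OF I[OF order_refl] that, symmetric])
    have "Q h G z = (LINT u:{0..t}|lborel. Q (h + u) f z)"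
      unfolding G_def by (rule Q_time_integral_commute) (use f h t GC z in \<open>auto simp: G_def[abs_def]\<close>)
    also have "\<dots> = (LINT u:{h..h + t}|lborel. ?q u)"
      using set_integral_Icc_shift[where a=0 and b=t and h=h and p="?q"] by simp
    finally have "Q h G z - G z = (LINT u:{t..h + t}|lborel. ?q u) - (LINT u:{0..h}|lborel. ?q u)"
      using split[of h] split[of t] h t unfolding G_def by simp
    also have "(LINT u:{t..h + t}|lborel. ?q u) = (LINT u:{0..h}|lborel. Q (t + u) f z)"
      using set_integral_Icc_shift[where a=0 and b=h and h=t and p="?q"] by (simp add: add.commute)
    also have "\<dots> = (LINT u:{0..h}|lborel. Q u (Q t f) z)"
      unfolding set_lebesgue_integral_def
      by (intro Bochner_Integration.integral_cong refl)
        (use t Q.P_add[OF _ _ f, of _ t] in \<open>auto simp: indicator_def add.commute\<close>)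
    also have "\<dots> - (LINT u:{0..h}|lborel. ?q u) = (LINT u:{0..h}|lborel. Q u (Q t f) z - Q u f z)"
      using t by (intro set_integral_diff(2)[symmetric] Q.P_set_integrable Q_C0 f) auto
    also have "\<dots> = (LINT u:{0..h}|lborel. Q u ?h z)"
      unfolding set_lebesgue_integral_def
      by (intro Bochner_Integration.integral_cong refl)
        (use t Q.P_diff[OF _ Q_C0[OF _ f] f] in \<open>auto simp: indicator_def\<close>)
    finally show ?thesis .
  qed
  have "generator_graph time_space Q (\<lambda>z. (1 / t) * G z) (\<lambda>z. (1 / t) * ?h z)"
  proof (rule Q.generator_graphI_integral)
    show "(\<lambda>z. 1 / t * G z) \<in> C0 time_space" "(\<lambda>z. 1 / t * ?h z) \<in> C0 time_space"
      using C0_lincomb[OF closed_time_space GC GC, of "1/t" 0] C0_lincomb[OF closed_time_space hC hC, of "1/t" 0] by simp_all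
    show "Q h (\<lambda>z. 1 / t * G z) z - 1 / t * G z = (LINT u:{0..h}|lborel. Q u (\<lambda>z. 1 / t * ?h z) z)"
      if "0 < h" "z \<in> time_space" for h z
    proof -
      have sc: "Q u (\<lambda>z. 1 / t * k z) z = 1 / t * Q u k z" if "0 \<le> u" "k \<in> C0 time_space" for u k
        using Q.P_lincomb[OF that that(2), of "1 / t" 0] by simp
      have "(LINT u:{0..h}|lborel. Q u (\<lambda>z. 1 / t * ?h z) z) = (LINT u:{0..h}|lborel. 1 / t * Q u ?h z)"
        unfolding set_lebesgue_integral_def
        by (intro Bochner_Integration.integral_cong refl) (use sc[OF _ hC] in \<open>auto simp: indicator_def\<close>)
      also have "\<dots> = 1 / t * (Q h G z - G z)" unfolding key[OF that] by (rule set_integral_mult_right)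
      finally show ?thesis using sc[OF _ GC, of h] that by (simp add: right_diff_distrib)
    qed
  qed
  then have "(\<lambda>z. (1 / t) * G z) \<in> generator_dom time_space Q"
    unfolding generator_dom_def by blast
  moreover have "supnorm time_space (\<lambda>z. f z - (1 / t) * G z) < e"
  proof -
    have "\<bar>f z - (1 / t) * G z\<bar> \<le> e / 2" for z
    proof -
      have i1: "set_integrable lborel {0..t} (\<lambda>u. Q u f z)" by (rule Q.P_set_integrable[OF f]) simp
      have i2: "set_integrable lborel {0..t} (\<lambda>u. f z)" by (rule set_integrable_continuous_Icc) simp
      have "\<bar>LINT u:{0..t}|lborel. Q u f z - f z\<bar> \<le> e / 2 * (t - 0)"
        by (rule set_integral_abs_le[OF set_integral_diff(1)[OF i1 i2]]) (use d(2) t in auto)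
      moreover have "(LINT u:{0..t}|lborel. Q u f z - f z) = G z - t * f z"
        unfolding set_integral_diff(2)[OF i1 i2] G_def using t by (simp add: set_lebesgue_integral_def)
      moreover have "f z - (1 / t) * G z = - (G z - t * f z) / t" using t by (simp add: field_simps)
      ultimately show ?thesis using t
        by (simp add: pos_divide_le_eq abs_minus_commute[of "t * f z" "G z"])
    qed
    then have "supnorm time_space (\<lambda>z. f z - (1 / t) * G z) \<le> e / 2" by (intro supnorm_le) auto
    then show ?thesis using e by simp
  qed
  ultimately show "\<exists>h\<in>generator_dom time_space Q. supnorm time_space (\<lambda>z. f z - h z) < e"
    by (intro bexI[where x="\<lambda>z. 1 / t * G z"])
qed

end

section \<open>Indefinite integrals and exponential sums\<close>

text \<open>Replaces the vanishing-derivative criterion where D may fail to be differentiable: near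
  every point its increments are small compared with those of a comparison function k. Bisection
  makes the bound global, and e is arbitrary.\<close>

lemma eq_if_increments_small:
  fixes D k :: "real \<Rightarrow> real"
  assumes ab: "a \<le> b"
    and loc: "\<And>x e. a \<le> x \<Longrightarrow> x \<le> b \<Longrightarrow> 0 < e \<Longrightarrow>
      \<exists>d>0. \<forall>c c'. a \<le> c \<longrightarrow> c \<le> x \<longrightarrow> x \<le> c' \<longrightarrow> c' \<le> b \<longrightarrow> c' - c < d \<longrightarrow> \<bar>D c' - D c\<bar> \<le> e * (k c' - k c)"
  shows "D b = D a"
proof -
  have *: "\<bar>D b - D a\<bar> \<le> e * (k b - k a)" if e: "0 < e" for e
  proof -
    have "a \<le> a \<and> b \<le> b \<longrightarrow> \<bar>D b - D a\<bar> \<le> e * (k b - k a)"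
      using ab
    proof (induction rule: Bolzano[where P="\<lambda>c c'. a \<le> c \<and> c' \<le> b \<longrightarrow> \<bar>D c' - D c\<bar> \<le> e * (k c' - k c)"])
      case (trans x y z)
      show ?case
      proof
        assume "a \<le> x \<and> z \<le> b"
        with trans have "\<bar>D y - D x\<bar> \<le> e * (k y - k x)" "\<bar>D z - D y\<bar> \<le> e * (k z - k y)" by auto
        then have "\<bar>D z - D x\<bar> \<le> e * (k y - k x) + e * (k z - k y)" by linarith
        then show "\<bar>D z - D x\<bar> \<le> e * (k z - k x)" by (simp add: algebra_simps)
      qed
    next
      case (local x)
      then show ?case using loc[OF _ _ e, of x] by blast
    qed
    then show ?thesis by simp
  qed
  have "\<bar>D b - D a\<bar> \<le> 0"
  \<comment> \<open>Monotonicity of k is not assumed; a nonpositive total increment already forces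
    equality.\<close>
  proof (cases "k b - k a \<le> 0")
    case True
    then show ?thesis using *[of 1] by simp
  next
    case False
    have "\<bar>D b - D a\<bar> \<le> 0 + e" if "0 < e" for e
      using *[of "e / (k b - k a)"] that False by simp
    then show ?thesis by (rule field_le_epsilon)
  qed
  then show ?thesis by simp
qed

lemma set_integrable_mult_continuous:
  fixes k h :: "real \<Rightarrow> real"
  assumes k: "set_integrable lborel {a..b} k" and h: "continuous_on {a..b} h"
  shows "set_integrable lborel {a..b} (\<lambda>u. k u * h u)"
proof -
  have "bounded (h ` {a..b})" using h by (intro compact_imp_bounded compact_continuous_image) auto
  then obtain C where "\<forall>y\<in>h ` {a..b}. norm y \<le> C" unfolding bounded_iff ..
  then have C: "\<And>u. u \<in> {a..b} \<Longrightarrow> \<bar>h u\<bar> \<le> C" by auto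
  have hm: "(\<lambda>u. indicat_real {a..b} u *\<^sub>R h u) \<in> borel_measurable borel"
    by (rule borel_measurable_continuous_on_indicator) (use h in auto)
  have km: "integrable lborel (\<lambda>u. indicat_real {a..b} u *\<^sub>R k u)"
    using k by (simp add: set_integrable_def)
  show ?thesis unfolding set_integrable_def
  proof (rule Bochner_Integration.integrable_bound)
    show "integrable lborel (\<lambda>u. C * (indicat_real {a..b} u *\<^sub>R k u))"
      by (rule integrable_mult_right[OF km])
    have "(\<lambda>u. (indicat_real {a..b} u *\<^sub>R k u) * (indicat_real {a..b} u *\<^sub>R h u)) \<in> borel_measurable lborel"
      using hm km by (intro borel_measurable_times) auto
    also have "(\<lambda>u. (indicat_real {a..b} u *\<^sub>R k u) * (indicat_real {a..b} u *\<^sub>R h u)) =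
        (\<lambda>u. indicat_real {a..b} u *\<^sub>R (k u * h u))" by (auto simp: indicator_def)
    finally show "(\<lambda>u. indicat_real {a..b} u *\<^sub>R (k u * h u)) \<in> borel_measurable lborel" .
    have "\<bar>k u * h u\<bar> \<le> \<bar>C * k u\<bar>" if "u \<in> {a..b}" for u
    proof -
      have "\<bar>k u\<bar> * \<bar>h u\<bar> \<le> \<bar>k u\<bar> * \<bar>C\<bar>" using C[OF that] by (intro mult_left_mono) auto
      then show ?thesis by (simp add: abs_mult mult.commute)
    qed
    then show "AE u in lborel. norm (indicat_real {a..b} u *\<^sub>R (k u * h u)) \<le> norm (C * (indicat_real {a..b} u *\<^sub>R k u))"
      by (intro AE_I2) (auto simp: indicator_def)
  qed
qed

text \<open>The factor is bounded by the values of exp at the two end points, which are the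
  quantities under control when y and z are values of an indefinite integral.\<close>

lemma exp_increment:
  fixes y z :: real
  obtains w where "exp z - exp y = w * (z - y)"
    "min (exp y) (exp z) \<le> w" "w \<le> max (exp y) (exp z)"
proof -
  have *: "\<exists>w. exp z - exp y = w * (z - y) \<and> exp y \<le> w \<and> w \<le> exp z" if "y < z" for y z :: real
  proof -
    have "\<exists>x>y. x < z \<and> exp z - exp y = (z - y) * exp x"
      by (rule MVT2[OF that]) (auto intro!: derivative_eq_intros)
    then obtain x where "x > y" "x < z" "exp z - exp y = (z - y) * exp x" by blast
    then show ?thesis by (intro exI[of _ "exp x"]) auto
  qed
  consider "y < z" | "z < y" | "y = z" by linarith
  then show ?thesis
  proof cases
    case 1
    then show ?thesis using *[OF 1] that by fastforce
  next
    case 2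
    from *[OF 2] obtain w where w: "exp y - exp z = w * (y - z)" "exp z \<le> w" "w \<le> exp y" by blast
    then have "exp z - exp y = w * (z - y)" by (simp add: algebra_simps)
    with w show ?thesis by (intro that[of w]) auto
  next
    case 3
    then show ?thesis by (intro that[of "exp y"]) auto
  qed
qed

text \<open>The chain rule for the indefinite integral of a merely integrable k, which may lack a
  derivative at some points. Near x both the factor from \<open>exp_increment\<close> and exp(K u)
  are close to exp(K x), so increments of \<open>D\<close> are at most e times those of the integral
  of |k|.\<close>

lemma exp_indefinite_integral:
  fixes k :: "real \<Rightarrow> real"
  assumes k: "set_integrable lborel {0..b} k" and ab: "0 \<le> a" "a \<le> b"
  defines "K \<equiv> \<lambda>t. LINT u:{0..t}|lborel. k u"
  shows "exp (K b) - exp (K a) = (LINT u:{a..b}|lborel. k u * exp (K u))"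
    and "set_integrable lborel {a..b} (\<lambda>u. k u * exp (K u))"
proof -
  have Kc: "continuous_on {0..b} (\<lambda>u. exp (K u))"
    unfolding K_def by (intro continuous_intros set_integral_Icc_continuous[OF k])
  have I: "set_integrable lborel {0..b} (\<lambda>u. k u * exp (K u))"
    by (rule set_integrable_mult_continuous[OF k Kc])
  then show "set_integrable lborel {a..b} (\<lambda>u. k u * exp (K u))"
    by (rule set_integrable_subset) (use ab in auto)
  define D where "D c = exp (K c) - (LINT u:{0..c}|lborel. k u * exp (K u))" for c
  define \<kappa> where "\<kappa> c = (LINT u:{0..c}|lborel. \<bar>k u\<bar>)" for c
  have diff: "(LINT u:{0..c'}|lborel. f u) - (LINT u:{0..c}|lborel. f u) = (LINT u:{c..c'}|lborel. f u)"
    if "set_integrable lborel {0..b} f" "0 \<le> c" "c \<le> c'" "c' \<le> b" for f :: "real \<Rightarrow> real" and c c'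
    using set_integral_Icc_combine[OF set_integrable_subset[OF that(1), of "{0..c'}"], of c] that by auto
  have "D b = D a"
  proof (rule eq_if_increments_small[OF ab(2), where k=\<kappa>])
    fix x e :: real assume x: "a \<le> x" "x \<le> b" and e: "0 < e"
    have "\<exists>d>0. \<forall>u\<in>{0..b}. dist u x < d \<longrightarrow> dist (exp (K u)) (exp (K x)) < e / 2"
      using Kc x ab e unfolding continuous_on_iff by (metis atLeastAtMost_iff half_gt_zero order_trans)
    then obtain d where d: "d > 0" "\<And>u. u \<in> {0..b} \<Longrightarrow> \<bar>u - x\<bar> < d \<Longrightarrow> \<bar>exp (K u) - exp (K x)\<bar> < e / 2"
      by (auto simp: dist_real_def)
    have "\<bar>D c' - D c\<bar> \<le> e * (\<kappa> c' - \<kappa> c)" if c: "a \<le> c" "c \<le> x" "x \<le> c'" "c' \<le> b" "c' - c < d" for c c'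
    proof -
      have c0: "0 \<le> c" "c \<le> c'" using c ab by auto
      have sub: "{c..c'} \<subseteq> {0..b}" using c c0 by auto
      have near: "\<bar>exp (K u) - exp (K x)\<bar> < e / 2" if "u \<in> {c..c'}" for u
        by (rule d(2)) (use that c c0 in auto)
      obtain w where w: "exp (K c') - exp (K c) = w * (K c' - K c)"
          "min (exp (K c)) (exp (K c')) \<le> w" "w \<le> max (exp (K c)) (exp (K c'))"
        by (rule exp_increment)
      have wx: "\<bar>w - exp (K x)\<bar> \<le> e / 2"
      proof -
        have "\<bar>exp (K c) - exp (K x)\<bar> < e / 2" "\<bar>exp (K c') - exp (K x)\<bar> < e / 2"
          using near[of c] near[of c'] c0 by auto
        with w(2,3) show ?thesis unfolding min_def max_def by (smt (verit))
      qed
      have ik: "set_integrable lborel {c..c'} k" by (rule set_integrable_subset[OF k]) (use sub in auto)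
      have iw: "set_integrable lborel {c..c'} (\<lambda>u. w * k u)" using ik by simp
      have iK: "set_integrable lborel {c..c'} (\<lambda>u. k u * exp (K u))" by (rule set_integrable_subset[OF I]) (use sub in auto)
      have "D c' - D c = w * (K c' - K c) - (LINT u:{c..c'}|lborel. k u * exp (K u))"
        using diff[OF I c0 c(4)] w(1) by (simp add: D_def)
      also have "\<dots> = (LINT u:{c..c'}|lborel. w * k u - k u * exp (K u))"
        unfolding set_integral_diff(2)[OF iw iK] using diff[OF k c0 c(4)] by (simp add: K_def)
      also have "\<bar>\<dots>\<bar> \<le> (LINT u:{c..c'}|lborel. \<bar>w * k u - k u * exp (K u)\<bar>)"
        unfolding real_norm_def[symmetric] by (rule set_integral_norm_bound[OF set_integral_diff(1)[OF iw iK]])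
      also have "\<dots> \<le> (LINT u:{c..c'}|lborel. e * \<bar>k u\<bar>)"
      proof (rule set_integral_mono[OF set_integrable_abs[OF set_integral_diff(1)[OF iw iK]]])
        show "set_integrable lborel {c..c'} (\<lambda>u. e * \<bar>k u\<bar>)" using set_integrable_abs[OF ik] by simp
        fix u assume "u \<in> {c..c'}"
        then have "\<bar>w - exp (K u)\<bar> \<le> e" using near[of u] wx by linarith
        then have "\<bar>w - exp (K u)\<bar> * \<bar>k u\<bar> \<le> e * \<bar>k u\<bar>" by (intro mult_right_mono) auto
        then show "\<bar>w * k u - k u * exp (K u)\<bar> \<le> e * \<bar>k u\<bar>"
          by (simp add: abs_mult[symmetric] algebra_simps)
      qed
      also have "\<dots> = e * (\<kappa> c' - \<kappa> c)"
        using diff[OF set_integrable_abs[OF k] c0 c(4)] by (simp add: \<kappa>_def)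
      finally show ?thesis .
    qed
    with d(1) show "\<exists>d>0. \<forall>c c'. a \<le> c \<longrightarrow> c \<le> x \<longrightarrow> x \<le> c' \<longrightarrow> c' \<le> b \<longrightarrow> c' - c < d \<longrightarrow> \<bar>D c' - D c\<bar> \<le> e * (\<kappa> c' - \<kappa> c)"
      by blast
  qed
  then show "exp (K b) - exp (K a) = (LINT u:{a..b}|lborel. k u * exp (K u))"
    using diff[OF I ab order_refl] by (simp add: D_def)
qed

text \<open>The values on the negative axis are irrelevant.\<close>

definition C1b :: "(real \<Rightarrow> real) \<Rightarrow> (real \<Rightarrow> real) \<Rightarrow> real \<Rightarrow> bool" where
  "C1b p p' B \<longleftrightarrow> continuous_on UNIV p \<and> continuous_on UNIV p' \<and> (\<forall>r. \<bar>p r\<bar> \<le> B \<and> \<bar>p' r\<bar> \<le> B) \<and>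
    (\<forall>r\<ge>0. (p has_real_derivative p' r) (at r within {0..}))"

lemma C1bD:
  assumes "C1b p p' B"
  shows "continuous_on UNIV p" "continuous_on UNIV p'" "\<bar>p r\<bar> \<le> B" "\<bar>p' r\<bar> \<le> B" "0 \<le> B"
    "0 \<le> r \<Longrightarrow> (p has_real_derivative p' r) (at r within {0..})"
proof -
  show "continuous_on UNIV p" "continuous_on UNIV p'" and B: "\<bar>p r\<bar> \<le> B" and "\<bar>p' r\<bar> \<le> B"
    "0 \<le> r \<Longrightarrow> (p has_real_derivative p' r) (at r within {0..})"
    using assms by (auto simp: C1b_def)
  from B show "0 \<le> B" by linarith
qed

lemma half_line_mvt:
  fixes f f' :: "real \<Rightarrow> real"
  assumes "0 \<le> a" "a < b" and f: "\<And>r. 0 \<le> r \<Longrightarrow> (f has_real_derivative f' r) (at r within {0..})"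
  obtains z where "a < z" "z < b" "f b - f a = f' z * (b - a)"
proof -
  have "\<exists>z\<in>{a<..<b}. f b - f a = (*) (f' z) (b - a)"
  proof (rule mvt_simple[where f=f and f'="\<lambda>r. (*) (f' r)"])
    fix r assume "a \<le> r" "r \<le> b"
    then have "(f has_derivative (*) (f' r)) (at r within {0..})"
      using f[of r] assms(1) by (simp add: has_field_derivative_def)
    then show "(f has_derivative (*) (f' r)) (at r within {a..b})"
      by (rule has_derivative_subset) (use assms in auto)
  qed fact
  then show ?thesis using that by auto
qed

text \<open>The mean value bound B r serves small jumps and the trivial bound 2 B large ones;
  together they match the weight min(1,r) for which g is integrable.\<close>

lemma C1b_increment:
  assumes p: "C1b p p' B" and "0 \<le> a" "0 \<le> r"
  shows "\<bar>p (a + r) - p a\<bar> \<le> 2 * B * min 1 r"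
proof (cases "r = 0")
  case False
  obtain z where z: "p (a + r) - p a = p' z * (a + r - a)"
    by (rule half_line_mvt[OF assms(2), of "a + r" p p']) (use C1bD(6)[OF p] assms False in auto)
  have "\<bar>p (a + r) - p a\<bar> \<le> B * r"
    using C1bD(4)[OF p, of z] assms(3) unfolding z by (auto simp: abs_mult intro!: mult_right_mono)
  moreover have "\<bar>p (a + r) - p a\<bar> \<le> 2 * B" using C1bD(3)[OF p, of "a + r"] C1bD(3)[OF p, of a] by linarith
  moreover have "0 \<le> B * r" using C1bD(5)[OF p] assms(3) by simp
  ultimately show ?thesis by (auto simp: min_def)
qed simp

lemma C1b_lincomb:
  assumes p: "C1b p p' B" and q: "C1b q q' C"
  shows "C1b (\<lambda>r. a * p r + b * q r) (\<lambda>r. a * p' r + b * q' r) (\<bar>a\<bar> * B + \<bar>b\<bar> * C)"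
  unfolding C1b_def
proof (intro conjI allI impI)
  have tri: "\<bar>a * x + b * y\<bar> \<le> \<bar>a\<bar> * B + \<bar>b\<bar> * C" if "\<bar>x\<bar> \<le> B" "\<bar>y\<bar> \<le> C" for x y :: real
  proof -
    have "\<bar>a * x + b * y\<bar> \<le> \<bar>a\<bar> * \<bar>x\<bar> + \<bar>b\<bar> * \<bar>y\<bar>" by (metis abs_mult abs_triangle_ineq)
    also have "\<dots> \<le> \<bar>a\<bar> * B + \<bar>b\<bar> * C" using that by (intro add_mono mult_left_mono) auto
    finally show ?thesis .
  qed
  show "\<bar>a * p r + b * q r\<bar> \<le> \<bar>a\<bar> * B + \<bar>b\<bar> * C" "\<bar>a * p' r + b * q' r\<bar> \<le> \<bar>a\<bar> * B + \<bar>b\<bar> * C" for r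
    by (intro tri C1bD(3,4)[OF p] C1bD(3,4)[OF q])+
  show "continuous_on UNIV (\<lambda>r. a * p r + b * q r)" "continuous_on UNIV (\<lambda>r. a * p' r + b * q' r)"
    by (intro continuous_intros C1bD(1,2)[OF p] C1bD(1,2)[OF q])+
  show "((\<lambda>r. a * p r + b * q r) has_real_derivative a * p' r + b * q' r) (at r within {0..})" if "0 \<le> r" for r
    using C1bD(6)[OF p that] C1bD(6)[OF q that] by (auto intro!: derivative_eq_intros)
qed

text \<open>Clamping keeps the exponential bounded on the negative axis, since \<open>C1b\<close>
  asks for bounds everywhere.\<close>

lemma C1b_exp:
  assumes "0 \<le> l"
  shows "C1b (\<lambda>r. exp (- l * max 0 r)) (\<lambda>r. - l * exp (- l * max 0 r)) (1 + l)"
  unfolding C1b_def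
proof (intro conjI allI impI)
  show "continuous_on UNIV (\<lambda>r. exp (- l * max 0 r))" "continuous_on UNIV (\<lambda>r. - l * exp (- l * max 0 r))"
    by (intro continuous_intros)+
  have 1: "exp (- l * max 0 r) \<le> 1" for r using assms by simp
  show "\<bar>exp (- l * max 0 r)\<bar> \<le> 1 + l" for r unfolding abs_exp_cancel using 1[of r] assms by linarith
  show "\<bar>- l * exp (- l * max 0 r)\<bar> \<le> 1 + l" for r
    using mult_left_mono[OF 1[of r] assms] assms by (simp add: abs_mult)
  show "((\<lambda>r. exp (- l * max 0 r)) has_real_derivative - l * exp (- l * max 0 r)) (at r within {0..})" if "0 \<le> r" for r
  proof (rule DERIV_subset)
    have "((\<lambda>r. exp (- l * r)) has_real_derivative - l * exp (- l * max 0 r)) (at r within {0..})"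
      using that by (auto intro!: derivative_eq_intros)
    then show "((\<lambda>r. exp (- l * max 0 r)) has_real_derivative - l * exp (- l * max 0 r)) (at r within {0..})"
      unfolding has_field_derivative_def
      by (rule has_derivative_transform[rotated 2]) (use that in auto)
  qed simp
qed

text \<open>With y = exp(-eta r), a polynomial in y approximates the derivative of exp(-2 eta r)
  p(r) divided by y. Multiplying back by y leaves the error delta exp(-eta r), whose integral over
  the half-line, delta/eta, bounds the error in the function itself.\<close>

lemma exponential_sum_approx:
  assumes p: "C1b p p' B" and \<eta>: "0 < \<eta>" and \<delta>: "0 < \<delta>"
  obtains a :: "nat \<Rightarrow> real" and N where
    "\<And>r. 0 \<le> r \<Longrightarrow> \<bar>p 0 + (\<Sum>i\<le>N. a i / (real (Suc i) * \<eta>) * (1 - exp (- (real (Suc i) * \<eta>) * r))) - exp (- 2 * \<eta> * r) * p r\<bar> \<le> \<delta> / \<eta>"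
    "\<And>r. 0 \<le> r \<Longrightarrow> \<bar>(\<Sum>i\<le>N. a i * exp (- (real (Suc i) * \<eta>) * r)) - exp (- 2 * \<eta> * r) * (p' r - 2 * \<eta> * p r)\<bar> \<le> \<delta>"
proof -
  define c where "c r = p' r - 2 * \<eta> * p r" for r
  define C where "C = B + 2 * \<eta> * B"
  have cC: "\<bar>c r\<bar> \<le> C" for r
  proof -
    have "\<bar>c r\<bar> \<le> \<bar>p' r\<bar> + \<bar>2 * \<eta> * p r\<bar>" unfolding c_def by linarith
    also have "\<bar>2 * \<eta> * p r\<bar> = 2 * \<eta> * \<bar>p r\<bar>" using \<eta> by (simp add: abs_mult)
    also have "\<bar>p' r\<bar> + 2 * \<eta> * \<bar>p r\<bar> \<le> C" unfolding C_def
      using C1bD(3,4)[OF p] \<eta> by (intro add_mono mult_left_mono) auto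
    finally show ?thesis .
  qed
  have c_cont: "continuous_on UNIV c" unfolding c_def by (intro continuous_intros C1bD[OF p])
  \<comment> \<open>The substitution \<open>y = exp (-\<eta> r)\<close> compactifies the half-line; at \<open>y = 0\<close> the factor \<open>y\<close>
    absorbs the junk value of \<open>ln\<close>.\<close>
  define G where "G y = y * c (- ln y / \<eta>)" for y
  have "continuous_on {0..1} G"
    unfolding continuous_on_eq_continuous_within
  proof
    fix y :: real assume y: "y \<in> {0..1}"
    show "continuous (at y within {0..1}) G"
    proof (cases "y = 0")
      case True
      have "(G \<longlongrightarrow> 0) (at y within {0..1})"
      proof (rule tendsto_0_le[where K=C])
        show "((\<lambda>y. y) \<longlongrightarrow> 0) (at y within {0..1})" using True by (simp add: tendsto_ident_at)
        show "\<forall>\<^sub>F y in at y within {0..1}. norm (G y) \<le> norm y * C"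
          using cC by (intro always_eventually allI) (auto simp: G_def abs_mult intro!: mult_left_mono)
      qed
      then show ?thesis using True by (simp add: continuous_within G_def)
    next
      case False
      have "isCont (\<lambda>y. - ln y / \<eta>) y" using False y \<eta> by (intro continuous_intros) auto
      moreover have "isCont c (- ln y / \<eta>)" using c_cont by (simp add: continuous_on_eq_continuous_at)
      ultimately have "isCont (\<lambda>y. c (- ln y / \<eta>)) y" by (rule isCont_o2)
      then have "isCont G y" unfolding G_def by (rule continuous_mult[OF continuous_ident])
      then show ?thesis by (rule continuous_at_imp_continuous_within)
    qed
  qed
  then obtain S where S: "real_polynomial_function S" "\<And>y. y \<in> {0..1} \<Longrightarrow> \<bar>G y - S y\<bar> < \<delta>"
    using Stone_Weierstrass_real_polynomial_function[of "{0..1}" G \<delta>] \<delta> by auto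
  then obtain a N where a: "S = (\<lambda>y. \<Sum>i\<le>N. a i * y ^ i)" using real_polynomial_function_iff_sum by auto
  define q where "q r = exp (- 2 * \<eta> * r) * (p' r - 2 * \<eta> * p r)" for r
  define E' where "E' r = (\<Sum>i\<le>N. a i * exp (- (real (Suc i) * \<eta>) * r))" for r
  \<comment> \<open>The extra factor y shifts the exponents to \<open>Suc i\<close>, so the
    derivative has no constant term and its antiderivative is again an exponential sum up to a
    constant, here normalised to p 0 at r = 0.\<close>
  define E where "E r = p 0 + (\<Sum>i\<le>N. a i / (real (Suc i) * \<eta>) * (1 - exp (- (real (Suc i) * \<eta>) * r)))" for r
  have E'q: "\<bar>E' r - q r\<bar> \<le> \<delta> * exp (- \<eta> * r)" if r: "0 \<le> r" for r
  proof -
    define y where "y = exp (- \<eta> * r)"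
    have y: "0 < y" "y \<in> {0..1}" using \<eta> r by (auto simp: y_def)
    have "exp (- (real (Suc i) * \<eta>) * r) = y * y ^ i" for i
      unfolding y_def by (simp add: exp_of_nat_mult[symmetric] exp_add[symmetric] algebra_simps)
    then have "E' r = y * S y" by (simp add: E'_def a sum_distrib_left algebra_simps)
    moreover have "q r = y * G y"
    proof -
      have "exp (- 2 * \<eta> * r) = y * y" by (simp add: y_def exp_add[symmetric])
      moreover have "- ln y / \<eta> = r" using \<eta> by (simp add: y_def)
      ultimately show ?thesis by (simp add: q_def G_def c_def)
    qed
    ultimately have "\<bar>E' r - q r\<bar> = y * \<bar>S y - G y\<bar>" using y
      by (simp add: right_diff_distrib[symmetric] abs_mult)
    also have "\<dots> \<le> y * \<delta>" using S(2)[OF y(2)] y(1) by (intro mult_left_mono) auto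
    finally show ?thesis by (simp add: y_def mult.commute)
  qed
  define d where "d r = E r - exp (- 2 * \<eta> * r) * p r" for r
  have dd: "(d has_real_derivative E' r - q r) (at r within {0..})" if "0 \<le> r" for r
  proof -
    have E: "(E has_real_derivative E' r) (at r within {0..})"
    proof -
      have "(E has_real_derivative (\<Sum>i\<le>N. a i / (real (Suc i) * \<eta>) * (real (Suc i) * \<eta> * exp (- (real (Suc i) * \<eta>) * r)))) (at r within {0..})"
        unfolding E_def[abs_def] by (rule derivative_eq_intros refl | simp add: mult_ac)+
      moreover have "a i / (real (Suc i) * \<eta>) * (real (Suc i) * \<eta> * exp (- (real (Suc i) * \<eta>) * r)) =
          a i * exp (- (real (Suc i) * \<eta>) * r)" for i
        using \<eta> by simp
      ultimately show ?thesis by (simp only: E'_def)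
    qed
    have X: "((\<lambda>r. exp (- 2 * \<eta> * r)) has_real_derivative - 2 * \<eta> * exp (- 2 * \<eta> * r)) (at r within {0..})"
      by (auto intro!: derivative_eq_intros)
    have "q r = - 2 * \<eta> * exp (- 2 * \<eta> * r) * p r + p' r * exp (- 2 * \<eta> * r)"
      by (simp add: q_def algebra_simps)
    then show ?thesis unfolding d_def[abs_def]
      using DERIV_diff[OF E DERIV_mult[OF X C1bD(6)[OF p that]]] by simp
  qed
  \<comment> \<open>The function is nonincreasing for \<open>\<sigma>\<close> = 1 and nondecreasing
    for \<open>\<sigma>\<close> = -1, which bounds \<open>d\<close> from both sides.\<close>
  have dexp: "((\<lambda>r. d r + \<sigma> * (\<delta> / \<eta>) * exp (- \<eta> * r)) has_real_derivative E' r - q r - \<sigma> * \<delta> * exp (- \<eta> * r)) (at r within {0..})"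
    if "0 \<le> r" for r \<sigma>
    using \<eta> by (auto intro!: derivative_eq_intros dd[OF that])
  have d0: "d 0 = 0" by (simp add: d_def E_def)
  have "\<bar>d r\<bar> \<le> \<delta> / \<eta>" if r: "0 \<le> r" for r
  proof (cases "r = 0")
    case False
    obtain z where z: "0 < z" "d r + 1 * (\<delta> / \<eta>) * exp (- \<eta> * r) - (d 0 + 1 * (\<delta> / \<eta>) * exp (- \<eta> * 0)) =
        (E' z - q z - 1 * \<delta> * exp (- \<eta> * z)) * (r - 0)"
      by (rule half_line_mvt[OF order_refl, of r "\<lambda>r. d r + 1 * (\<delta> / \<eta>) * exp (- \<eta> * r)"
            "\<lambda>r. E' r - q r - 1 * \<delta> * exp (- \<eta> * r)"]) (use dexp[of _ 1] r False in auto)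
    have "(E' z - q z - 1 * \<delta> * exp (- \<eta> * z)) * (r - 0) \<le> 0"
      using E'q[of z] z(1) r by (intro mult_nonpos_nonneg) auto
    then have 1: "d r \<le> \<delta> / \<eta> - \<delta> / \<eta> * exp (- \<eta> * r)" using z(2) d0 by simp
    obtain z where z: "0 < z" "d r + - 1 * (\<delta> / \<eta>) * exp (- \<eta> * r) - (d 0 + - 1 * (\<delta> / \<eta>) * exp (- \<eta> * 0)) =
        (E' z - q z - - 1 * \<delta> * exp (- \<eta> * z)) * (r - 0)"
      by (rule half_line_mvt[OF order_refl, of r "\<lambda>r. d r + - 1 * (\<delta> / \<eta>) * exp (- \<eta> * r)"
            "\<lambda>r. E' r - q r - - 1 * \<delta> * exp (- \<eta> * r)"]) (use dexp[of _ "- 1"] r False in auto)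
    have "0 \<le> (E' z - q z - - 1 * \<delta> * exp (- \<eta> * z)) * (r - 0)"
      using E'q[of z] z(1) r by (intro mult_nonneg_nonneg) auto
    then have 2: "- (\<delta> / \<eta> - \<delta> / \<eta> * exp (- \<eta> * r)) \<le> d r" using z(2) d0 by simp
    have "0 \<le> \<delta> / \<eta> * exp (- \<eta> * r)" using \<delta> \<eta> by simp
    with 1 2 show ?thesis by linarith
  qed (use d0 \<delta> \<eta> in simp)
  moreover have "\<bar>E' r - q r\<bar> \<le> \<delta>" if "0 \<le> r" for r
  proof -
    have "\<delta> * exp (- \<eta> * r) \<le> \<delta> * 1" using \<delta> \<eta> that by (intro mult_left_mono) auto
    with E'q[OF that] show ?thesis by simp
  qed
  ultimately show ?thesis
    by (intro that[of a N]) (simp_all add: d_def E_def E'_def q_def)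
qed

section \<open>The forward equation of the increments\<close>

context subordinated_feller
begin

section \<open>Integrals against the jump density\<close>

definition K :: "real \<Rightarrow> real" where
  "K s = (LINT r:{0<..}|lborel. min 1 r * g s r)"

lemma g_measurable:
  "(\<lambda>z. indicat_real ({0..} \<times> {0..}) z * g (fst z) (snd z)) \<in> borel_measurable (borel \<Otimes>\<^sub>M borel)"
proof -
  have "(\<lambda>z. indicat_real ({0..} \<times> {0..}) z *\<^sub>R (case z of (s, r) \<Rightarrow> g s r)) \<in> borel_measurable borel"
    by (rule borel_measurable_continuous_on_indicator[OF _ g_cont]) (intro borel_closed closed_Times; simp)
  then show ?thesis by (simp add: borel_prod case_prod_unfold)
qed

lemma g_set_integrable:
  assumes s: "0 \<le> s" and h: "set_borel_measurable borel {0<..} h"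
    and C: "\<And>r. 0 < r \<Longrightarrow> \<bar>h r\<bar> \<le> C * min 1 r"
  shows "set_integrable lborel {0<..} (\<lambda>r. h r * g s r)"
    and "\<bar>LINT r:{0<..}|lborel. h r * g s r\<bar> \<le> C * K s"
proof -
  have b: "\<bar>h r * g s r\<bar> \<le> C * (min 1 r * g s r)" if "0 < r" for r
    using mult_right_mono[OF C[OF that] g_nonneg[OF s less_imp_le[OF that]]] g_nonneg[OF s less_imp_le[OF that]]
    by (simp add: abs_mult mult.assoc)
  have i: "set_integrable lborel {0<..} (\<lambda>r. C * (min 1 r * g s r))"
    using g_integrable[OF s] by simp
  show I: "set_integrable lborel {0<..} (\<lambda>r. h r * g s r)"
    unfolding set_integrable_def
  proof (rule Bochner_Integration.integrable_bound[OF i[unfolded set_integrable_def]])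
    have "(\<lambda>r. indicat_real ({0..} \<times> {0..}) (s, r) * g s r) \<in> borel_measurable borel"
      using measurable_compose[OF measurable_Pair1'[of s borel borel] g_measurable] by simp
    then have "(\<lambda>r. (indicat_real {0<..} r *\<^sub>R h r) * (indicat_real ({0..} \<times> {0..}) (s, r) * g s r)) \<in> borel_measurable borel"
      by (rule borel_measurable_times[OF h[unfolded set_borel_measurable_def]])
    also have "(\<lambda>r. (indicat_real {0<..} r *\<^sub>R h r) * (indicat_real ({0..} \<times> {0..}) (s, r) * g s r)) =
        (\<lambda>r. indicat_real {0<..} r *\<^sub>R (h r * g s r))"
      using s by (auto simp: indicator_def fun_eq_iff)
    finally show "(\<lambda>r. indicat_real {0<..} r *\<^sub>R (h r * g s r)) \<in> borel_measurable lborel"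
      by (simp only: measurable_lborel2)
    show "AE r in lborel. norm (indicat_real {0<..} r *\<^sub>R (h r * g s r)) \<le> norm (indicat_real {0<..} r *\<^sub>R (C * (min 1 r * g s r)))"
      by (intro AE_I2) (use b in \<open>force simp: indicator_def\<close>)
  qed
  have "\<bar>LINT r:{0<..}|lborel. h r * g s r\<bar> \<le> (LINT r:{0<..}|lborel. \<bar>h r * g s r\<bar>)"
    unfolding real_norm_def[symmetric] by (rule set_integral_norm_bound[OF I])
  also have "\<dots> \<le> (LINT r:{0<..}|lborel. C * (min 1 r * g s r))"
    by (rule set_integral_mono[OF set_integrable_abs[OF I] i]) (use b in auto)
  also have "\<dots> = C * K s" by (simp add: K_def)
  finally show "\<bar>LINT r:{0<..}|lborel. h r * g s r\<bar> \<le> C * K s" .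
qed

lemma K_nonneg: "0 \<le> s \<Longrightarrow> 0 \<le> K s"
  unfolding K_def set_lebesgue_integral_def
  by (intro Bochner_Integration.integral_nonneg) (auto simp: indicator_def g_nonneg)

lemma exp_minus_1_bound:
  fixes l r :: real
  assumes "0 \<le> l" "0 < r"
  shows "\<bar>exp (- l * r) - 1\<bar> \<le> (1 + l) * min 1 r"
proof -
  have "1 - exp (- l * r) \<le> l * r" using exp_ge_add_one_self[of "- l * r"] by simp
  moreover have "exp (- l * r) \<le> 1" "0 \<le> exp (- l * r)" using assms by simp_all
  moreover have "0 \<le> l * r" using assms by simp
  ultimately show ?thesis using assms by (auto simp: min_def algebra_simps)
qed

lemma exp_minus_1_g_integrable:
  assumes "0 \<le> s" "0 \<le> l"
  shows "set_integrable lborel {0<..} (\<lambda>r. (exp (- l * r) - 1) * g s r)"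
  by (rule g_set_integrable(1)[OF assms(1), where C="1 + l"])
    (use exp_minus_1_bound[OF assms(2)] in \<open>auto simp: set_borel_measurable_def\<close>)

text \<open>The drift and the jump part of \<open>psir 1\<close> are both nonpositive, so the jump
  part is at most |psir 1| in absolute value; the factor 2 comes from min(1,r) <= 2 (1 - exp(-r)).
  This is the source of the integrability of \<open>K\<close> in time.\<close>

lemma K_le_psir:
  assumes s: "0 \<le> s"
  shows "K s \<le> 2 * \<bar>psir 1 s\<bar>"
proof -
  have i: "set_integrable lborel {0<..} (\<lambda>r. (exp (- 1 * r) - 1) * g s r)"
    by (rule exp_minus_1_g_integrable[OF s]) simp
  have "K s \<le> (LINT r:{0<..}|lborel. - 2 * ((exp (- 1 * r) - 1) * g s r))"
    unfolding K_def
  proof (rule set_integral_mono[OF g_integrable[OF s]])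
    show "set_integrable lborel {0<..} (\<lambda>r. - 2 * ((exp (- 1 * r) - 1) * g s r))"
      by (rule set_integrable_mult_right) (rule i)
    fix r :: real assume "r \<in> {0<..}"
    then have r: "0 < r" by simp
    have "1 + r \<le> exp r" by (rule exp_ge_add_one_self)
    then have "exp (- r) \<le> 1 / (1 + r)" using r by (simp add: exp_minus divide_simps)
    moreover have "1 / (1 + r) \<le> 1 - min 1 r / 2"
      using r by (cases "r \<le> 1") (auto simp: min_def field_simps)
    ultimately have "min 1 r \<le> - 2 * (exp (- 1 * r) - 1)" by simp
    from mult_right_mono[OF this g_nonneg[OF s less_imp_le[OF r]]]
    show "min 1 r * g s r \<le> - 2 * ((exp (- 1 * r) - 1) * g s r)" by (simp only: mult.assoc)
  qed
  also have "\<dots> = - 2 * (psir 1 s + \<beta> s)" unfolding set_integral_mult_right by (simp add: psir_def)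
  also have "\<dots> \<le> 2 * \<bar>psir 1 s\<bar>"
    unfolding distrib_left using \<beta>_nonneg[OF s] abs_ge_minus_self[of "psir 1 s"] by simp
  finally show ?thesis .
qed

text \<open>The majorant is that of \<open>K_le_psir\<close>. Measurability in s comes from
  integrating out one variable of a jointly measurable function, with indicators because g is
  arbitrary at negative arguments.\<close>

lemma K_set_integrable:
  assumes "0 \<le> a"
  shows "set_integrable lborel {a..b} K"
proof -
  have "set_integrable lborel {0..max 0 b} K"
    unfolding set_integrable_def
  proof (rule Bochner_Integration.integrable_bound)
    show "integrable lborel (\<lambda>s. 2 * (indicat_real {0..max 0 b} s *\<^sub>R psir 1 s))"
      using psir_integrable[of 1 "max 0 b"] unfolding set_integrable_def by (intro integrable_mult_right) auto
    have "(\<lambda>r. indicat_real {0<..} r * min 1 r) \<in> borel_measurable borel" by measurable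
    from measurable_compose[OF measurable_snd this]
    have "(\<lambda>z. indicat_real {0<..} (snd z) * min 1 (snd z)) \<in> borel_measurable (borel \<Otimes>\<^sub>M borel)" .
    moreover have "(\<lambda>z. indicat_real {0..max 0 b} (fst z)) \<in> borel_measurable (borel \<Otimes>\<^sub>M borel)"
      by (rule measurable_compose[OF measurable_fst borel_measurable_indicator]) simp
    ultimately have "(\<lambda>z. (indicat_real {0..max 0 b} (fst z) * (indicat_real {0<..} (snd z) * min 1 (snd z))) *
        (indicat_real ({0..} \<times> {0..}) z * g (fst z) (snd z))) \<in> borel_measurable (borel \<Otimes>\<^sub>M borel)"
      by (intro borel_measurable_times[OF borel_measurable_times g_measurable])
    moreover have "(borel :: real measure) \<Otimes>\<^sub>M (lborel :: real measure) \<rightarrow>\<^sub>M (borel :: real measure) = borel \<Otimes>\<^sub>M borel \<rightarrow>\<^sub>M borel"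
      by (intro measurable_cong_sets sets_pair_measure_cong refl sets_lborel)
    ultimately have "(\<lambda>(s, r). (indicat_real {0..max 0 b} s * (indicat_real {0<..} r * min 1 r)) *
        (indicat_real ({0..} \<times> {0..}) (s, r) * g s r)) \<in> borel_measurable (borel \<Otimes>\<^sub>M lborel)"
      by (simp only: case_prod_unfold prod.collapse)
    from lborel.borel_measurable_lebesgue_integral[OF this]
    have "(\<lambda>s. LINT r|lborel. (indicat_real {0..max 0 b} s * (indicat_real {0<..} r * min 1 r)) *
        (indicat_real ({0..} \<times> {0..}) (s, r) * g s r)) \<in> borel_measurable borel" .
    moreover have "(LINT r|lborel. (indicat_real {0..max 0 b} s * (indicat_real {0<..} r * min 1 r)) *
        (indicat_real ({0..} \<times> {0..}) (s, r) * g s r)) = indicat_real {0..max 0 b} s *\<^sub>R K s" for s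
    proof -
      have "(indicat_real {0..max 0 b} s * (indicat_real {0<..} r * min 1 r)) * (indicat_real ({0..} \<times> {0..}) (s, r) * g s r)
          = indicat_real {0..max 0 b} s * (indicat_real {0<..} r *\<^sub>R (min 1 r * g s r))" for r
        by (cases "s \<in> {0..max 0 b}"; cases "0 < r") simp_all
      then show ?thesis by (simp only: K_def set_lebesgue_integral_def integral_mult_right_zero real_scaleR_def)
    qed
    ultimately show "(\<lambda>s. indicat_real {0..max 0 b} s *\<^sub>R K s) \<in> borel_measurable lborel" by simp
    show "AE s in lborel. norm (indicat_real {0..max 0 b} s *\<^sub>R K s) \<le> norm (2 * (indicat_real {0..max 0 b} s *\<^sub>R psir 1 s))"
      by (intro AE_I2) (use K_le_psir K_nonneg in \<open>auto simp: indicator_def abs_mult\<close>)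
  qed
  then show ?thesis by (rule set_integrable_subset) (use assms in auto)
qed

lemma \<beta>_set_integrable: "0 \<le> a \<Longrightarrow> set_integrable lborel {a..b} \<beta>"
  by (intro set_integrable_continuous_Icc continuous_on_subset[OF \<beta>_cont]) auto

section \<open>The forward equation in integrated form\<close>

definition mean :: "real \<Rightarrow> (real \<Rightarrow> real) \<Rightarrow> real \<Rightarrow> real \<Rightarrow> real" where
  "mean s p u r = (LINT \<omega>|M 0. p (Z u \<omega> - Z s \<omega> + r))"

text \<open>The time-inhomogeneous generator of Z applied to p and averaged over the increment, with
  the expectation placed inside the jump integral, where it acts on p directly.\<close>

definition J :: "real \<Rightarrow> (real \<Rightarrow> real) \<Rightarrow> (real \<Rightarrow> real) \<Rightarrow> real \<Rightarrow> real" where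
  "J s p p' u = \<beta> u * mean s p' u 0 + (LINT r:{0<..}|lborel. (mean s p u r - mean s p u 0) * g u r)"

text \<open>Integrability is part of the property: it makes the integral meaningful and passes
  through linear combinations and limits together with the equation.\<close>

definition forward_eq :: "real \<Rightarrow> (real \<Rightarrow> real) \<Rightarrow> (real \<Rightarrow> real) \<Rightarrow> bool" where
  "forward_eq s p p' \<longleftrightarrow> (\<forall>a b. s \<le> a \<longrightarrow> a \<le> b \<longrightarrow> set_integrable lborel {a..b} (J s p p') \<and>
    mean s p b 0 - mean s p a 0 = (LINT u:{a..b}|lborel. J s p p' u))"

lemma mean_integrable:
  fixes p :: "real \<Rightarrow> real"
  assumes "0 \<le> s" "0 \<le> u" and p: "continuous_on UNIV p" "\<And>r. \<bar>p r\<bar> \<le> B"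
  shows "integrable (M 0) (\<lambda>\<omega>. p (Z u \<omega> - Z s \<omega> + r))"
proof (rule tc.integrable_const_bound[where B=B])
  have "(\<lambda>y. p (y + r)) \<in> borel_measurable borel"
    by (intro borel_measurable_continuous_onI continuous_on_compose2[OF p(1)] continuous_intros) auto
  from measurable_compose[OF incr_measurable[OF assms(1,2)] this]
  show "(\<lambda>\<omega>. p (Z u \<omega> - Z s \<omega> + r)) \<in> borel_measurable (M 0)" .
qed (use p in auto)

lemma mean_bound:
  fixes p :: "real \<Rightarrow> real"
  assumes "\<And>r. \<bar>p r\<bar> \<le> B"
  shows "\<bar>mean s p u r\<bar> \<le> B"
proof (cases "integrable (M 0) (\<lambda>\<omega>. p (Z u \<omega> - Z s \<omega> + r))")
  case True
  have "\<bar>mean s p u r\<bar> \<le> (LINT \<omega>|M 0. \<bar>p (Z u \<omega> - Z s \<omega> + r)\<bar>)"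
    unfolding mean_def by (rule integral_abs_bound)
  also have "\<dots> \<le> (LINT \<omega>|M 0. B)" by (rule integral_mono) (use True assms in auto)
  finally show ?thesis by (simp add: tc.prob_space)
next
  case False
  then have "mean s p u r = 0" unfolding mean_def by (rule not_integrable_integral_eq)
  then show ?thesis using assms[of 0] by simp
qed

lemma mean_measurable:
  assumes "0 \<le> s" "0 \<le> u" and p: "continuous_on UNIV p"
  shows "(\<lambda>r. mean s p u r) \<in> borel_measurable borel"
proof -
  have "p \<in> borel_measurable borel" by (rule borel_measurable_continuous_onI[OF p])
  moreover have "(\<lambda>z. (Z u (snd z) - Z s (snd z)) + fst z) \<in> borel_measurable (borel \<Otimes>\<^sub>M M 0)"
    using measurable_compose[OF measurable_snd incr_measurable[OF assms(1,2)]]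
    by (intro borel_measurable_add measurable_fst) auto
  ultimately have "(\<lambda>(r, \<omega>). p (Z u \<omega> - Z s \<omega> + r)) \<in> borel_measurable (borel \<Otimes>\<^sub>M M 0)"
    unfolding case_prod_unfold by (rule measurable_compose[rotated])
  from tc.borel_measurable_lebesgue_integral[OF this] show ?thesis unfolding mean_def .
qed

lemma mean_increment:
  assumes s: "0 \<le> s" "s \<le> u" and p: "C1b p p' B" and r: "0 \<le> r"
  shows "\<bar>mean s p u r - mean s p u 0\<bar> \<le> 2 * B * min 1 r"
proof -
  have u: "0 \<le> u" using s by simp
  note I = mean_integrable[OF s(1) u C1bD(1,3)[OF p]]
  have "mean s p u r - mean s p u 0 = (LINT \<omega>|M 0. p (Z u \<omega> - Z s \<omega> + r) - p (Z u \<omega> - Z s \<omega> + 0))"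
    unfolding mean_def by (rule Bochner_Integration.integral_diff[OF I I, symmetric])
  also have "\<bar>\<dots>\<bar> \<le> (LINT \<omega>|M 0. \<bar>p (Z u \<omega> - Z s \<omega> + r) - p (Z u \<omega> - Z s \<omega> + 0)\<bar>)"
    by (rule integral_abs_bound)
  also have "\<dots> \<le> (LINT \<omega>|M 0. 2 * B * min 1 r)"
  proof (rule integral_mono)
    show "integrable (M 0) (\<lambda>\<omega>. \<bar>p (Z u \<omega> - Z s \<omega> + r) - p (Z u \<omega> - Z s \<omega> + 0)\<bar>)"
      by (intro integrable_abs Bochner_Integration.integrable_diff I)
    show "\<bar>p (Z u \<omega> - Z s \<omega> + r) - p (Z u \<omega> - Z s \<omega> + 0)\<bar> \<le> 2 * B * min 1 r" if "\<omega> \<in> space (M 0)" for \<omega>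
      using C1b_increment[OF p _ r, of "Z u \<omega> - Z s \<omega>"] Z_mono[OF that s] by simp
  qed simp
  finally show ?thesis by (simp add: tc.prob_space)
qed

lemma mean_increment_integrable:
  assumes s: "0 \<le> s" "s \<le> u" and p: "C1b p p' B"
  shows "set_integrable lborel {0<..} (\<lambda>r. (mean s p u r - mean s p u 0) * g u r)"
    and "\<bar>LINT r:{0<..}|lborel. (mean s p u r - mean s p u 0) * g u r\<bar> \<le> 2 * B * K u"
proof -
  have u: "0 \<le> u" using s by simp
  have m: "set_borel_measurable borel {0<..} (\<lambda>r. mean s p u r - mean s p u 0)"
    unfolding set_borel_measurable_def
    by (intro borel_measurable_scaleR borel_measurable_diff mean_measurable[OF s(1) u C1bD(1)[OF p]]) auto
  show "set_integrable lborel {0<..} (\<lambda>r. (mean s p u r - mean s p u 0) * g u r)"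
    by (rule g_set_integrable(1)[OF u m mean_increment[OF s p]]) simp
  show "\<bar>LINT r:{0<..}|lborel. (mean s p u r - mean s p u 0) * g u r\<bar> \<le> 2 * B * K u"
    by (rule g_set_integrable(2)[OF u m mean_increment[OF s p]]) simp
qed

lemma mean_lincomb:
  assumes "0 \<le> s" "0 \<le> u" and "continuous_on UNIV p" "\<And>r. \<bar>p r\<bar> \<le> B" and "continuous_on UNIV q" "\<And>r. \<bar>q r\<bar> \<le> C"
  shows "mean s (\<lambda>r. a * p r + b * q r) u r = a * mean s p u r + b * mean s q u r"
  unfolding mean_def using mean_integrable[OF assms(1,2,3,4)] mean_integrable[OF assms(1,2,5,6)] by simp

lemma forward_eq_lincomb:
  assumes s: "0 \<le> s" and p: "C1b p p' B" "forward_eq s p p'" and q: "C1b q q' C" "forward_eq s q q'"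
  shows "forward_eq s (\<lambda>r. a * p r + b * q r) (\<lambda>r. a * p' r + b * q' r)"
proof -
  let ?f = "\<lambda>r. a * p r + b * q r" and ?f' = "\<lambda>r. a * p' r + b * q' r"
  have m: "mean s ?f u r = a * mean s p u r + b * mean s q u r"
    "mean s ?f' u r = a * mean s p' u r + b * mean s q' u r" if "s \<le> u" for u r
    using mean_lincomb[OF s _ C1bD(1,3)[OF p(1)] C1bD(1,3)[OF q(1)], of u]
      mean_lincomb[OF s _ C1bD(2,4)[OF p(1)] C1bD(2,4)[OF q(1)], of u] s that by auto
  have J: "J s ?f ?f' u = a * J s p p' u + b * J s q q' u" if u: "s \<le> u" for u
  proof -
    note i = mean_increment_integrable(1)[OF s u p(1)] mean_increment_integrable(1)[OF s u q(1)]
    have "(LINT r:{0<..}|lborel. (mean s ?f u r - mean s ?f u 0) * g u r) =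
        (LINT r:{0<..}|lborel. a * ((mean s p u r - mean s p u 0) * g u r) + b * ((mean s q u r - mean s q u 0) * g u r))"
      by (simp add: m[OF u] algebra_simps)
    also have "\<dots> = a * (LINT r:{0<..}|lborel. (mean s p u r - mean s p u 0) * g u r) +
        b * (LINT r:{0<..}|lborel. (mean s q u r - mean s q u 0) * g u r)"
      using i by (subst set_integral_add(2)) auto
    finally show ?thesis by (simp add: J_def m[OF u] algebra_simps)
  qed
  show ?thesis unfolding forward_eq_def
  proof (intro allI impI conjI)
    fix c d assume cd: "s \<le> c" "c \<le> d"
    have I: "set_integrable lborel {c..d} (J s p p')" "set_integrable lborel {c..d} (J s q q')"
      and E: "mean s p d 0 - mean s p c 0 = (LINT u:{c..d}|lborel. J s p p' u)"
        "mean s q d 0 - mean s q c 0 = (LINT u:{c..d}|lborel. J s q q' u)"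
      using p(2) q(2) cd unfolding forward_eq_def by auto
    have I2: "set_integrable lborel {c..d} (\<lambda>u. a * J s p p' u)" "set_integrable lborel {c..d} (\<lambda>u. b * J s q q' u)"
      using I by auto
    have eq: "indicat_real {c..d} u *\<^sub>R J s ?f ?f' u = indicat_real {c..d} u *\<^sub>R (a * J s p p' u + b * J s q q' u)" for u
      using J[of u] cd by (auto simp: indicator_def)
    show "set_integrable lborel {c..d} (J s ?f ?f')"
      using set_integral_add(1)[OF I2] unfolding set_integrable_def eq .
    have "(LINT u:{c..d}|lborel. J s ?f ?f' u) = (LINT u:{c..d}|lborel. a * J s p p' u + b * J s q q' u)"
      unfolding set_lebesgue_integral_def eq ..
    also have "\<dots> = a * (mean s p d 0 - mean s p c 0) + b * (mean s q d 0 - mean s q c 0)"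
      unfolding set_integral_add(2)[OF I2] E by simp
    finally show "mean s ?f d 0 - mean s ?f c 0 = (LINT u:{c..d}|lborel. J s ?f ?f' u)"
      using cd by (simp add: m algebra_simps)
  qed
qed

text \<open>Exponentials make both sides explicit in phi(u), the Laplace transform of Z_u - Z_s at
  l: \<open>J\<close> equals psir l u times phi(u), and phi is the exponential of an indefinite
  integral of \<open>psir l\<close>.\<close>

lemma forward_eq_exp:
  assumes s: "0 \<le> s" and l: "0 \<le> l"
  shows "forward_eq s (\<lambda>r. exp (- l * max 0 r)) (\<lambda>r. - l * exp (- l * max 0 r))" (is "forward_eq s ?p ?p'")
proof -
  let ?\<phi> = "\<lambda>u. exp (Psi l u - Psi l s)"
  have m: "mean s ?p u r = exp (- l * r) * ?\<phi> u" "mean s ?p' u r = - l * exp (- l * r) * ?\<phi> u" if u: "s \<le> u" "0 \<le> r" for u r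
  proof -
    have e: "exp (- l * max 0 (Z u \<omega> - Z s \<omega> + r)) = exp (- l * r) * exp (- l * (Z u \<omega> - Z s \<omega>))"
      if "\<omega> \<in> space (M 0)" for \<omega>
    proof -
      have "max 0 (Z u \<omega> - Z s \<omega> + r) = Z u \<omega> - Z s \<omega> + r" using Z_mono[OF that s u(1)] u(2) by simp
      then show ?thesis by (simp only: exp_add[symmetric]) (simp add: algebra_simps)
    qed
    have L: "(LINT \<omega>|M 0. exp (- l * (Z u \<omega> - Z s \<omega>))) = ?\<phi> u" by (rule laplace_real[OF s u(1) l])
    have "mean s ?p u r = (LINT \<omega>|M 0. exp (- l * r) * exp (- l * (Z u \<omega> - Z s \<omega>)))"
      unfolding mean_def by (intro Bochner_Integration.integral_cong refl e)
    then show "mean s ?p u r = exp (- l * r) * ?\<phi> u" unfolding integral_mult_right_zero L .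
    moreover have "mean s ?p' u r = - l * mean s ?p u r" unfolding mean_def by (rule integral_mult_right_zero)
    ultimately show "mean s ?p' u r = - l * exp (- l * r) * ?\<phi> u" by simp
  qed
  have J: "J s ?p ?p' u = psir l u * ?\<phi> u" if u: "s \<le> u" for u
  proof -
    have "(mean s ?p u r - mean s ?p u 0) * g u r = ?\<phi> u * ((exp (- l * r) - 1) * g u r)" if "0 < r" for r
      unfolding m(1)[OF u less_imp_le[OF that]] m(1)[OF u order_refl] by (simp add: algebra_simps)
    then have "(LINT r:{0<..}|lborel. (mean s ?p u r - mean s ?p u 0) * g u r) =
        (LINT r:{0<..}|lborel. ?\<phi> u * ((exp (- l * r) - 1) * g u r))"
      unfolding set_lebesgue_integral_def
      by (intro Bochner_Integration.integral_cong refl) (auto simp: indicator_def)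
    also have "\<dots> = ?\<phi> u * (psir l u + l * \<beta> u)" unfolding set_integral_mult_right by (simp add: psir_def)
    finally show ?thesis unfolding J_def m(2)[OF u order_refl] by (simp add: algebra_simps)
  qed
  show ?thesis unfolding forward_eq_def
  proof (intro allI impI conjI)
    fix a b assume ab: "s \<le> a" "a \<le> b"
    have k: "set_integrable lborel {0..b} (psir l)" by (rule psir_integrable[OF l]) (use s ab in auto)
    note X = exp_indefinite_integral[OF k _ ab(2), folded Psi_def]
    have X1: "exp (Psi l b) - exp (Psi l a) = (LINT u:{a..b}|lborel. psir l u * exp (Psi l u))"
      and X2: "set_integrable lborel {a..b} (\<lambda>u. psir l u * exp (Psi l u))"
      using X s ab by auto
    have eq: "indicat_real {a..b} u *\<^sub>R J s ?p ?p' u = indicat_real {a..b} u *\<^sub>R (exp (- Psi l s) * (psir l u * exp (Psi l u)))" for u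
      using J[of u] ab by (auto simp: indicator_def exp_diff exp_minus field_simps)
    show "set_integrable lborel {a..b} (J s ?p ?p')"
      unfolding set_integrable_def eq unfolding set_integrable_def[symmetric]
      by (rule set_integrable_mult_right) (rule X2)
    have "(LINT u:{a..b}|lborel. J s ?p ?p' u) = exp (- Psi l s) * (exp (Psi l b) - exp (Psi l a))"
      unfolding X1 set_lebesgue_integral_def eq
      by (subst integral_mult_right_zero[symmetric]) (simp add: mult_ac)
    also have "\<dots> = ?\<phi> b - ?\<phi> a" by (simp add: exp_diff exp_minus field_simps)
    finally show "mean s ?p b 0 - mean s ?p a 0 = (LINT u:{a..b}|lborel. J s ?p ?p' u)"
      using ab m[of b 0] m[of a 0] by simp
  qed
qed

text \<open>The bound is existentially quantified so that it can be carried through the induction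
  without tracking its value; constants enter as multiples of the exponential with exponent
  0.\<close>

lemma forward_eq_exponential_sum:
  assumes s: "0 \<le> s" and \<eta>: "0 < \<eta>"
  shows "\<exists>B. C1b (\<lambda>r. c + (\<Sum>i\<le>N. a i / (real (Suc i) * \<eta>) * (1 - exp (- (real (Suc i) * \<eta>) * max 0 r))))
      (\<lambda>r. \<Sum>i\<le>N. a i * exp (- (real (Suc i) * \<eta>) * max 0 r)) B \<and>
    forward_eq s (\<lambda>r. c + (\<Sum>i\<le>N. a i / (real (Suc i) * \<eta>) * (1 - exp (- (real (Suc i) * \<eta>) * max 0 r))))
      (\<lambda>r. \<Sum>i\<le>N. a i * exp (- (real (Suc i) * \<eta>) * max 0 r))"
proof -
  define l where "l i = real (Suc i) * \<eta>" for i
  have l: "0 < l i" for i using \<eta> by (simp add: l_def)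
  have good_step: "\<exists>B. C1b (\<lambda>r. x * p r + y * q r) (\<lambda>r. x * p' r + y * q' r) B \<and>
      forward_eq s (\<lambda>r. x * p r + y * q r) (\<lambda>r. x * p' r + y * q' r)"
    if "\<exists>B. C1b p p' B \<and> forward_eq s p p'" "\<exists>B. C1b q q' B \<and> forward_eq s q q'" for p p' q q' x y
    using that C1b_lincomb forward_eq_lincomb[OF s] by blast
  have ex: "\<exists>B. C1b (\<lambda>r. exp (- k * max 0 r)) (\<lambda>r. - k * exp (- k * max 0 r)) B \<and>
      forward_eq s (\<lambda>r. exp (- k * max 0 r)) (\<lambda>r. - k * exp (- k * max 0 r))" if "0 \<le> k" for k
    using C1b_exp[OF that] forward_eq_exp[OF s that] by blast
  have const: "\<exists>B. C1b (\<lambda>r. c) (\<lambda>r. 0) B \<and> forward_eq s (\<lambda>r. c) (\<lambda>r. 0)" for c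
    using good_step[OF ex[of 0] ex[of 0], of c 0] by simp
  have summand: "\<exists>B. C1b (\<lambda>r. a i / l i * (1 - exp (- l i * max 0 r))) (\<lambda>r. a i * exp (- l i * max 0 r)) B \<and>
      forward_eq s (\<lambda>r. a i / l i * (1 - exp (- l i * max 0 r))) (\<lambda>r. a i * exp (- l i * max 0 r))" for i
  proof -
    have "(\<lambda>r. a i / l i * (1 - exp (- l i * max 0 r))) = (\<lambda>r. 1 * (a i / l i) + (- (a i / l i)) * exp (- l i * max 0 r))"
      by (auto simp: right_diff_distrib)
    moreover have "(\<lambda>r. a i * exp (- l i * max 0 r)) = (\<lambda>r. 1 * 0 + (- (a i / l i)) * (- l i * exp (- l i * max 0 r)))"
      using l[of i] by auto
    ultimately show ?thesis
      using good_step[OF const[of "a i / l i"] ex[OF less_imp_le[OF l[of i]]], of 1 "- (a i / l i)"] by simp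
  qed
  have sum: "\<exists>B. C1b (\<lambda>r. \<Sum>i\<le>N. a i / l i * (1 - exp (- l i * max 0 r))) (\<lambda>r. \<Sum>i\<le>N. a i * exp (- l i * max 0 r)) B \<and>
      forward_eq s (\<lambda>r. \<Sum>i\<le>N. a i / l i * (1 - exp (- l i * max 0 r))) (\<lambda>r. \<Sum>i\<le>N. a i * exp (- l i * max 0 r))" for N
  proof (induction N)
    case 0
    show ?case using summand[of 0] by simp
  next
    case (Suc N)
    show ?case using good_step[OF Suc summand[of "Suc N"], of 1 1] by simp
  qed
  show ?thesis using good_step[OF const[of c] sum[of N], of 1 1] unfolding l_def by simp
qed

text \<open>Dominated convergence over outcomes, jump sizes and time, with majorants B, 2 B min(1,r)
  g and B \<beta> + 2 B K. The common bound on the derivatives is what controls small jumps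
  uniformly in n.\<close>

lemma forward_eq_limit:
  assumes s: "0 \<le> s" and p: "C1b p p' B0"
    and pn: "\<And>n. \<exists>C. C1b (pn n) (pn' n) C" "\<And>n. forward_eq s (pn n) (pn' n)"
    and B: "\<And>n r. 0 \<le> r \<Longrightarrow> \<bar>pn n r\<bar> \<le> B" "\<And>n r. 0 \<le> r \<Longrightarrow> \<bar>pn' n r\<bar> \<le> B"
    and lim: "\<And>r. 0 \<le> r \<Longrightarrow> (\<lambda>n. pn n r) \<longlonglongrightarrow> p r" "\<And>r. 0 \<le> r \<Longrightarrow> (\<lambda>n. pn' n r) \<longlonglongrightarrow> p' r"
  shows "forward_eq s p p'"
proof -
  have B0: "0 \<le> B" using B(1)[of 0 0] by linarith
  have cont: "continuous_on UNIV (pn n)" "continuous_on UNIV (pn' n)" for n using pn(1)[of n] C1bD by blast+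
  have mean_lim: "(\<lambda>n. mean s (q n) u r) \<longlonglongrightarrow> mean s q0 u r"
    if u: "s \<le> u" "0 \<le> r" and q: "\<And>n. continuous_on UNIV (q n)" "continuous_on UNIV q0"
      "\<And>n r. 0 \<le> r \<Longrightarrow> \<bar>q n r\<bar> \<le> B" "\<And>r. 0 \<le> r \<Longrightarrow> (\<lambda>n. q n r) \<longlonglongrightarrow> q0 r" for q q0 u r
    unfolding mean_def
  proof (rule integral_dominated_convergence[where w="\<lambda>_. B"])
    have m: "(\<lambda>\<omega>. f (Z u \<omega> - Z s \<omega> + r)) \<in> borel_measurable (M 0)" if "continuous_on UNIV f" for f :: "real \<Rightarrow> real"
    proof -
      have "(\<lambda>y. f (y + r)) \<in> borel_measurable borel"
        by (intro borel_measurable_continuous_onI continuous_on_compose2[OF that] continuous_intros) auto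
      from measurable_compose[OF incr_measurable this] s u show ?thesis by auto
    qed
    show "(\<lambda>\<omega>. q0 (Z u \<omega> - Z s \<omega> + r)) \<in> borel_measurable (M 0)" by (rule m[OF q(2)])
    show "(\<lambda>\<omega>. q n (Z u \<omega> - Z s \<omega> + r)) \<in> borel_measurable (M 0)" for n by (rule m[OF q(1)])
    have R: "0 \<le> Z u \<omega> - Z s \<omega> + r" if "\<omega> \<in> space (M 0)" for \<omega> using Z_mono[OF that s u(1)] u(2) by simp
    show "AE \<omega> in M 0. (\<lambda>n. q n (Z u \<omega> - Z s \<omega> + r)) \<longlonglongrightarrow> q0 (Z u \<omega> - Z s \<omega> + r)"
      by (intro AE_I2 q(4) R)
    show "AE \<omega> in M 0. norm (q n (Z u \<omega> - Z s \<omega> + r)) \<le> B" for n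
      using q(3) R by (intro AE_I2) auto
  qed simp
  have mean_b: "\<bar>mean s q u r\<bar> \<le> B" if u: "s \<le> u" "0 \<le> r" and q: "\<And>r. 0 \<le> r \<Longrightarrow> \<bar>q r\<bar> \<le> B" for q u r
  proof -
    have "mean s q u r = mean s (\<lambda>r. q (max 0 r)) u r"
      unfolding mean_def
    proof (intro Bochner_Integration.integral_cong refl)
      fix \<omega> assume "\<omega> \<in> space (M 0)"
      from Z_mono[OF this s u(1)] u(2) show "q (Z u \<omega> - Z s \<omega> + r) = q (max 0 (Z u \<omega> - Z s \<omega> + r))" by simp
    qed
    then show ?thesis using mean_bound[of "\<lambda>r. q (max 0 r)" B] q by simp
  qed
  \<comment> \<open>The \<open>C1b\<close> constant of \<open>pn n\<close> may grow with n and also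
    concerns negative arguments; clamping the argument gives a function with the common constant
    B.\<close>
  have inc_n: "\<bar>mean s (pn n) u r - mean s (pn n) u 0\<bar> \<le> 2 * B * min 1 r" if u: "s \<le> u" "0 \<le> r" for n u r
  proof -
    define h where "h r = pn n (max 0 r)" for r
    define h' where "h' r = pn' n (max 0 r)" for r
    obtain C where C: "C1b (pn n) (pn' n) C" using pn(1) by blast
    have "C1b h h' B" unfolding C1b_def
    proof (intro conjI allI impI)
      show "continuous_on UNIV h" "continuous_on UNIV h'" unfolding h_def h'_def
        by (intro continuous_on_compose2[OF cont(1)] continuous_on_compose2[OF cont(2)] continuous_intros; simp)+
      show "\<bar>h r\<bar> \<le> B" "\<bar>h' r\<bar> \<le> B" for r using B by (auto simp: h_def h'_def)
      show "(h has_real_derivative h' r) (at r within {0..})" if "0 \<le> r" for r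
      proof -
        have "(pn n has_derivative (*) (h' r)) (at r within {0..})"
          using C1bD(6)[OF C that] that by (simp add: h'_def has_field_derivative_def)
        then show ?thesis unfolding has_field_derivative_def
          by (rule has_derivative_transform[rotated 2]) (use that in \<open>auto simp: h_def\<close>)
      qed
    qed
    from mean_increment[OF s u(1) this u(2)] have "\<bar>mean s h u r - mean s h u 0\<bar> \<le> 2 * B * min 1 r" .
    moreover have "mean s h u r = mean s (pn n) u r" if "0 \<le> r" for r
      unfolding mean_def h_def
    proof (intro Bochner_Integration.integral_cong refl)
      fix \<omega> assume "\<omega> \<in> space (M 0)"
      from Z_mono[OF this s u(1)] that show "pn n (max 0 (Z u \<omega> - Z s \<omega> + r)) = pn n (Z u \<omega> - Z s \<omega> + r)" by simp
    qed
    ultimately show ?thesis using u(2) by simp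
  qed
  have J_lim: "(\<lambda>n. J s (pn n) (pn' n) u) \<longlonglongrightarrow> J s p p' u" if u: "s \<le> u" for u
    unfolding J_def
  proof (intro tendsto_add tendsto_mult tendsto_const)
    have u0: "0 \<le> u" using s u by simp
    show "(\<lambda>n. mean s (pn' n) u 0) \<longlonglongrightarrow> mean s p' u 0"
      by (rule mean_lim[OF u order_refl cont(2) C1bD(2)[OF p] B(2) lim(2)])
    show "(\<lambda>n. LINT r:{0<..}|lborel. (mean s (pn n) u r - mean s (pn n) u 0) * g u r)
        \<longlonglongrightarrow> (LINT r:{0<..}|lborel. (mean s p u r - mean s p u 0) * g u r)"
      unfolding set_lebesgue_integral_def
    proof (rule integral_dominated_convergence[where w="\<lambda>r. indicat_real {0<..} r *\<^sub>R (2 * B * (min 1 r * g u r))"])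
      obtain C where C: "\<And>n. C1b (pn n) (pn' n) (C n)" using pn(1) by metis
      show "(\<lambda>r. indicat_real {0<..} r *\<^sub>R ((mean s p u r - mean s p u 0) * g u r)) \<in> borel_measurable lborel"
        using mean_increment_integrable(1)[OF s u p] unfolding set_integrable_def by (rule borel_measurable_integrable)
      show "(\<lambda>r. indicat_real {0<..} r *\<^sub>R ((mean s (pn n) u r - mean s (pn n) u 0) * g u r)) \<in> borel_measurable lborel" for n
        using mean_increment_integrable(1)[OF s u C] unfolding set_integrable_def by (rule borel_measurable_integrable)
      have "set_integrable lborel {0<..} (\<lambda>r. 2 * B * (min 1 r * g u r))"
        by (rule set_integrable_mult_right) (rule g_integrable[OF u0])
      then show "integrable lborel (\<lambda>r. indicat_real {0<..} r *\<^sub>R (2 * B * (min 1 r * g u r)))"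
        by (simp only: set_integrable_def)
      have "(\<lambda>n. mean s (pn n) u r - mean s (pn n) u 0) \<longlonglongrightarrow> mean s p u r - mean s p u 0" if "0 < r" for r
        using that by (intro tendsto_diff mean_lim u cont(1) C1bD(1)[OF p] B(1) lim(1)) auto
      then show "AE r in lborel. (\<lambda>n. indicat_real {0<..} r *\<^sub>R ((mean s (pn n) u r - mean s (pn n) u 0) * g u r))
          \<longlonglongrightarrow> indicat_real {0<..} r *\<^sub>R ((mean s p u r - mean s p u 0) * g u r)"
        by (intro AE_I2) (auto simp: indicator_def intro!: tendsto_mult)
      have "\<bar>(mean s (pn n) u r - mean s (pn n) u 0) * g u r\<bar> \<le> 2 * B * (min 1 r * g u r)" if "0 < r" for n r
        using mult_right_mono[OF inc_n[OF u less_imp_le[OF that], of n] g_nonneg[OF u0 less_imp_le[OF that]]]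
          g_nonneg[OF u0 less_imp_le[OF that]] by (simp add: abs_mult mult.assoc)
      then show "AE r in lborel. norm (indicat_real {0<..} r *\<^sub>R ((mean s (pn n) u r - mean s (pn n) u 0) * g u r))
          \<le> indicat_real {0<..} r *\<^sub>R (2 * B * (min 1 r * g u r))" for n
        by (intro AE_I2) (auto simp: indicator_def)
    qed
  qed
  have J_bound: "\<bar>J s (pn n) (pn' n) u\<bar> \<le> B * \<beta> u + 2 * B * K u" if u: "s \<le> u" for n u
  proof -
    have u0: "0 \<le> u" using s u by simp
    have "\<bar>\<beta> u * mean s (pn' n) u 0\<bar> \<le> B * \<beta> u"
    proof -
      have "\<bar>mean s (pn' n) u 0\<bar> \<le> B" by (rule mean_b[OF u order_refl, of "pn' n"]) (rule B(2))
      from mult_left_mono[OF this \<beta>_nonneg[OF u0]] show ?thesis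
        by (simp add: abs_mult abs_of_nonneg[OF \<beta>_nonneg[OF u0]] mult.commute)
    qed
    moreover have "\<bar>LINT r:{0<..}|lborel. (mean s (pn n) u r - mean s (pn n) u 0) * g u r\<bar> \<le> 2 * B * K u"
    proof (rule g_set_integrable(2)[OF u0])
      show "set_borel_measurable borel {0<..} (\<lambda>r. mean s (pn n) u r - mean s (pn n) u 0)"
        unfolding set_borel_measurable_def
        by (intro borel_measurable_scaleR borel_measurable_diff mean_measurable[OF s u0 cont(1)]) auto
    qed (use inc_n[OF u] in auto)
    ultimately show ?thesis unfolding J_def by linarith
  qed
  show ?thesis unfolding forward_eq_def
  proof (intro allI impI)
    fix a b assume ab: "s \<le> a" "a \<le> b"
    have Jm: "(\<lambda>u. indicat_real {a..b} u *\<^sub>R J s (pn n) (pn' n) u) \<in> borel_measurable lborel" for n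
      using pn(2)[of n] ab unfolding forward_eq_def set_integrable_def by (blast intro: borel_measurable_integrable)
    have w: "integrable lborel (\<lambda>u. indicat_real {a..b} u *\<^sub>R (B * \<beta> u + 2 * B * K u))"
    proof -
      have "set_integrable lborel {a..b} (\<lambda>u. B * \<beta> u + 2 * B * K u)"
        by (intro set_integral_add(1) set_integrable_mult_right impI \<beta>_set_integrable K_set_integrable) (use s ab in auto)
      then show ?thesis by (simp only: set_integrable_def)
    qed
    have l: "(\<lambda>n. indicat_real {a..b} u *\<^sub>R J s (pn n) (pn' n) u) \<longlonglongrightarrow> indicat_real {a..b} u *\<^sub>R J s p p' u" for u
      using J_lim[of u] ab by (auto simp: indicator_def)
    have bd: "norm (indicat_real {a..b} u *\<^sub>R J s (pn n) (pn' n) u) \<le> indicat_real {a..b} u *\<^sub>R (B * \<beta> u + 2 * B * K u)" for n u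
      using J_bound[of u n] ab by (auto simp: indicator_def)
    have lm: "(\<lambda>u. indicat_real {a..b} u *\<^sub>R J s p p' u) \<in> borel_measurable lborel"
      by (rule borel_measurable_LIMSEQ_real[OF l Jm])
    have I: "set_integrable lborel {a..b} (J s p p')"
      unfolding set_integrable_def
      by (rule integrable_dominated_convergence[where s="\<lambda>n u. indicat_real {a..b} u *\<^sub>R J s (pn n) (pn' n) u", OF lm Jm w])
        (use l bd in auto)
    have "(\<lambda>n. LINT u:{a..b}|lborel. J s (pn n) (pn' n) u) \<longlonglongrightarrow> (LINT u:{a..b}|lborel. J s p p' u)"
      unfolding set_lebesgue_integral_def
      by (rule integral_dominated_convergence[OF lm Jm w]) (use l bd in auto)
    moreover have "(LINT u:{a..b}|lborel. J s (pn n) (pn' n) u) = mean s (pn n) b 0 - mean s (pn n) a 0" for n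
      using pn(2)[of n] ab unfolding forward_eq_def by simp
    moreover have "(\<lambda>n. mean s (pn n) b 0 - mean s (pn n) a 0) \<longlonglongrightarrow> mean s p b 0 - mean s p a 0"
      by (intro tendsto_diff mean_lim[OF _ order_refl cont(1) C1bD(1)[OF p] B(1) lim(1)]) (use ab in auto)
    ultimately have "mean s p b 0 - mean s p a 0 = (LINT u:{a..b}|lborel. J s p p' u)"
      using LIMSEQ_unique by auto
    with I show "set_integrable lborel {a..b} (J s p p') \<and> mean s p b 0 - mean s p a 0 = (LINT u:{a..b}|lborel. J s p p' u)"
      by blast
  qed
qed

text \<open>The damping factor exp(-2 eta r) tends to 1 only pointwise in r as eta tends to 0, so
  the approximation is not uniform and the limit is taken with uniform bounds instead.\<close>

lemma forward_eq_C1b: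
  assumes s: "0 \<le> s" and p: "C1b p p' B"
  shows "forward_eq s p p'"
proof -
  define \<eta> where "\<eta> n = inverse (real (Suc n))" for n
  have \<eta>: "0 < \<eta> n" "\<eta> n \<le> 1" for n by (auto simp: \<eta>_def inverse_le_1_iff)
  have \<eta>0: "\<eta> \<longlonglongrightarrow> 0" unfolding \<eta>_def by (rule LIMSEQ_inverse_real_of_nat)
  define approx where "approx n a N \<longleftrightarrow> (\<forall>r\<ge>0.
      \<bar>p 0 + (\<Sum>i\<le>N. a i / (real (Suc i) * \<eta> n) * (1 - exp (- (real (Suc i) * \<eta> n) * r))) - exp (- 2 * \<eta> n * r) * p r\<bar> \<le> \<eta> n \<and>
      \<bar>(\<Sum>i\<le>N. a i * exp (- (real (Suc i) * \<eta> n) * r)) - exp (- 2 * \<eta> n * r) * (p' r - 2 * \<eta> n * p r)\<bar> \<le> \<eta> n)"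
    for n and a :: "nat \<Rightarrow> real" and N :: nat
  have "\<exists>a N. approx n a N" for n
  proof -
    \<comment> \<open>With \<delta> the square of \<eta>, both errors of
      \<open>exponential_sum_approx\<close>, \<delta>/\<eta> and \<delta>, are at most
      \<eta>.\<close>
    have \<delta>: "0 < \<eta> n * \<eta> n" using \<eta> by simp
    have 1: "\<eta> n * \<eta> n / \<eta> n = \<eta> n" and 2: "\<eta> n * \<eta> n \<le> \<eta> n" using \<eta>[of n] by (auto simp: mult_left_le)
    show ?thesis
    proof (rule exponential_sum_approx[OF p \<eta>(1)[of n] \<delta>], unfold 1)
      fix a :: "nat \<Rightarrow> real" and N
      assume "\<And>r. 0 \<le> r \<Longrightarrow> \<bar>p 0 + (\<Sum>i\<le>N. a i / (real (Suc i) * \<eta> n) * (1 - exp (- (real (Suc i) * \<eta> n) * r))) - exp (- 2 * \<eta> n * r) * p r\<bar> \<le> \<eta> n"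
        and "\<And>r. 0 \<le> r \<Longrightarrow> \<bar>(\<Sum>i\<le>N. a i * exp (- (real (Suc i) * \<eta> n) * r)) - exp (- 2 * \<eta> n * r) * (p' r - 2 * \<eta> n * p r)\<bar> \<le> \<eta> n * \<eta> n"
      then have "approx n a N" unfolding approx_def using order_trans[OF _ 2] by blast
      then show ?thesis by blast
    qed
  qed
  then obtain a N where "\<And>n. approx n (a n) (N n)" by metis
  then have aN:
    "\<bar>p 0 + (\<Sum>i\<le>N n. a n i / (real (Suc i) * \<eta> n) * (1 - exp (- (real (Suc i) * \<eta> n) * r))) - exp (- 2 * \<eta> n * r) * p r\<bar> \<le> \<eta> n"
    "\<bar>(\<Sum>i\<le>N n. a n i * exp (- (real (Suc i) * \<eta> n) * r)) - exp (- 2 * \<eta> n * r) * (p' r - 2 * \<eta> n * p r)\<bar> \<le> \<eta> n"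
    if "0 \<le> r" for n r
    using that unfolding approx_def by blast+
  define pn where "pn n r = p 0 + (\<Sum>i\<le>N n. a n i / (real (Suc i) * \<eta> n) * (1 - exp (- (real (Suc i) * \<eta> n) * max 0 r)))" for n r
  define pn' where "pn' n r = (\<Sum>i\<le>N n. a n i * exp (- (real (Suc i) * \<eta> n) * max 0 r))" for n r
  have good: "\<exists>C. C1b (pn n) (pn' n) C \<and> forward_eq s (pn n) (pn' n)" for n
    unfolding pn_def pn'_def by (rule forward_eq_exponential_sum[OF s \<eta>(1)])
  have d: "\<bar>pn n r - exp (- 2 * \<eta> n * r) * p r\<bar> \<le> \<eta> n" "\<bar>pn' n r - exp (- 2 * \<eta> n * r) * (p' r - 2 * \<eta> n * p r)\<bar> \<le> \<eta> n"
    if "0 \<le> r" for n r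
    using aN[OF that, of n] that by (simp_all add: pn_def pn'_def max_absorb2)
  have B0: "0 \<le> B" by (rule C1bD(5)[OF p])
  have e1: "0 \<le> exp (- 2 * \<eta> n * r)" "exp (- 2 * \<eta> n * r) \<le> 1" if "0 \<le> r" for n r
    using \<eta>(1)[of n] that by auto
  show ?thesis
  \<comment> \<open>|p'| + 2 \<eta> |p| is at most 3 B because \<eta> <= 1, and the approximation
    error adds at most 1.\<close>
  proof (rule forward_eq_limit[OF s p, of pn pn' "3 * B + 1"])
    show "\<exists>C. C1b (pn n) (pn' n) C" "forward_eq s (pn n) (pn' n)" for n using good[of n] by blast+
    have damp: "\<bar>exp (- 2 * \<eta> n * r) * y\<bar> \<le> \<bar>y\<bar>" if "0 \<le> r" for n r y
      using mult_right_mono[OF e1(2)[OF that, of n] abs_ge_zero[of y]] by (simp add: abs_mult)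
    show "\<bar>pn n r\<bar> \<le> 3 * B + 1" if "0 \<le> r" for n r
      using d(1)[OF that, of n] damp[OF that, of n "p r"] C1bD(3)[OF p, of r] \<eta>(2)[of n] B0 by linarith
    show "\<bar>pn' n r\<bar> \<le> 3 * B + 1" if "0 \<le> r" for n r
    proof -
      have "\<bar>2 * \<eta> n * p r\<bar> \<le> 2 * (1 * B)"
        using mult_mono[of "\<eta> n" 1 "\<bar>p r\<bar>" B] \<eta>[of n] C1bD(3)[OF p, of r] by (simp add: abs_mult)
      then have "\<bar>p' r - 2 * \<eta> n * p r\<bar> \<le> 3 * B" using C1bD(4)[OF p, of r] by linarith
      with d(2)[OF that, of n] damp[OF that, of n "p' r - 2 * \<eta> n * p r"] \<eta>(2)[of n] show ?thesis by linarith
    qed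
    have E: "(\<lambda>n. exp (- 2 * \<eta> n * r)) \<longlonglongrightarrow> 1" for r
      using tendsto_exp[OF tendsto_mult_right[OF tendsto_mult_left[OF \<eta>0, of "- 2"], of r]] by simp
    have conv: "x \<longlonglongrightarrow> l" if "y \<longlonglongrightarrow> l" "\<And>n. \<bar>x n - y n\<bar> \<le> \<eta> n" for x y :: "nat \<Rightarrow> real" and l
    proof -
      have "(\<lambda>n. x n - y n) \<longlonglongrightarrow> 0"
        by (rule Lim_null_comparison[OF _ \<eta>0]) (use that(2) in auto)
      from tendsto_add[OF this that(1)] show ?thesis by simp
    qed
    show "(\<lambda>n. pn n r) \<longlonglongrightarrow> p r" if "0 \<le> r" for r
      using tendsto_mult_right[OF E, of r "p r"] by (intro conv[OF _ d(1)[OF that]]) simp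
    have "(\<lambda>n. exp (- 2 * \<eta> n * r) * (p' r - 2 * \<eta> n * p r)) \<longlonglongrightarrow> 1 * (p' r - 2 * 0 * p r)" for r
      by (intro tendsto_mult E tendsto_diff tendsto_const \<eta>0)
    then show "(\<lambda>n. pn' n r) \<longlonglongrightarrow> p' r" if "0 \<le> r" for r
      by (intro conv[OF _ d(2)[OF that]]) simp
  qed
qed

section \<open>The forward equation along orbits of the semigroup\<close>

lemma continuous_P_max: "v \<in> C0 UNIV \<Longrightarrow> continuous_on UNIV (\<lambda>r. P (max 0 r) v x)"
  by (rule continuous_on_compose2[OF P_continuous_time]) (auto intro!: continuous_intros)

lemma C1b_P:
  assumes vw: "generator_graph UNIV P v w" and B: "\<And>y. \<bar>v y\<bar> \<le> B" "\<And>y. \<bar>w y\<bar> \<le> B"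
  shows "C1b (\<lambda>r. P (max 0 r) v x) (\<lambda>r. P (max 0 r) w x) B"
  unfolding C1b_def
proof (intro conjI allI impI)
  have v: "v \<in> C0 UNIV" and w: "w \<in> C0 UNIV" using vw by (auto simp: generator_graph_def)
  show "continuous_on UNIV (\<lambda>r. P (max 0 r) v x)" "continuous_on UNIV (\<lambda>r. P (max 0 r) w x)"
    by (intro continuous_P_max v w)+
  show "\<bar>P (max 0 r) v x\<bar> \<le> B" "\<bar>P (max 0 r) w x\<bar> \<le> B" for r
    by (auto intro: P_bound v w B)
  show "((\<lambda>r. P (max 0 r) v x) has_real_derivative P (max 0 r) w x) (at r within {0..})" if "0 \<le> r" for r
  proof -
    have "((\<lambda>r. P r v x) has_derivative (*) (P (max 0 r) w x)) (at r within {0..})"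
      using P_deriv[OF vw that, of x] that by (simp add: has_field_derivative_def max_absorb2)
    then show ?thesis unfolding has_field_derivative_def
      by (rule has_derivative_transform[rotated 2]) (use that in auto)
  qed
qed

lemma generator_graph_boundE:
  assumes vw: "generator_graph UNIV P v w"
  obtains B where "\<And>y. \<bar>v y\<bar> \<le> B" "\<And>y. \<bar>w y\<bar> \<le> B"
proof -
  have v: "v \<in> C0 UNIV" and w: "w \<in> C0 UNIV" using vw by (auto simp: generator_graph_def)
  obtain B1 where B1: "\<And>y. \<bar>v y\<bar> \<le> B1" by (rule C0_boundE[OF v]) blast
  obtain B2 where B2: "\<And>y. \<bar>w y\<bar> \<le> B2" by (rule C0_boundE[OF w]) blast
  show ?thesis by (rule that[of "max B1 B2"]) (use B1 B2 in \<open>auto simp: le_max_iff_disj\<close>)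
qed

lemma mean_P:
  assumes s: "0 \<le> s" "s \<le> u" and r: "0 \<le> r" and v: "v \<in> C0 UNIV"
  shows "mean s (\<lambda>r. P (max 0 r) v x) u r = U s u (P r v) x"
  unfolding U_P[OF s r v] mean_def
proof (rule Bochner_Integration.integral_cong[OF refl])
  fix \<omega> assume "\<omega> \<in> space (M 0)"
  from Z_mono[OF this s] r show "P (max 0 (Z u \<omega> - Z s \<omega> + r)) v x = P (Z u \<omega> - Z s \<omega> + r) v x" by simp
qed

lemma U_jump_measurable:
  assumes s: "0 \<le> s" "s \<le> u" and v: "v \<in> C0 UNIV"
  shows "set_borel_measurable borel {0<..} (\<lambda>r. U s u (P r v) x - U s u v x)"
proof -
  have "(\<lambda>r. indicat_real {0<..} r *\<^sub>R (mean s (\<lambda>r. P (max 0 r) v x) u r - U s u v x)) \<in> borel_measurable borel"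
    using s by (intro borel_measurable_scaleR borel_measurable_diff mean_measurable continuous_P_max v) auto
  moreover have "indicat_real {0<..} r *\<^sub>R (mean s (\<lambda>r. P (max 0 r) v x) u r - U s u v x) =
      indicat_real {0<..} r *\<^sub>R (U s u (P r v) x - U s u v x)" for r
    by (auto simp: indicator_def mean_P[OF s _ v])
  ultimately show ?thesis by (simp only: set_borel_measurable_def)
qed

lemma U_jump_eq_mean:
  assumes s: "0 \<le> s" "s \<le> u" and v: "v \<in> C0 UNIV"
  shows "indicat_real {0<..} r *\<^sub>R ((mean s (\<lambda>r. P (max 0 r) v x) u r - mean s (\<lambda>r. P (max 0 r) v x) u 0) * g u r) =
    indicat_real {0<..} r *\<^sub>R ((U s u (P r v) x - U s u v x) * g u r)"
  by (auto simp: indicator_def mean_P[OF s _ v] P_0[OF v])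

lemma U_jump_integrable:
  assumes s: "0 \<le> s" "s \<le> u" and vw: "generator_graph UNIV P v w"
  shows "set_integrable lborel {0<..} (\<lambda>r. (U s u (P r v) x - U s u v x) * g u r)"
proof -
  have v: "v \<in> C0 UNIV" using vw by (auto simp: generator_graph_def)
  obtain B where B: "\<And>y. \<bar>v y\<bar> \<le> B" "\<And>y. \<bar>w y\<bar> \<le> B" by (rule generator_graph_boundE[OF vw]) blast
  from mean_increment_integrable(1)[OF s C1b_P[OF vw B, of x]]
  show ?thesis by (simp only: set_integrable_def U_jump_eq_mean[OF s v])
qed

text \<open>The forward equation for r -> P_r v(x) with x and v fixed; the time dependence of f is
  left to \<open>Q_dynkin\<close>.\<close>

lemma U_forward_equation:
  fixes x :: 'b
  assumes s: "0 \<le> s" "s \<le> a" "a \<le> b" and vw: "generator_graph UNIV P v w"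
  defines "\<Theta> \<equiv> \<lambda>u. \<beta> u * U s u w x + (LINT r:{0<..}|lborel. (U s u (P r v) x - U s u v x) * g u r)"
  shows "set_integrable lborel {a..b} \<Theta>" "U s b v x - U s a v x = (LINT u:{a..b}|lborel. \<Theta> u)"
proof -
  have v: "v \<in> C0 UNIV" and w: "w \<in> C0 UNIV" using vw by (auto simp: generator_graph_def)
  define p where "p = (\<lambda>r. P (max 0 r) v x)"
  define p' where "p' = (\<lambda>r. P (max 0 r) w x)"
  obtain B where B: "\<And>y. \<bar>v y\<bar> \<le> B" "\<And>y. \<bar>w y\<bar> \<le> B" by (rule generator_graph_boundE[OF vw]) blast
  have F: "forward_eq s p p'"
    unfolding p_def p'_def by (rule forward_eq_C1b[OF s(1) C1b_P[OF vw B]])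
  have m: "mean s p u 0 = U s u v x" "mean s p' u 0 = U s u w x" if u: "s \<le> u" for u
    using mean_P[OF s(1) u order_refl v] mean_P[OF s(1) u order_refl w]
    by (simp_all add: p_def p'_def P_0 v w)
  have J: "J s p p' u = \<Theta> u" if u: "s \<le> u" for u
    unfolding J_def \<Theta>_def m(2)[OF u] set_lebesgue_integral_def
    by (simp only: p_def U_jump_eq_mean[OF s(1) u v])
  have eq: "indicat_real {a..b} u *\<^sub>R J s p p' u = indicat_real {a..b} u *\<^sub>R \<Theta> u" for u
    using J[of u] s by (auto simp: indicator_def)
  have F': "set_integrable lborel {a..b} (J s p p')" "mean s p b 0 - mean s p a 0 = (LINT u:{a..b}|lborel. J s p p' u)"
    using F s unfolding forward_eq_def by auto
  show "set_integrable lborel {a..b} \<Theta>" using F'(1) unfolding set_integrable_def eq .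
  show "U s b v x - U s a v x = (LINT u:{a..b}|lborel. \<Theta> u)"
    using F'(2) m(1)[of a] m(1)[of b] s unfolding set_lebesgue_integral_def eq by simp
qed

end

section \<open>The generator\<close>

context subordinated_feller
begin

text \<open>Measures the cost of replacing one function of the domain by another. Contraction gives
  2 e, and the mean value theorem in r, with derivative P_r (w1 - w2), gives e r; combined they
  carry the weight min(1,r) again.\<close>

lemma P_increment_diff_bound:
  assumes vw: "generator_graph UNIV P v1 w1" "generator_graph UNIV P v2 w2" and r: "0 \<le> r"
    and e: "\<And>y. \<bar>v1 y - v2 y\<bar> \<le> e" "\<And>y. \<bar>w1 y - w2 y\<bar> \<le> e"
  shows "\<bar>(P r v1 x - v1 x) - (P r v2 x - v2 x)\<bar> \<le> 2 * e * min 1 r"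
proof (cases "r = 0")
  case True
  then show ?thesis using vw by (simp add: P_0 generator_graph_def)
next
  case False
  have C: "v1 \<in> C0 UNIV" "v2 \<in> C0 UNIV" "w1 \<in> C0 UNIV" "w2 \<in> C0 UNIV" using vw by (auto simp: generator_graph_def)
  have e0: "0 \<le> e" using e(1)[of undefined] by linarith
  have "\<bar>P r (\<lambda>y. v1 y - v2 y) x\<bar> \<le> e" by (rule P_bound[OF r C0_diff[OF closed_UNIV C(1,2)] e(1)])
  then have 1: "\<bar>(P r v1 x - v1 x) - (P r v2 x - v2 x)\<bar> \<le> 2 * e"
    using e(1)[of x] P_diff[OF r C(1,2)] by simp
  obtain z where z: "0 < z" "P r v1 x - P r v2 x - (P 0 v1 x - P 0 v2 x) = (P z w1 x - P z w2 x) * (r - 0)"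
    by (rule half_line_mvt[of 0 r "\<lambda>r. P r v1 x - P r v2 x" "\<lambda>r. P r w1 x - P r w2 x"])
      (use r False in \<open>auto intro!: DERIV_diff P_deriv vw\<close>)
  have "\<bar>P z (\<lambda>y. w1 y - w2 y) x\<bar> \<le> e" by (rule P_bound[OF _ C0_diff[OF closed_UNIV C(3,4)] e(2)]) (use z in simp)
  then have "\<bar>P z w1 x - P z w2 x\<bar> \<le> e" using P_diff[OF less_imp_le[OF z(1)] C(3,4)] by simp
  then have "\<bar>(P z w1 x - P z w2 x) * (r - 0)\<bar> \<le> e * r"
    using r by (auto simp: abs_mult intro!: mult_right_mono)
  then have 2: "\<bar>(P r v1 x - v1 x) - (P r v2 x - v2 x)\<bar> \<le> e * r"
    using z(2) by (simp add: P_0 C algebra_simps)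
  have "0 \<le> e * r" using e0 r by simp
  with 1 2 show ?thesis by (auto simp: min_def)
qed

lemma P_increment_bound:
  assumes vw: "generator_graph UNIV P v w" and r: "0 \<le> r" and B: "\<And>y. \<bar>v y\<bar> \<le> B" "\<And>y. \<bar>w y\<bar> \<le> B"
  shows "\<bar>P r v x - v x\<bar> \<le> 2 * B * min 1 r"
  using C1b_increment[OF C1b_P[OF vw B, of x] order_refl r] vw r by (simp add: generator_graph_def P_0)

text \<open>Writing U as an expectation of X at a random time turns the claim into an exchange of
  expectation and jump integral, whose absolute version is bounded by 2 B K t. This representation
  is available because the jump integral itself lies in \<open>C0\<close>.\<close>

lemma U_jump_integral:
  assumes s: "0 \<le> s" "s \<le> t" and vw: "generator_graph UNIV P v w"
    and I: "(\<lambda>y. LINT r:{0<..}|lborel. (P r v y - v y) * g t r) \<in> C0 UNIV"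
  shows "U s t (\<lambda>y. LINT r:{0<..}|lborel. (P r v y - v y) * g t r) x =
    (LINT r:{0<..}|lborel. (U s t (P r v) x - U s t v x) * g t r)"
proof -
  have v: "v \<in> C0 UNIV" and w: "w \<in> C0 UNIV" using vw by (auto simp: generator_graph_def)
  have t: "0 \<le> t" using s by simp
  obtain B where B: "\<And>y. \<bar>v y\<bar> \<le> B" "\<And>y. \<bar>w y\<bar> \<le> B" by (rule generator_graph_boundE[OF vw]) blast
  define Y where "Y \<omega> = X (Z t \<omega> - Z s \<omega>) \<omega>" for \<omega>
  have Ym: "Y \<in> borel_measurable (M x)"
    unfolding Y_def[abs_def] by (rule tc.X_random_time_measurable[OF incr_measurable]) (use s Z_mono in auto)
  interpret pair_sigma_finite "M x" lborel
    by (intro pair_sigma_finite.intro sigma_finite_lborel tc.sigma_finite_measure_axioms)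
  define F where "F \<omega> r = indicat_real {0<..} r * ((P r v (Y \<omega>) - v (Y \<omega>)) * g t r)" for \<omega> r
  \<comment> \<open>Clamping the time and cutting off g leave the values unchanged but make joint
    measurability visible.\<close>
  have F_eq: "(\<lambda>z. F (fst z) (snd z)) = (\<lambda>z. indicat_real {0<..} (snd z) *
      ((P (max 0 (snd z)) v (Y (fst z)) - v (Y (fst z))) * (indicat_real ({0..} \<times> {0..}) (t, snd z) * g t (snd z))))"
    using t by (auto simp: F_def fun_eq_iff indicator_def)
  have gm: "(\<lambda>r. indicat_real ({0..} \<times> {0..}) (t, r) * g t r) \<in> borel_measurable borel"
    using measurable_compose[OF measurable_Pair1'[of t borel borel] g_measurable] by simp
  have sndm: "snd \<in> M x \<Otimes>\<^sub>M lborel \<rightarrow>\<^sub>M (borel :: real measure)"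
    using measurable_snd[of "M x" "lborel :: real measure"] by simp
  have Fm: "(\<lambda>(\<omega>, r). F \<omega> r) \<in> borel_measurable (M x \<Otimes>\<^sub>M lborel)"
    unfolding case_prod_unfold F_eq
    by (intro borel_measurable_times borel_measurable_diff P_measurable[OF v sndm measurable_compose[OF measurable_fst Ym]]
        measurable_compose[OF sndm gm] tc.C0_comp_measurable[OF v measurable_compose[OF measurable_fst Ym]]
        measurable_compose[OF sndm borel_measurable_indicator]) auto
  have G: "set_integrable lborel {0<..} (\<lambda>r. (P r v y - v y) * g t r)"
      "\<bar>LINT r:{0<..}|lborel. \<bar>P r v y - v y\<bar> * g t r\<bar> \<le> 2 * B * K t" for y
  proof -
    have m: "set_borel_measurable borel {0<..} (\<lambda>r. P r v y - v y)"
    proof -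
      have "(\<lambda>r. indicat_real {0<..} r *\<^sub>R (P (max 0 r) v y - v y)) \<in> borel_measurable borel"
        by (intro borel_measurable_scaleR borel_measurable_diff P_measurable[OF v]) auto
      also have "(\<lambda>r. indicat_real {0<..} r *\<^sub>R (P (max 0 r) v y - v y)) = (\<lambda>r. indicat_real {0<..} r *\<^sub>R (P r v y - v y))"
        by (auto simp: indicator_def fun_eq_iff)
      finally show ?thesis by (simp add: set_borel_measurable_def)
    qed
    show "set_integrable lborel {0<..} (\<lambda>r. (P r v y - v y) * g t r)"
      by (rule g_set_integrable(1)[OF t m P_increment_bound[OF vw _ B]]) simp
    show "\<bar>LINT r:{0<..}|lborel. \<bar>P r v y - v y\<bar> * g t r\<bar> \<le> 2 * B * K t"
    proof (rule g_set_integrable(2)[OF t])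
      have "(\<lambda>r. \<bar>indicat_real {0<..} r *\<^sub>R (P r v y - v y)\<bar>) \<in> borel_measurable borel"
        using m unfolding set_borel_measurable_def by (rule borel_measurable_abs)
      then show "set_borel_measurable borel {0<..} (\<lambda>r. \<bar>P r v y - v y\<bar>)"
        by (simp add: set_borel_measurable_def abs_mult)
      show "\<bar>\<bar>P r v y - v y\<bar>\<bar> \<le> 2 * B * min 1 r" if "0 < r" for r
        using P_increment_bound[OF vw less_imp_le[OF that] B] by simp
    qed
  qed
  have F_int: "integrable lborel (F \<omega>)" for \<omega>
    using G(1)[of "Y \<omega>"] by (simp add: F_def[abs_def] set_integrable_def)
  have int: "integrable (M x \<Otimes>\<^sub>M lborel) (\<lambda>(\<omega>, r). F \<omega> r)"
  proof (rule Fubini_integrable[OF Fm])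
    show "AE \<omega> in M x. integrable lborel (\<lambda>r. case (\<omega>, r) of (\<omega>, r) \<Rightarrow> F \<omega> r)"
      using F_int by (intro AE_I2) simp
    have "(LINT r|lborel. norm (F \<omega> r)) = (LINT r:{0<..}|lborel. \<bar>P r v (Y \<omega>) - v (Y \<omega>)\<bar> * g t r)" for \<omega>
      unfolding set_lebesgue_integral_def F_def
      by (intro Bochner_Integration.integral_cong refl) (use g_nonneg[OF t] in \<open>auto simp: indicator_def abs_mult\<close>)
    then have b: "\<bar>LINT r|lborel. norm (F \<omega> r)\<bar> \<le> 2 * B * K t" for \<omega> using G(2)[of "Y \<omega>"] by simp
    have "(\<lambda>(\<omega>, r). norm (F \<omega> r)) \<in> borel_measurable (M x \<Otimes>\<^sub>M lborel)"
      using measurable_compose[OF Fm borel_measurable_norm] by (simp add: case_prod_unfold)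
    from lborel.borel_measurable_lebesgue_integral[OF this]
    have m: "(\<lambda>\<omega>. LINT r|lborel. norm (F \<omega> r)) \<in> borel_measurable (M x)" .
    show "integrable (M x) (\<lambda>\<omega>. LINT r|lborel. norm (case (\<omega>, r) of (\<omega>, r) \<Rightarrow> F \<omega> r))"
      by (rule tc.integrable_const_bound[where B="2 * B * K t"]) (use b m in auto)
  qed
  have "U s t (\<lambda>y. LINT r:{0<..}|lborel. (P r v y - v y) * g t r) x = (LINT \<omega>|M x. LINT r|lborel. F \<omega> r)"
    using expectation_X_increment[OF s I, of x] unfolding F_def Y_def set_lebesgue_integral_def by simp
  also have "\<dots> = (LINT r|lborel. LINT \<omega>|M x. F \<omega> r)" by (rule Fubini_integral[OF int, symmetric])
  also have "\<dots> = (LINT r:{0<..}|lborel. (U s t (P r v) x - U s t v x) * g t r)"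
    unfolding set_lebesgue_integral_def
  proof (rule Bochner_Integration.integral_cong[OF refl])
    fix r :: real
    show "(LINT \<omega>|M x. F \<omega> r) = indicat_real {0<..} r *\<^sub>R ((U s t (P r v) x - U s t v x) * g t r)"
    proof (cases "0 < r")
      case True
      then have r: "0 \<le> r" by simp
      have Pr: "P r v \<in> C0 UNIV" by (rule P_C0[OF r v])
      have i: "integrable (M x) (\<lambda>\<omega>. P r v (Y \<omega>))" "integrable (M x) (\<lambda>\<omega>. v (Y \<omega>))"
        using tc.C0_comp_measurable[OF Pr Ym] tc.C0_comp_measurable[OF v Ym] P_bound[OF r v B(1)] B(1)
        by (auto intro!: tc.integrable_const_bound[where B=B])
      have "(LINT \<omega>|M x. F \<omega> r) = (LINT \<omega>|M x. (P r v (Y \<omega>) - v (Y \<omega>)) * g t r)"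
        using True by (simp add: F_def)
      also have "\<dots> = ((LINT \<omega>|M x. P r v (Y \<omega>)) - (LINT \<omega>|M x. v (Y \<omega>))) * g t r"
        using i by simp
      also have "\<dots> = (U s t (P r v) x - U s t v x) * g t r"
        unfolding Y_def expectation_X_increment[OF s Pr] expectation_X_increment[OF s v] ..
      finally show ?thesis using True by simp
    qed (simp add: F_def)
  qed
  finally show ?thesis .
qed

lemma generator_graph_generator:
  assumes "f \<in> generator_dom UNIV P"
  shows "generator_graph UNIV P f (generator UNIV P f)"
proof -
  obtain h where h: "generator_graph UNIV P f h" using assms by (auto simp: generator_dom_def)
  have "generator UNIV P f = h"
    by (rule generator_eqI[OF closed_UNIV _ _ h]) (use h in \<open>auto simp: generator_graph_def intro: P_C0\<close>)
  with h show ?thesis by simp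
qed

text \<open>Over [c,c'] the increment of U_(s,u) f_u splits into U_(s,c') (f_c' - f_c), which the
  time derivative governs, and (U_(s,c') - U_(s,c)) f_c, to which the forward equation applies with
  the slice frozen at c. Passing from frozen to moving quantities costs at most e times the
  increment of \<open>k\<close>, so \<open>D\<close> is constant.\<close>

lemma Q_dynkin:
  assumes f: "f \<in> C0 time_space" and dom: "\<And>s. 0 \<le> s \<Longrightarrow> (\<lambda>y. f (s, y)) \<in> generator_dom UNIV P"
    and Lf: "zero_ext time_space (\<lambda>(s, x). generator UNIV P (\<lambda>y. f (s, y)) x) \<in> C0 time_space"
    and deriv: "\<And>s x. 0 \<le> s \<Longrightarrow> ((\<lambda>u. f (u, x)) has_real_derivative f' (s, x)) (at s within {0..})"
    and f': "f' \<in> C0 time_space"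
    and H: "DY_generator_formula M X \<beta> g f f' \<in> C0 time_space"
    and s: "0 \<le> s" and t: "0 \<le> t"
  shows "Q t f (s, x) - f (s, x) = (LINT u:{0..t}|lborel. Q u (DY_generator_formula M X \<beta> g f f') (s, x))"
proof -
  define h where "h = DY_generator_formula M X \<beta> g f f'"
  define L where "L = zero_ext time_space (\<lambda>(s, x). generator UNIV P (\<lambda>y. f (s, y)) x)"
  have hC: "h \<in> C0 time_space" and LC: "L \<in> C0 time_space" using H Lf by (simp_all add: h_def L_def)
  note sl = C0_time_slice
  have graph: "generator_graph UNIV P (\<lambda>y. f (u, y)) (\<lambda>y. L (u, y))" if "0 \<le> u" for u
    using generator_graph_generator[OF dom[OF that]] that by (simp add: L_def zero_ext_def)
  let ?jump = "\<lambda>u y. LINT r:{0<..}|lborel. (P r (\<lambda>y. f (u, y)) y - f (u, y)) * g u r"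
  let ?Ujump = "\<lambda>w v. LINT r:{0<..}|lborel. (U s w (P r v) x - U s w v x) * g w r"
  have h_eq: "h (u, y) = f' (u, y) + \<beta> u * L (u, y) + ?jump u y" if "0 \<le> u" for u y
    using that by (simp add: h_def DY_generator_formula_def L_def zero_ext_def)
  define \<theta> where "\<theta> w = U s w (\<lambda>y. h (w, y)) x" for w
  define \<theta>1 where "\<theta>1 w = U s w (\<lambda>y. f' (w, y)) x" for w
  define \<theta>2 where "\<theta>2 w = \<beta> w * U s w (\<lambda>y. L (w, y)) x + ?Ujump w (\<lambda>y. f (w, y))" for w
  \<comment> \<open>The jump integral is \<open>h\<close> minus two other terms whose slices lie in
    \<open>C0\<close>; this is how membership of the generator formula in \<open>C0\<close> makes
    \<open>U_jump_integral\<close> applicable.\<close>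
  have \<theta>_split: "\<theta> w = \<theta>1 w + \<theta>2 w" if w: "s \<le> w" for w
  proof -
    have w0: "0 \<le> w" using s w by simp
    have f'L: "(\<lambda>y. 1 * f' (w, y) + \<beta> w * L (w, y)) \<in> C0 UNIV"
      by (rule C0_lincomb[OF closed_UNIV sl[OF f' w0] sl[OF LC w0]])
    have jump_eq: "?jump w = (\<lambda>y. h (w, y) - (1 * f' (w, y) + \<beta> w * L (w, y)))"
      using h_eq[OF w0] by (auto simp: fun_eq_iff)
    have jump_C0: "?jump w \<in> C0 UNIV" unfolding jump_eq by (rule C0_diff[OF closed_UNIV sl[OF hC w0] f'L])
    have "?Ujump w (\<lambda>y. f (w, y)) = U s w (?jump w) x"
      by (rule U_jump_integral[OF s w graph[OF w0] jump_C0, symmetric])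
    also have "\<dots> = \<theta> w - (1 * \<theta>1 w + \<beta> w * U s w (\<lambda>y. L (w, y)) x)"
      unfolding jump_eq U_diff[OF s w sl[OF hC w0] f'L] U_lincomb[OF s w sl[OF f' w0] sl[OF LC w0]] \<theta>_def \<theta>1_def ..
    finally show ?thesis by (simp add: \<theta>2_def)
  qed
  have Q_cont: "set_integrable lborel {a..b} (\<lambda>w. U s w (\<lambda>y. k (w, y)) x)" if k: "k \<in> C0 time_space" and a: "s \<le> a" for k a b
  proof (rule set_integrable_continuous_Icc)
    have "continuous_on {a..b} (\<lambda>w. Q (w - s) k (s, x))"
      by (rule continuous_on_compose2[OF Q.P_continuous_time[OF k]]) (use a in \<open>auto intro!: continuous_intros\<close>)
    moreover have "Q (w - s) k (s, x) = U s w (\<lambda>y. k (w, y)) x" if "w \<in> {a..b}" for w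
      using Q_eq[OF s _ k, of "w - s" x] that a by simp
    ultimately show "continuous_on {a..b} (\<lambda>w. U s w (\<lambda>y. k (w, y)) x)"
      using continuous_on_cong[OF refl, of "{a..b}" "\<lambda>w. Q (w - s) k (s, x)" "\<lambda>w. U s w (\<lambda>y. k (w, y)) x"] by simp
  qed
  have \<theta>_int: "set_integrable lborel {a..b} \<theta>" and \<theta>1_int: "set_integrable lborel {a..b} \<theta>1" if "s \<le> a" for a b
    unfolding \<theta>_def[abs_def] \<theta>1_def[abs_def] by (intro Q_cont hC f' that)+
  \<comment> \<open>Obtained from the difference of the continuous functions \<open>\<theta>\<close>
    and \<open>\<theta>1\<close>; the jump term has no evident regularity in time of its
    own.\<close>
  have \<theta>2_int: "set_integrable lborel {a..b} \<theta>2" if "s \<le> a" for a b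
  proof -
    have "indicat_real {a..b} w *\<^sub>R (\<theta> w - \<theta>1 w) = indicat_real {a..b} w *\<^sub>R \<theta>2 w" for w
      using \<theta>_split[of w] that by (auto simp: indicator_def)
    then show ?thesis
      using set_integral_diff(1)[OF \<theta>_int[OF that] \<theta>1_int[OF that], of b] by (simp only: set_integrable_def)
  qed
  have \<kappa>_int: "set_integrable lborel {a..b} (\<lambda>w. \<beta> w + 2 * K w)" if "s \<le> a" for a b
    by (intro set_integral_add(1) set_integrable_mult_right impI \<beta>_set_integrable K_set_integrable) (use that s in auto)
  define b where "b = s + t"
  have sb: "s \<le> b" using t by (simp add: b_def)
  define D where "D u = U s u (\<lambda>y. f (u, y)) x - (LINT w:{s..u}|lborel. \<theta> w)" for u
  \<comment> \<open>The 3 collects one e from the mean value theorem and two from comparing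
    \<open>q\<close> with \<open>\<theta>1\<close>; \<beta> and 2 K weigh the errors in the drift
    and in the jumps.\<close>
  define k where "k u = 3 * u + (LINT w:{s..u}|lborel. \<beta> w + 2 * K w)" for u
  have "D b = D s"
  proof (rule eq_if_increments_small[OF sb, where k=k])
    fix z e :: real assume z: "s \<le> z" "z \<le> b" and e: "0 < e"
    obtain d1 where d1: "d1 > 0" "\<And>c c' y. 0 \<le> c \<Longrightarrow> 0 \<le> c' \<Longrightarrow> \<bar>c - c'\<bar> < d1 \<Longrightarrow> \<bar>f (c, y) - f (c', y)\<bar> \<le> e"
      by (rule C0_time_uniform[OF f e]) blast
    obtain d2 where d2: "d2 > 0" "\<And>c c' y. 0 \<le> c \<Longrightarrow> 0 \<le> c' \<Longrightarrow> \<bar>c - c'\<bar> < d2 \<Longrightarrow> \<bar>L (c, y) - L (c', y)\<bar> \<le> e"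
      by (rule C0_time_uniform[OF LC e]) blast
    obtain d3 where d3: "d3 > 0" "\<And>c c' y. 0 \<le> c \<Longrightarrow> 0 \<le> c' \<Longrightarrow> \<bar>c - c'\<bar> < d3 \<Longrightarrow> \<bar>f' (c, y) - f' (c', y)\<bar> \<le> e"
      by (rule C0_time_uniform[OF f' e]) blast
    obtain d4 where d4: "d4 > 0" "\<And>v a u a' u' y. v \<in> (\<lambda>s y. f' (s, y)) ` {0..} \<Longrightarrow> 0 \<le> a \<Longrightarrow> a \<le> u \<Longrightarrow> u \<le> b \<Longrightarrow> 0 \<le> a' \<Longrightarrow> a' \<le> u' \<Longrightarrow> u' \<le> b \<Longrightarrow>
      \<bar>a - a'\<bar> < d4 \<Longrightarrow> \<bar>u - u'\<bar> < d4 \<Longrightarrow> \<bar>U a u v y - U a' u' v y\<bar> \<le> e"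
      by (rule U_equicontinuous[OF equi_slices[OF f'] order_trans[OF s sb] e]) blast
    define d where "d = min (min d1 d2) (min d3 d4)"
    have "d > 0" using d1 d2 d3 d4 by (simp add: d_def)
    have "\<bar>D c' - D c\<bar> \<le> e * (k c' - k c)" if c: "s \<le> c" "c \<le> z" "z \<le> c'" "c' \<le> b" "c' - c < d" for c c'
    proof (cases "c = c'")
      case False
      have cc: "c < c'" and c0: "0 \<le> c" "0 \<le> c'" and sc': "s \<le> c'" using c False s by auto
      let ?v = "\<lambda>y. f (c, y)"
      have vC: "?v \<in> C0 UNIV" "(\<lambda>y. f (c', y)) \<in> C0 UNIV" "(\<lambda>y. f' (c, y)) \<in> C0 UNIV"
        using sl[OF f c0(1)] sl[OF f c0(2)] sl[OF f' c0(1)] by auto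
      define q where "q = U s c' (\<lambda>y. f' (c, y)) x"
      define \<Theta> where "\<Theta> w = \<beta> w * U s w (\<lambda>y. L (c, y)) x + ?Ujump w ?v" for w
      note FE = U_forward_equation[OF s c(1) less_imp_le[OF cc] graph[OF c0(1)], of x, folded \<Theta>_def]
      \<comment> \<open>The mean value theorem is applied at each y separately, with an intermediate
        time depending on y; the bound is uniform in y, so the contraction U preserves it.\<close>
      have 1: "\<bar>U s c' (\<lambda>y. f (c', y)) x - U s c' ?v x - (c' - c) * q\<bar> \<le> e * (c' - c)"
      proof -
        have "\<bar>U s c' (\<lambda>y. 1 * (f (c', y) - f (c, y)) + (- (c' - c)) * f' (c, y)) x\<bar> \<le> e * (c' - c)"
        proof (rule U_bound[OF s sc' C0_lincomb[OF closed_UNIV C0_diff[OF closed_UNIV vC(2,1)] vC(3)]])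
          fix y
          obtain \<xi> where \<xi>: "c < \<xi>" "\<xi> < c'" "f (c', y) - f (c, y) = f' (\<xi>, y) * (c' - c)"
            by (rule half_line_mvt[OF c0(1) cc, of "\<lambda>u. f (u, y)" "\<lambda>u. f' (u, y)"]) (use deriv in auto)
          have "\<bar>f' (\<xi>, y) - f' (c, y)\<bar> \<le> e" by (rule d3(2)) (use \<xi> c c0 in \<open>auto simp: d_def\<close>)
          then have "\<bar>f' (\<xi>, y) - f' (c, y)\<bar> * (c' - c) \<le> e * (c' - c)" using cc by (intro mult_right_mono) auto
          moreover have "1 * (f (c', y) - f (c, y)) + (- (c' - c)) * f' (c, y) = (f' (\<xi>, y) - f' (c, y)) * (c' - c)"
            using \<xi>(3) by (simp add: algebra_simps)
          ultimately show "\<bar>1 * (f (c', y) - f (c, y)) + (- (c' - c)) * f' (c, y)\<bar> \<le> e * (c' - c)"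
            using cc by (simp only: abs_mult)
        qed
        then show ?thesis
          unfolding U_lincomb[OF s sc' C0_diff[OF closed_UNIV vC(2,1)] vC(3)] U_diff[OF s sc' vC(2,1)]
          by (simp add: q_def algebra_simps)
      qed
      \<comment> \<open>\<open>q\<close> is frozen both at the end c' of the time window and at the
        slice c; releasing each costs e.\<close>
      have 2: "\<bar>LINT w:{c..c'}|lborel. q - \<theta>1 w\<bar> \<le> (2 * e) * (c' - c)"
      proof (rule set_integral_abs_le)
        show "set_integrable lborel {c..c'} (\<lambda>w. q - \<theta>1 w)"
          by (rule set_integral_diff(1)[OF _ \<theta>1_int[OF c(1)]]) (simp add: set_integrable_continuous_Icc)
        fix w assume w: "w \<in> {c..c'}"
        then have w0: "0 \<le> w" "s \<le> w" using c c0 by auto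
        have "\<bar>U s c' (\<lambda>y. f' (c, y)) x - U s w (\<lambda>y. f' (c, y)) x\<bar> \<le> e"
          by (rule d4(2)) (use w w0 c c0 s sc' d4(1) in \<open>auto simp: d_def\<close>)
        moreover have "\<bar>U s w (\<lambda>y. f' (c, y) - f' (w, y)) x\<bar> \<le> e"
          by (rule U_bound[OF s w0(2) C0_diff[OF closed_UNIV vC(3) sl[OF f' w0(1)]]], rule d3(2))
            (use w w0 c c0 in \<open>auto simp: d_def\<close>)
        ultimately show "\<bar>q - \<theta>1 w\<bar> \<le> 2 * e"
          unfolding U_diff[OF s w0(2) vC(3) sl[OF f' w0(1)]] q_def \<theta>1_def by linarith
      qed (use cc in simp)
      have 3: "\<bar>LINT w:{c..c'}|lborel. \<Theta> w - \<theta>2 w\<bar> \<le> e * (LINT w:{c..c'}|lborel. \<beta> w + 2 * K w)"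
      proof -
        note i = set_integral_diff(1)[OF FE(1) \<theta>2_int[OF c(1)]]
        have "\<bar>LINT w:{c..c'}|lborel. \<Theta> w - \<theta>2 w\<bar> \<le> (LINT w:{c..c'}|lborel. \<bar>\<Theta> w - \<theta>2 w\<bar>)"
          unfolding real_norm_def[symmetric] by (rule set_integral_norm_bound[OF i])
        also have "\<dots> \<le> (LINT w:{c..c'}|lborel. e * (\<beta> w + 2 * K w))"
        proof (rule set_integral_mono[OF set_integrable_abs[OF i]])
          show "set_integrable lborel {c..c'} (\<lambda>w. e * (\<beta> w + 2 * K w))"
            by (intro set_integrable_mult_right impI \<kappa>_int c(1))
          fix w assume w: "w \<in> {c..c'}"
          then have w0: "0 \<le> w" "s \<le> w" using c c0 by auto
          have close: "\<bar>f (c, y) - f (w, y)\<bar> \<le> e" "\<bar>L (c, y) - L (w, y)\<bar> \<le> e" for y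
            by (rule d1(2) d2(2); use w w0 c c0 in \<open>auto simp: d_def\<close>)+
          have "\<bar>U s w (\<lambda>y. L (c, y) - L (w, y)) x\<bar> \<le> e"
            by (rule U_bound[OF s w0(2) C0_diff[OF closed_UNIV sl[OF LC c0(1)] sl[OF LC w0(1)]] close(2)])
          then have "\<beta> w * \<bar>U s w (\<lambda>y. L (c, y)) x - U s w (\<lambda>y. L (w, y)) x\<bar> \<le> \<beta> w * e"
            unfolding U_diff[OF s w0(2) sl[OF LC c0(1)] sl[OF LC w0(1)]]
            by (rule mult_left_mono[OF _ \<beta>_nonneg[OF w0(1)]])
          then have A: "\<bar>\<beta> w * U s w (\<lambda>y. L (c, y)) x - \<beta> w * U s w (\<lambda>y. L (w, y)) x\<bar> \<le> e * \<beta> w"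
            using \<beta>_nonneg[OF w0(1)] by (simp add: right_diff_distrib[symmetric] abs_mult mult.commute)
          let ?v' = "\<lambda>y. f (w, y)"
          have v'C: "?v' \<in> C0 UNIV" by (rule sl[OF f w0(1)])
          have Ud: "\<bar>(U s w (P r ?v) x - U s w ?v x) - (U s w (P r ?v') x - U s w ?v' x)\<bar> \<le> 2 * e * min 1 r" if r: "0 < r" for r
          proof -
            note C1 = C0_diff[OF closed_UNIV P_C0[OF less_imp_le[OF r] vC(1)] vC(1)]
            note C2 = C0_diff[OF closed_UNIV P_C0[OF less_imp_le[OF r] v'C] v'C]
            have "\<bar>U s w (\<lambda>y. (P r ?v y - f (c, y)) - (P r ?v' y - f (w, y))) x\<bar> \<le> 2 * e * min 1 r"
              by (rule U_bound[OF s w0(2) C0_diff[OF closed_UNIV C1 C2]])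
                (rule P_increment_diff_bound[OF graph[OF c0(1)] graph[OF w0(1)] less_imp_le[OF r] close])
            then show ?thesis
              unfolding U_diff[OF s w0(2) C1 C2] U_diff[OF s w0(2) P_C0[OF less_imp_le[OF r] vC(1)] vC(1)]
                U_diff[OF s w0(2) P_C0[OF less_imp_le[OF r] v'C] v'C] .
          qed
          have jump_diff: "?Ujump w ?v - ?Ujump w ?v' = (LINT r:{0<..}|lborel.
              ((U s w (P r ?v) x - U s w ?v x) - (U s w (P r ?v') x - U s w ?v' x)) * g w r)"
            unfolding left_diff_distrib[of "_ - _" "_ - _"] by (rule set_integral_diff(2)[symmetric, OF
                U_jump_integrable[OF s w0(2) graph[OF c0(1)]] U_jump_integrable[OF s w0(2) graph[OF w0(1)]]])
          have Bd: "\<bar>?Ujump w ?v - ?Ujump w ?v'\<bar> \<le> 2 * e * K w"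
            unfolding jump_diff
          proof (rule g_set_integrable(2)[OF w0(1) _ Ud])
            show "set_borel_measurable borel {0<..} (\<lambda>r. (U s w (P r ?v) x - U s w ?v x) - (U s w (P r ?v') x - U s w ?v' x))"
              using U_jump_measurable[OF s w0(2) vC(1)] U_jump_measurable[OF s w0(2) v'C]
              unfolding set_borel_measurable_def scaleR_diff_right[of _ "_ - _" "_ - _"] by (rule borel_measurable_diff)
          qed
          have "\<bar>\<Theta> w - \<theta>2 w\<bar> \<le> e * \<beta> w + 2 * e * K w"
            unfolding \<Theta>_def \<theta>2_def by (rule order_trans[OF abs_diff_triangle_ineq add_mono[OF A Bd]])
          then show "\<bar>\<Theta> w - \<theta>2 w\<bar> \<le> e * (\<beta> w + 2 * K w)" by (simp add: algebra_simps)
        qed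
        also have "\<dots> = e * (LINT w:{c..c'}|lborel. \<beta> w + 2 * K w)" by (rule set_integral_mult_right)
        finally show ?thesis .
      qed
      have \<theta>_sum: "(LINT w:{c..c'}|lborel. \<theta> w) = (LINT w:{c..c'}|lborel. \<theta>1 w) + (LINT w:{c..c'}|lborel. \<theta>2 w)"
      proof -
        have "indicat_real {c..c'} w *\<^sub>R \<theta> w = indicat_real {c..c'} w *\<^sub>R (\<theta>1 w + \<theta>2 w)" for w
          using \<theta>_split[of w] c(1) by (auto simp: indicator_def)
        then have "(LINT w:{c..c'}|lborel. \<theta> w) = (LINT w:{c..c'}|lborel. \<theta>1 w + \<theta>2 w)"
          by (simp only: set_lebesgue_integral_def)
        also have "\<dots> = (LINT w:{c..c'}|lborel. \<theta>1 w) + (LINT w:{c..c'}|lborel. \<theta>2 w)"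
          by (rule set_integral_add(2)[OF \<theta>1_int[OF c(1)] \<theta>2_int[OF c(1)]])
        finally show ?thesis .
      qed
      have q_int: "(LINT w:{c..c'}|lborel. q - \<theta>1 w) = (c' - c) * q - (LINT w:{c..c'}|lborel. \<theta>1 w)"
      proof -
        have "set_integrable lborel {c..c'} (\<lambda>w. q)" by (simp add: set_integrable_continuous_Icc)
        from set_integral_diff(2)[OF this \<theta>1_int[OF c(1)]] show ?thesis
          using cc by (simp add: set_lebesgue_integral_def)
      qed
      have "D c' - D c = (U s c' (\<lambda>y. f (c', y)) x - U s c ?v x) - (LINT w:{c..c'}|lborel. \<theta> w)"
        using set_integral_Icc_combine[OF \<theta>_int[OF order_refl, of c'] c(1) less_imp_le[OF cc]] by (simp add: D_def)
      also have "\<dots> = (U s c' (\<lambda>y. f (c', y)) x - U s c' ?v x - (c' - c) * q)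
          + (LINT w:{c..c'}|lborel. q - \<theta>1 w) + (LINT w:{c..c'}|lborel. \<Theta> w - \<theta>2 w)"
        unfolding q_int set_integral_diff(2)[OF FE(1) \<theta>2_int[OF c(1)]] \<theta>_sum using FE(2) by simp
      finally have "\<bar>D c' - D c\<bar> \<le> e * (c' - c) + (2 * e) * (c' - c) + e * (LINT w:{c..c'}|lborel. \<beta> w + 2 * K w)"
        using 1 2 3 by linarith
      also have "\<dots> = e * (k c' - k c)"
      proof -
        have k: "k c' - k c = 3 * (c' - c) + (LINT w:{c..c'}|lborel. \<beta> w + 2 * K w)"
          using set_integral_Icc_combine[OF \<kappa>_int[OF order_refl, of c'] c(1) less_imp_le[OF cc]] by (simp add: k_def)
        show ?thesis unfolding k by (simp add: algebra_simps)
      qed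
      finally show ?thesis .
    qed simp
    with \<open>d > 0\<close> show "\<exists>d>0. \<forall>c c'. s \<le> c \<longrightarrow> c \<le> z \<longrightarrow> z \<le> c' \<longrightarrow> c' \<le> b \<longrightarrow> c' - c < d \<longrightarrow> \<bar>D c' - D c\<bar> \<le> e * (k c' - k c)"
      by blast
  qed
  moreover have "D s = f (s, x)"
  proof -
    have "(LINT w:{s..s}|lborel. \<theta> w) = 0"
      using set_integral_Icc_combine[OF \<theta>_int[OF order_refl, of s] order_refl order_refl] by linarith
    then show ?thesis by (simp add: D_def U_refl[OF sl[OF f s]])
  qed
  ultimately have "U s b (\<lambda>y. f (b, y)) x - f (s, x) = (LINT w:{s..b}|lborel. \<theta> w)" by (simp add: D_def)
  also have "\<dots> = (LINT u:{0..t}|lborel. \<theta> (s + u))"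
    using set_integral_Icc_shift[where a=0 and b=t and h=s and p=\<theta>] by (simp add: b_def)
  also have "\<dots> = (LINT u:{0..t}|lborel. Q u h (s, x))"
    unfolding set_lebesgue_integral_def
    by (intro Bochner_Integration.integral_cong refl) (use s in \<open>auto simp: indicator_def \<theta>_def Q_eq hC\<close>)
  also have "U s b (\<lambda>y. f (b, y)) x = Q t f (s, x)"
    using s t by (simp add: Q_eq f b_def)
  finally show ?thesis by (simp add: h_def)
qed

lemma Q_generator:
  assumes f: "f \<in> C0 time_space" and dom: "\<And>s. 0 \<le> s \<Longrightarrow> (\<lambda>y. f (s, y)) \<in> generator_dom UNIV P"
    and Lf: "zero_ext time_space (\<lambda>(s, x). generator UNIV P (\<lambda>y. f (s, y)) x) \<in> C0 time_space"
    and deriv: "\<And>s x. 0 \<le> s \<Longrightarrow> ((\<lambda>u. f (u, x)) has_real_derivative f' (s, x)) (at s within {0..})"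
    and f': "f' \<in> C0 time_space"
    and H: "DY_generator_formula M X \<beta> g f f' \<in> C0 time_space"
  shows "f \<in> generator_dom time_space Q"
    and "generator time_space Q f = DY_generator_formula M X \<beta> g f f'"
proof -
  have gr: "generator_graph time_space Q f (DY_generator_formula M X \<beta> g f f')"
    by (rule Q.generator_graphI_integral[OF f H]) (auto intro!: Q_dynkin[OF assms])
  then show "f \<in> generator_dom time_space Q" by (auto simp: generator_dom_def)
  show "generator time_space Q f = DY_generator_formula M X \<beta> g f f'"
    by (rule generator_eqI[OF Q.closed_E Q.E_nonempty _ gr]) (use f in \<open>auto intro: Q_C0\<close>)
qed

end

theorem theorem1:
  fixes M :: "real ^ 'n \<Rightarrow> 'w measure"
    and X :: "real \<Rightarrow> 'w \<Rightarrow> real ^ 'n"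
    and Z :: "real \<Rightarrow> 'w \<Rightarrow> real"
    and \<beta> :: "real \<Rightarrow> real"
    and g :: "real \<Rightarrow> real \<Rightarrow> real"
  assumes sets_M: "\<And>x y. sets (M x) = sets (M y)"
    and X_feller: "\<And>x. feller_process (M x) UNIV X (semigroup_of M X)"
    and X_start: "\<And>x. AE \<omega> in M x. X 0 \<omega> = x"
    and X_cadlag: "\<And>x \<omega>. \<omega> \<in> space (M x) \<Longrightarrow> cadlag (\<lambda>t. X t \<omega>)"
    and L_dense: "dense_in_C0 UNIV (generator_dom UNIV (semigroup_of M X))"
    and \<beta>_cont: "continuous_on {0..} \<beta>"
    and \<beta>_nonneg: "\<And>s. 0 \<le> s \<Longrightarrow> 0 \<le> \<beta> s"
    and g_cont: "continuous_on ({0..} \<times> {0..}) (\<lambda>(s, r). g s r)"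
    and g_nonneg: "\<And>s r. 0 \<le> s \<Longrightarrow> 0 \<le> r \<Longrightarrow> 0 \<le> g s r"
    and g_integrable: "\<And>s. 0 \<le> s \<Longrightarrow> set_integrable lborel {0<..} (\<lambda>r. min 1 r * g s r)"
    and Z_additive: "\<And>x. additive_subordinator (M x) Z"
    and Z_laplace: "\<And>x. has_laplace_exponent (M x) Z (psi \<beta> g)"
    and X_Z_indep: "\<And>x. indep_processes (M x) X Z"
  shows "(\<forall>s\<ge>0. \<forall>x. feller_process (M x) time_space (DY X Z s) (DY_semigroup M X Z)) \<and>
    dense_in_C0 time_space (generator_dom time_space (DY_semigroup M X Z)) \<and>
    (\<forall>f f'. f \<in> C0 time_space \<and>
        (\<forall>s\<ge>0. (\<lambda>y. f (s, y)) \<in> generator_dom UNIV (semigroup_of M X)) \<and>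
        zero_ext time_space
          (\<lambda>(s, x). generator UNIV (semigroup_of M X) (\<lambda>y. f (s, y)) x) \<in> C0 time_space \<and>
        (\<forall>s\<ge>0. \<forall>x. ((\<lambda>u. f (u, x)) has_real_derivative f' (s, x)) (at s within {0..})) \<and>
        f' \<in> C0 time_space \<and>
        DY_generator_formula M X \<beta> g f f' \<in> C0 time_space \<longrightarrow>
      f \<in> generator_dom time_space (DY_semigroup M X Z) \<and>
      generator time_space (DY_semigroup M X Z) f = DY_generator_formula M X \<beta> g f f')"
proof -
  interpret subordinated_feller M X Z \<beta> g
    by unfold_locales (fact X_feller X_start X_cadlag \<beta>_cont \<beta>_nonneg g_cont g_nonneg g_integrable
        Z_additive Z_laplace X_Z_indep)+
  show ?thesis
    using feller_process_DY Q_generator_dense Q_generator by blast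
qed

end
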